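(* Let $a<b$ be real numbers. For every $f\in C^0([a,b])$ there exists a sequence of measurable functions $\{\overline{p}_n\}_{n\in\mathbb{N}}$ on $[a,b]_{\mathcal{R}}$ that satisfies the following properties for every $1\leq p\leq\infty$: (1) $\{\overline{p}_n\}_{n\in\mathbb{N}}$ is weakly Cauchy in $\mathcal{L}^p([a,b]_{\mathcal{R}})$; (2) $\operatorname{w-lim}_{n\to\infty}\|\overline{p}_n\|_p=\|f\|_p$; (3) $\operatorname{w-lim}_{n\to\infty}\overline{p}_n(x)=f(x)$ for every real $x\in[a,b]$.
   Context: A set $F\subset\mathbb{Q}$ is left-finite if $\{x\in F: x\le q\}$ is finite for every $q\in\mathbb{Q}$. The Levi-Civita field $\mathcal{R}$ is the set of functions $x:\mathbb{Q}\to\mathbb{R}$ (values written $x[q]$) whose support $\{q: x[q]\neq 0\}$ is left-finite, with pointwise sum and product $(x\cdot y)[q]=\sum_{q_1+q_2=q}x[q_1]y[q_2]$. For $x\ne 0$, $\lambda(x)=\min\operatorname{supp}(x)$, and $\lambda(0)=\infty$. For $x\neq y$, $x<y$ iff $(x-y)[\lambda(x-y)]<0$. This makes $\mathcal{R}$ an ordered (real closed) field containing $\mathbb{R}$. $[a,b]_{\mathcal{R}}=\{x\in\mathcal{R}:a\le x\le b\}$. A sequence strongly converges to $l$ if for every $\varepsilon\in\mathcal{R}$, $\varepsilon>0$, eventually $|a_n-l|<\varepsilon$. It weakly converges to $l\in\mathcal{R}$ (written $\operatorname{w-lim}a_n=l$) if for every real $\varepsilon>0$, eventually $\max_{q\in\mathbb{Q},q\le\varepsilon^{-1}}|(a_n-l)[q]|<\varepsilon$.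 It diverges to $+\infty$ if for every $M\in\mathcal{R}$ eventually $a_n>M$. For $a\le b$ in $\mathcal{R}$, $I(a,b)$ denotes any of the four intervals of $\mathcal{R}$ with endpoints $a,b$ (degenerate intervals allowed), with length $l(I(a,b))=b-a$. A set $A\subseteq\mathcal{R}$ is measurable iff for every $\varepsilon\in\mathcal{R}$, $\varepsilon>0$, there are two sequences of mutually disjoint intervals $\{I_n\}$, $\{J_n\}$ such that $\bigcup_n I_n\subseteq A\subseteq\bigcup_n J_n$, $\sum_n l(I_n)$ and $\sum_n l(J_n)$ strongly converge, and $\sum_n l(J_n)-\sum_n l(I_n)\le\varepsilon$. The measure $m(A)\in\mathcal{R}$ is the (existing) supremum of such inner sums, equal to the infimum of such outer sums. A property holds almost everywhere (a.e.) on $A$ iff the set of points of $A$ where it holds is measurable with measure $m(A)$. A function $f$ is simple on an interval $I$ if there are $x_0,a_k\in\mathcal{R}$ such that for every $x\in I$ the partial sums $\sum_{k\le K}a_k(x-x_0)^k$ weakly converge to $f(x)$. For $A$ measurable, $f:A\to\mathcal{R}$ is measurable ($f\in\mathcal{M}(A)$) iff for every $\varepsilon\in\mathcal{R}$, $\varepsilon>0$, there is a sequence of mutually disjoint intervals $\{I_n\}$ with $\bigcup_n I_n\subseteq A$, $\sum_n l(I_n)$ strongly convergent, $m(A)-\sum_n l(I_n)<\varepsilon$, and $f$ simple on each $I_n$. If $f$ is simple on $I(a,b)$ with (termwise) antiderivative $F$, $\int_{I(a,b)}f=\lim_{x\to b}F(x)-\lim_{x\to a}F(x)$. For $f\in\mathcal{M}(A)$,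 $\int_A f$ is the limit of $\sum_n\int_{I_n}f$ (strong sum) over sequences of mutually disjoint intervals $\{I_n\}$ with $\bigcup_n I_n\subseteq A$ and $f$ simple on each $I_n$, as $\sum_n l(I_n)\to m(A)$; it is $\pm\infty$ if the partial sums diverge, and undefined if the limit does not exist. Functions equal a.e. are identified. For $1\le p<\infty$, $\mathcal{L}^p(A)$ is the set of (classes of) $f\in\mathcal{M}(A)$ with $f^p\in\mathcal{M}(A)$ such that $\int_A|f|^p$ is defined and $<+\infty$; $\|f\|_p=(\int_A|f|^p)^{1/p}$. For $p=\infty$, $\|f\|_\infty=\inf\{c\in\mathcal{R}:|f(x)|\le c\text{ for a.e. }x\in A\}$ (undefined if this infimum does not exist in $\mathcal{R}$), and $\mathcal{L}^\infty(A)$ is the set of (classes of) $f\in\mathcal{M}(A)$ for which $\|f\|_\infty$ is defined. A sequence $\{f_n\}$ in $\mathcal{L}^p(A)$ is weakly Cauchy iff for every real $\varepsilon>0$ there is $n_\varepsilon$ such that $\max_{q\in\mathbb{Q},q\le\varepsilon^{-1}}\left|\,\|f_n-f_m\|_p[q]\,\right|<\varepsilon$ for all $m,n>n_\varepsilon$. For the real function $f$, $\|f\|_p$ is the usual $L^p([a,b])$ norm.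
   Formalization: In the definition of a simple function, the partial sums must weakly converge and also have all their supports in one left-finite set; without this, one function can have weak expansions whose termwise antiderivatives give different integrals. *)

theory Defs
  imports "HOL-Analysis.Analysis" "HOL-Probability.Essential_Supremum"
begin

section \<open>The Levi-Civita field as an ordered ring\<close>

definition left_finite :: "rat set \<Rightarrow> bool" where
  "left_finite F \<longleftrightarrow> (\<forall>q. finite {x \<in> F. x \<le> q})"

lemma left_finite_empty [simp]: "left_finite {}"
  by (simp add: left_finite_def)

lemma left_finite_subset: "left_finite G \<Longrightarrow> F \<subseteq> G \<Longrightarrow> left_finite F"
proof (unfold left_finite_def, intro allI)
  fix q assume "\<forall>q. finite {x \<in> G. x \<le> q}" "F \<subseteq> G"
  then show "finite {x \<in> F. x \<le> q}"
    by (intro finite_subset[of "{x \<in> F. x \<le> q}" "{x \<in> G. x \<le> q}"]) auto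
qed

lemma left_finite_Un: "left_finite F \<Longrightarrow> left_finite G \<Longrightarrow> left_finite (F \<union> G)"
proof -
  assume "left_finite F" "left_finite G"
  moreover have "{x \<in> F \<union> G. x \<le> q} = {x \<in> F. x \<le> q} \<union> {x \<in> G. x \<le> q}" for q
    by auto
  ultimately show ?thesis by (simp add: left_finite_def)
qed

lemma left_finite_has_least:
  assumes "left_finite F" "F \<noteq> {}"
  obtains m where "m \<in> F" "\<And>q. q \<in> F \<Longrightarrow> m \<le> q"
proof -
  from assms obtain f where f: "f \<in> F" by auto
  let ?S = "{x \<in> F. x \<le> f}"
  have fin: "finite ?S" and ne: "?S \<noteq> {}" using assms f by (auto simp: left_finite_def)
  have "Min ?S \<in> ?S" using fin ne by (rule Min_in)
  moreover have "Min ?S \<le> q" if "q \<in> F" for q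
  proof (cases "q \<le> f")
    case True then show ?thesis using that fin by (intro Min_le) auto
  next
    case False
    have "Min ?S \<le> f" using fin f by (intro Min_le) auto
    then show ?thesis using False by simp
  qed
  ultimately show ?thesis using that by auto
qed

lemma left_finite_bdd_below: "left_finite F \<Longrightarrow> \<exists>m. \<forall>q\<in>F. m \<le> q"
  by (cases "F = {}") (simp, metis left_finite_has_least)

lemma left_finite_sum_pairs:
  assumes "left_finite F" "left_finite G"
  shows "finite {a \<in> F. q - a \<in> G}"
proof -
  obtain m where m: "\<forall>g\<in>G. m \<le> g" using left_finite_bdd_below[OF assms(2)] by auto
  have "{a \<in> F. q - a \<in> G} \<subseteq> {a \<in> F. a \<le> q - m}"
    using m by (auto simp: algebra_simps)
  moreover have "finite {a \<in> F. a \<le> q - m}" using assms(1) by (simp add: left_finite_def)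
  ultimately show ?thesis by (rule finite_subset)
qed

lemma left_finite_plus:
  assumes "left_finite F" "left_finite G"
  shows "left_finite {a + b | a b. a \<in> F \<and> b \<in> G}"
  unfolding left_finite_def
proof
  fix q
  obtain m where m: "\<forall>g\<in>F. m \<le> g" using left_finite_bdd_below[OF assms(1)] by auto
  obtain l where l: "\<forall>g\<in>G. l \<le> g" using left_finite_bdd_below[OF assms(2)] by auto
  let ?X = "{a \<in> F. a \<le> q - l}" and ?Y = "{b \<in> G. b \<le> q - m}"
  have "{x \<in> {a + b |a b. a \<in> F \<and> b \<in> G}. x \<le> q} \<subseteq> (\<lambda>(a, b). a + b) ` (?X \<times> ?Y)"
  proof
    fix x assume "x \<in> {x \<in> {a + b |a b. a \<in> F \<and> b \<in> G}. x \<le> q}"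
    then obtain a b where ab: "x = a + b" "a \<in> F" "b \<in> G" "a + b \<le> q" by auto
    have "m \<le> a" "l \<le> b" using m l ab by auto
    then have "a \<in> ?X" "b \<in> ?Y" using ab by auto
    then show "x \<in> (\<lambda>(a, b). a + b) ` (?X \<times> ?Y)" using ab by auto
  qed
  moreover have "finite (?X \<times> ?Y)" using assms by (simp add: left_finite_def)
  ultimately show "finite {x \<in> {a + b |a b. a \<in> F \<and> b \<in> G}. x \<le> q}"
    by (meson finite_imageI finite_subset)
qed

typedef levi_civita = "{x :: rat \<Rightarrow> real. left_finite {q. x q \<noteq> 0}}"
  morphisms coef Abs_levi_civita
  by (rule exI[of _ "\<lambda>_. 0"]) simp

setup_lifting type_definition_levi_civita

lemma levi_civita_eqI: "(\<And>q. coef x q = coef y q) \<Longrightarrow> x = y"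
  by (metis coef_inject ext)

definition supp :: "levi_civita \<Rightarrow> rat set" where
  "supp x = {q. coef x q \<noteq> 0}"

lemma left_finite_supp: "left_finite (supp x)"
  using coef[of x] by (simp add: supp_def)

instantiation levi_civita :: comm_ring_1
begin

lift_definition zero_levi_civita :: levi_civita is "\<lambda>_. 0" by simp

lift_definition one_levi_civita :: levi_civita is "\<lambda>q. if q = 0 then 1 else 0"
proof -
  have "{q::rat. (if q = 0 then 1 else 0 :: real) \<noteq> 0} = {0}" by auto
  then show "left_finite {q::rat. (if q = 0 then 1 else 0 :: real) \<noteq> 0}"
    by (simp add: left_finite_def)
qed

lift_definition plus_levi_civita :: "levi_civita \<Rightarrow> levi_civita \<Rightarrow> levi_civita"
  is "\<lambda>x y q. x q + y q"
  by (rule left_finite_subset[OF left_finite_Un]) (assumption | force)+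

lift_definition uminus_levi_civita :: "levi_civita \<Rightarrow> levi_civita" is "\<lambda>x q. - x q"
  by simp

lift_definition minus_levi_civita :: "levi_civita \<Rightarrow> levi_civita \<Rightarrow> levi_civita"
  is "\<lambda>x y q. x q - y q"
  by (rule left_finite_subset[OF left_finite_Un]) (assumption | force)+

text \<open>The sum over all \<open>q\<^sub>1 + q\<^sub>2 = q\<close> has only finitely many non-zero terms; it is
  indexed by those \<open>q\<^sub>1\<close>.\<close>

lift_definition times_levi_civita :: "levi_civita \<Rightarrow> levi_civita \<Rightarrow> levi_civita"
  is "\<lambda>x y q. \<Sum>q1 | x q1 \<noteq> 0 \<and> y (q - q1) \<noteq> 0. x q1 * y (q - q1)"
proof -
  fix x y :: "rat \<Rightarrow> real"
  assume *: "left_finite {q. x q \<noteq> 0}" "left_finite {q. y q \<noteq> 0}"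
  show "left_finite {q. (\<Sum>q1 | x q1 \<noteq> 0 \<and> y (q - q1) \<noteq> 0. x q1 * y (q - q1)) \<noteq> 0}"
  proof (rule left_finite_subset[OF left_finite_plus[OF *]], rule subsetI)
    fix q assume "q \<in> {q. (\<Sum>q1 | x q1 \<noteq> 0 \<and> y (q - q1) \<noteq> 0. x q1 * y (q - q1)) \<noteq> 0}"
    then have "\<not> (\<forall>q1\<in>{q1. x q1 \<noteq> 0 \<and> y (q - q1) \<noteq> 0}. x q1 * y (q - q1) = 0)"
      using sum.neutral[of "{q1. x q1 \<noteq> 0 \<and> y (q - q1) \<noteq> 0}" "\<lambda>q1. x q1 * y (q - q1)"] by blast
    then obtain q1 where q1: "x q1 \<noteq> 0" "y (q - q1) \<noteq> 0" by blast
    have "q = q1 + (q - q1)" by simp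
    then show "q \<in> {a + b |a b. a \<in> {q. x q \<noteq> 0} \<and> b \<in> {q. y q \<noteq> 0}}"
      using q1 by blast
  qed
qed

lemma coef_times_superset:
  assumes "finite X" "{a. coef x a \<noteq> 0 \<and> coef y (q - a) \<noteq> 0} \<subseteq> X"
  shows "coef (x * y) q = (\<Sum>a\<in>X. coef x a * coef y (q - a))"
  unfolding times_levi_civita.rep_eq using assms
  by (intro sum.mono_neutral_left) auto

lemma coef_times_commute: "coef (x * y) q = coef (y * x) q"
  unfolding times_levi_civita.rep_eq
  by (rule sum.reindex_bij_witness[of _ "\<lambda>a. q - a" "\<lambda>a. q - a"]) auto

instance
proof
  fix x y z :: levi_civita
  show "x * y = y * x" by (rule levi_civita_eqI) (rule coef_times_commute)
  show "x * y * z = x * (y * z)"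
  proof (rule levi_civita_eqI)
    fix q
    let ?A = "{a. coef x a \<noteq> 0}" and ?B = "{a. coef y a \<noteq> 0}" and ?C = "{a. coef z a \<noteq> 0}"
    have lf: "left_finite ?A" "left_finite ?B" "left_finite ?C"
      using left_finite_supp unfolding supp_def by auto
    define X where "X = {a \<in> ?A. q - a \<in> {b + c |b c. b \<in> ?B \<and> c \<in> ?C}}"
    define Z where "Z = {c \<in> ?C. q - c \<in> {a + b |a b. a \<in> ?A \<and> b \<in> ?B}}"
    have fin: "finite X" "finite Z"
      unfolding X_def Z_def by (intro left_finite_sum_pairs left_finite_plus lf)+
    have nz: "\<exists>a b. r = a + b \<and> coef u a \<noteq> 0 \<and> coef v b \<noteq> 0" if "coef (u * v) r \<noteq> 0" for u v r
    proof -
      have "\<not> (\<forall>a\<in>{a. coef u a \<noteq> 0 \<and> coef v (r - a) \<noteq> 0}. coef u a * coef v (r - a) = 0)"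
        using that sum.neutral[of "{a. coef u a \<noteq> 0 \<and> coef v (r - a) \<noteq> 0}"
            "\<lambda>a. coef u a * coef v (r - a)"]
        unfolding times_levi_civita.rep_eq by blast
      then obtain a where a: "coef u a \<noteq> 0" "coef v (r - a) \<noteq> 0" by blast
      have "r = a + (r - a)" by simp
      then show ?thesis using a by blast
    qed
    have "coef (x * y * z) q = coef (z * (x * y)) q" by (rule coef_times_commute)
    also have "\<dots> = (\<Sum>c\<in>Z. coef z c * coef (x * y) (q - c))"
      using nz[of x y] by (intro coef_times_superset fin) (unfold Z_def, blast)
    also have "\<dots> = (\<Sum>c\<in>Z. coef z c * (\<Sum>a\<in>X. coef x a * coef y (q - c - a)))"
    proof (intro sum.cong refl)
      fix c assume "c \<in> Z"
      then have c: "coef z c \<noteq> 0" by (simp add: Z_def)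
      have "{a. coef x a \<noteq> 0 \<and> coef y (q - c - a) \<noteq> 0} \<subseteq> X"
      proof
        fix a assume "a \<in> {a. coef x a \<noteq> 0 \<and> coef y (q - c - a) \<noteq> 0}"
        moreover have "q - a = (q - c - a) + c" by simp
        ultimately show "a \<in> X" using c unfolding X_def by blast
      qed
      then show "coef z c * coef (x * y) (q - c)
          = coef z c * (\<Sum>a\<in>X. coef x a * coef y (q - c - a))"
        by (simp add: coef_times_superset[OF fin(1)])
    qed
    also have "\<dots> = (\<Sum>c\<in>Z. \<Sum>a\<in>X. coef x a * (coef z c * coef y (q - a - c)))"
      by (simp add: sum_distrib_left algebra_simps)
    also have "\<dots> = (\<Sum>a\<in>X. \<Sum>c\<in>Z. coef x a * (coef z c * coef y (q - a - c)))"
      by (rule sum.swap)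
    also have "\<dots> = (\<Sum>a\<in>X. coef x a * (\<Sum>c\<in>Z. coef z c * coef y (q - a - c)))"
      by (simp add: sum_distrib_left)
    also have "\<dots> = (\<Sum>a\<in>X. coef x a * coef (z * y) (q - a))"
    proof (intro sum.cong refl)
      fix a assume "a \<in> X"
      then have a: "coef x a \<noteq> 0" by (simp add: X_def)
      have "{c. coef z c \<noteq> 0 \<and> coef y (q - a - c) \<noteq> 0} \<subseteq> Z"
      proof
        fix c assume "c \<in> {c. coef z c \<noteq> 0 \<and> coef y (q - a - c) \<noteq> 0}"
        moreover have "q - c = a + (q - a - c)" by simp
        ultimately show "c \<in> Z" using a unfolding Z_def by blast
      qed
      then show "coef x a * (\<Sum>c\<in>Z. coef z c * coef y (q - a - c))
          = coef x a * coef (z * y) (q - a)"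
        by (simp add: coef_times_superset[OF fin(2)])
    qed
    also have "\<dots> = (\<Sum>a\<in>X. coef x a * coef (y * z) (q - a))"
      by (simp add: coef_times_commute)
    also have "\<dots> = coef (x * (y * z)) q"
      using nz[of y z] by (intro coef_times_superset[symmetric] fin) (unfold X_def, blast)
    finally show "coef (x * y * z) q = coef (x * (y * z)) q" .
  qed
  show "1 * x = x"
  proof (rule levi_civita_eqI)
    fix q
    have "coef (1 * x) q = (\<Sum>a\<in>{0}. coef 1 a * coef x (q - a))"
      by (rule coef_times_superset) (auto simp: one_levi_civita.rep_eq split: if_splits)
    then show "coef (1 * x) q = coef x q" by (simp add: one_levi_civita.rep_eq)
  qed
  show "(x + y) * z = x * z + y * z"
  proof (rule levi_civita_eqI)
    fix q
    define X where "X = {a \<in> supp x \<union> supp y. q - a \<in> supp z}"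
    have fin: "finite X" unfolding X_def
      by (intro left_finite_sum_pairs left_finite_Un left_finite_supp)
    have 1: "coef (x * z) q = (\<Sum>a\<in>X. coef x a * coef z (q - a))"
      and 2: "coef (y * z) q = (\<Sum>a\<in>X. coef y a * coef z (q - a))"
      and 3: "coef ((x + y) * z) q = (\<Sum>a\<in>X. coef (x + y) a * coef z (q - a))"
      by (intro coef_times_superset fin;
          auto simp: X_def supp_def plus_levi_civita.rep_eq)+
    show "coef ((x + y) * z) q = coef (x * z + y * z) q"
      by (simp only: 1 2 3 plus_levi_civita.rep_eq sum.distrib distrib_right)
  qed
  show "x + y + z = x + (y + z)" by transfer (simp add: algebra_simps)
  show "x + y = y + x" by transfer (simp add: algebra_simps)
  show "0 + x = x" by transfer simp
  show "- x + x = 0" by transfer simp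
  show "x - y = x + - y" by transfer simp
  show "(0::levi_civita) \<noteq> 1" by transfer (metis zero_neq_one)
qed

end

lemmas coef_simps [simp] = zero_levi_civita.rep_eq one_levi_civita.rep_eq
  plus_levi_civita.rep_eq minus_levi_civita.rep_eq uminus_levi_civita.rep_eq

instantiation levi_civita :: real_algebra_1
begin

lift_definition scaleR_levi_civita :: "real \<Rightarrow> levi_civita \<Rightarrow> levi_civita"
  is "\<lambda>r x q. r * x q"
  by (rule left_finite_subset) (assumption | force)+

lemma scaleR_times_left: "r *\<^sub>R x * y = r *\<^sub>R (x * (y :: levi_civita))"
proof (rule levi_civita_eqI)
  fix q
  define X where "X = {a \<in> supp x. q - a \<in> supp y}"
  have fin: "finite X" unfolding X_def
    by (intro left_finite_sum_pairs left_finite_supp)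
  have 1: "coef (x * y) q = (\<Sum>a\<in>X. coef x a * coef y (q - a))"
    and 2: "coef (r *\<^sub>R x * y) q = (\<Sum>a\<in>X. coef (r *\<^sub>R x) a * coef y (q - a))"
    by (intro coef_times_superset fin;
        auto simp: X_def supp_def scaleR_levi_civita.rep_eq)+
  show "coef (r *\<^sub>R x * y) q = coef (r *\<^sub>R (x * y)) q"
    by (simp only: 1 2 scaleR_levi_civita.rep_eq sum_distrib_left mult.assoc)
qed

instance
proof
  fix r s :: real and x y :: levi_civita
  show "r *\<^sub>R (x + y) = r *\<^sub>R x + r *\<^sub>R y" by transfer (simp add: algebra_simps)
  show "(r + s) *\<^sub>R x = r *\<^sub>R x + s *\<^sub>R x" by transfer (simp add: algebra_simps)
  show "r *\<^sub>R s *\<^sub>R x = (r * s) *\<^sub>R x" by transfer (simp add: algebra_simps)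
  show "1 *\<^sub>R x = x" by transfer simp
  show "r *\<^sub>R x * y = r *\<^sub>R (x * y)" by (rule scaleR_times_left)
  show "x * r *\<^sub>R y = r *\<^sub>R (x * y)"
    by (metis mult.commute scaleR_times_left)
qed

end

lemma coef_scaleR [simp]: "coef (r *\<^sub>R x) q = r * coef x q"
  by (simp add: scaleR_levi_civita.rep_eq)

text \<open>The valuation \<open>\<lambda>(x) = min supp(x)\<close>.  It is only meaningful, and only used, for \<open>x \<noteq> 0\<close>.\<close>

definition val :: "levi_civita \<Rightarrow> rat" where
  "val x = (LEAST q. q \<in> supp x)"

lemma val_props:
  assumes "x \<noteq> 0"
  shows val_in_supp: "val x \<in> supp x" and val_le: "q \<in> supp x \<Longrightarrow> val x \<le> q"
proof -
  have "supp x \<noteq> {}" using assms levi_civita_eqI[of x 0] by (auto simp: supp_def)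
  then obtain m where m: "m \<in> supp x" "\<And>q. q \<in> supp x \<Longrightarrow> m \<le> q"
    using left_finite_has_least[OF left_finite_supp] by blast
  then have "val x = m" unfolding val_def by (intro Least_equality) auto
  then show "val x \<in> supp x" "q \<in> supp x \<Longrightarrow> val x \<le> q" using m by auto
qed

lemma coef_val_nz: "x \<noteq> 0 \<Longrightarrow> coef x (val x) \<noteq> 0"
  using val_in_supp[of x] by (simp add: supp_def)

lemma coef_less_val: "x \<noteq> 0 \<Longrightarrow> q < val x \<Longrightarrow> coef x q = 0"
  using val_le[of x q] by (fastforce simp: supp_def)

lemma val_eqI: "coef x q \<noteq> 0 \<Longrightarrow> (\<And>r. r < q \<Longrightarrow> coef x r = 0) \<Longrightarrow> val x = q"
  unfolding val_def by (intro Least_equality) (auto simp: supp_def not_less[symmetric])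

lemma val_uminus: "val (- x) = val x"
  by (simp add: val_def supp_def)

definition lead_pos :: "levi_civita \<Rightarrow> bool" where
  "lead_pos x \<longleftrightarrow> x \<noteq> 0 \<and> coef x (val x) > 0"

lemma lead_pos_iff: "lead_pos x \<longleftrightarrow> (\<exists>q. coef x q > 0 \<and> (\<forall>r<q. coef x r = 0))"
proof
  assume "lead_pos x"
  then show "\<exists>q. coef x q > 0 \<and> (\<forall>r<q. coef x r = 0)"
    by (intro exI[of _ "val x"]) (auto simp: lead_pos_def coef_less_val)
next
  assume "\<exists>q. coef x q > 0 \<and> (\<forall>r<q. coef x r = 0)"
  then obtain q where q: "coef x q > 0" "\<forall>r<q. coef x r = 0" by auto
  then have "val x = q" by (intro val_eqI) auto
  then show "lead_pos x" using q by (auto simp: lead_pos_def)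
qed

lemma lead_pos_cases: "x \<noteq> 0 \<Longrightarrow> lead_pos x \<or> lead_pos (- x)"
  using coef_val_nz[of x] by (auto simp: lead_pos_def val_uminus)

lemma lead_pos_asym: "lead_pos x \<Longrightarrow> \<not> lead_pos (- x)"
  by (auto simp: lead_pos_def val_uminus)

lemma lead_pos_add: "lead_pos x \<Longrightarrow> lead_pos y \<Longrightarrow> lead_pos (x + y)"
proof -
  assume "lead_pos x" "lead_pos y"
  then obtain p q where p: "coef x p > 0" "\<forall>r<p. coef x r = 0"
    and q: "coef y q > 0" "\<forall>r<q. coef y r = 0"
    by (auto simp: lead_pos_iff)
  have "coef (x + y) (min p q) > 0"
  proof (rule linorder_cases[of p q])
    assume "p < q" then show ?thesis using p q by (simp add: min_def)
  next
    assume "p = q" then show ?thesis using p q by simp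
  next
    assume "q < p" then show ?thesis using p q by (simp add: min_def)
  qed
  then show ?thesis using p q by (auto simp: lead_pos_iff intro!: exI[of _ "min p q"])
qed

lemma lead_pos_mult: "lead_pos x \<Longrightarrow> lead_pos y \<Longrightarrow> lead_pos (x * y)"
proof -
  assume "lead_pos x" "lead_pos y"
  then obtain p q where p: "coef x p > 0" "\<forall>r<p. coef x r = 0"
    and q: "coef y q > 0" "\<forall>r<q. coef y r = 0"
    by (auto simp: lead_pos_iff)
  have "coef (x * y) (p + q) = (\<Sum>a\<in>{p}. coef x a * coef y (p + q - a))"
  proof (rule coef_times_superset)
    show "{a. coef x a \<noteq> 0 \<and> coef y (p + q - a) \<noteq> 0} \<subseteq> {p}"
    proof
      fix a assume "a \<in> {a. coef x a \<noteq> 0 \<and> coef y (p + q - a) \<noteq> 0}"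
      then have "p \<le> a" "q \<le> p + q - a" using p q by (auto simp: not_less[symmetric])
      then show "a \<in> {p}" by simp
    qed
  qed simp
  then have 1: "coef (x * y) (p + q) > 0" using p q by simp
  have 2: "coef (x * y) r = 0" if "r < p + q" for r
  proof -
    have "coef (x * y) r = (\<Sum>a\<in>{}. coef x a * coef y (r - a))"
    proof (rule coef_times_superset)
      show "{a. coef x a \<noteq> 0 \<and> coef y (r - a) \<noteq> 0} \<subseteq> {}"
      proof
        fix a assume "a \<in> {a. coef x a \<noteq> 0 \<and> coef y (r - a) \<noteq> 0}"
        then have "p \<le> a" "q \<le> r - a" using p q by (auto simp: not_less[symmetric])
        then show "a \<in> {}" using that by simp
      qed
    qed simp
    then show ?thesis by simp
  qed
  from 1 2 show ?thesis by (auto simp: lead_pos_iff)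
qed

instantiation levi_civita :: linordered_idom
begin

definition less_levi_civita :: "levi_civita \<Rightarrow> levi_civita \<Rightarrow> bool" where
  "x < y \<longleftrightarrow> x \<noteq> y \<and> coef (x - y) (val (x - y)) < 0"

definition less_eq_levi_civita :: "levi_civita \<Rightarrow> levi_civita \<Rightarrow> bool" where
  "x \<le> y \<longleftrightarrow> x < y \<or> x = (y :: levi_civita)"

definition abs_levi_civita :: "levi_civita \<Rightarrow> levi_civita" where
  "\<bar>x :: levi_civita\<bar> = (if x < 0 then - x else x)"

definition sgn_levi_civita :: "levi_civita \<Rightarrow> levi_civita" where
  "sgn (x :: levi_civita) = (if x = 0 then 0 else if 0 < x then 1 else - 1)"

lemma less_iff_lead_pos: "x < y \<longleftrightarrow> lead_pos (y - x)"
  using val_uminus[of "x - y"] by (auto simp: less_levi_civita_def lead_pos_def)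

instance
proof
  fix x y z :: levi_civita
  have trans: "x < z" if "x < y" "y < z" for x y z :: levi_civita
    using lead_pos_add[of "y - x" "z - y"] that by (simp add: less_iff_lead_pos)
  have irrefl: "\<not> x < x" for x :: levi_civita by (simp add: less_levi_civita_def)
  show "(x < y) = (x \<le> y \<and> \<not> y \<le> x)"
    using trans[of x y x] irrefl by (auto simp: less_eq_levi_civita_def)
  show "x \<le> x" by (simp add: less_eq_levi_civita_def)
  show "x \<le> y \<Longrightarrow> y \<le> z \<Longrightarrow> x \<le> z"
    using trans by (auto simp: less_eq_levi_civita_def)
  show "x \<le> y \<Longrightarrow> y \<le> x \<Longrightarrow> x = y"
    using trans[of x y x] irrefl by (auto simp: less_eq_levi_civita_def)
  show "x \<le> y \<or> y \<le> x"
    using lead_pos_cases[of "y - x"] by (auto simp: less_eq_levi_civita_def less_iff_lead_pos)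
  show "x \<le> y \<Longrightarrow> z + x \<le> z + y"
    by (auto simp: less_eq_levi_civita_def less_iff_lead_pos)
  show "x < y \<Longrightarrow> 0 < z \<Longrightarrow> z * x < z * y"
    using lead_pos_mult[of z "y - x"] by (simp add: less_iff_lead_pos algebra_simps)
  show "\<bar>x\<bar> = (if x < 0 then - x else x)" by (rule abs_levi_civita_def)
  show "sgn x = (if x = 0 then 0 else if 0 < x then 1 else - 1)" by (rule sgn_levi_civita_def)
qed

end

text \<open>The monomial \<open>d\<^sup>q\<close>, where \<open>d\<close> is the positive infinitesimal with \<open>d[1] = 1\<close> and support \<open>{1}\<close>.\<close>

lift_definition d_pow :: "rat \<Rightarrow> levi_civita" is "\<lambda>q r. if r = q then 1 else 0"
proof -
  fix q :: rat
  have "{r. (if r = q then 1 else 0 :: real) \<noteq> 0} = {q}" by auto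
  then show "left_finite {r. (if r = q then 1 else 0 :: real) \<noteq> 0}"
    by (simp add: left_finite_def)
qed


section \<open>Strong and weak convergence\<close>

definition strong_lim :: "(nat \<Rightarrow> levi_civita) \<Rightarrow> levi_civita \<Rightarrow> bool" where
  "strong_lim X l \<longleftrightarrow> (\<forall>\<epsilon>>0. \<forall>\<^sub>F n in sequentially. \<bar>X n - l\<bar> < \<epsilon>)"

definition strong_sums :: "(nat \<Rightarrow> levi_civita) \<Rightarrow> levi_civita \<Rightarrow> bool" where
  "strong_sums u s \<longleftrightarrow> strong_lim (\<lambda>n. \<Sum>k<n. u k) s"

text \<open>The maximum exists because \<open>x\<close> has only finitely many non-zero values on \<open>{q. q \<le> r}\<close>.\<close>

definition max_coef :: "real \<Rightarrow> levi_civita \<Rightarrow> real" where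
  "max_coef r x = Max ((\<lambda>q. \<bar>coef x q\<bar>) ` {q. real_of_rat q \<le> r})"

lemma finite_max_coef: "finite ((\<lambda>q. \<bar>coef x q\<bar>) ` {q. real_of_rat q \<le> r})"
proof -
  obtain m :: rat where m: "r < real_of_rat m" using of_rat_dense[of r "r + 1"] by auto
  have "(\<lambda>q. \<bar>coef x q\<bar>) ` {q. real_of_rat q \<le> r}
      \<subseteq> insert 0 ((\<lambda>q. \<bar>coef x q\<bar>) ` {q \<in> supp x. q \<le> m})"
  proof
    fix v assume "v \<in> (\<lambda>q. \<bar>coef x q\<bar>) ` {q. real_of_rat q \<le> r}"
    then obtain q where q: "v = \<bar>coef x q\<bar>" "real_of_rat q \<le> r" by auto
    then have "real_of_rat q < real_of_rat m" using m by linarith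
    then have "q \<le> m" by (simp add: of_rat_less)
    then show "v \<in> insert 0 ((\<lambda>q. \<bar>coef x q\<bar>) ` {q \<in> supp x. q \<le> m})"
      using q by (cases "q \<in> supp x") (auto simp: supp_def)
  qed
  moreover have "finite {q \<in> supp x. q \<le> m}"
    using left_finite_supp[of x] by (simp add: left_finite_def)
  ultimately show ?thesis by (meson finite_imageI finite_insert finite_subset)
qed

lemma max_coef_less_iff:
  "max_coef r x < e \<longleftrightarrow> (\<forall>q. real_of_rat q \<le> r \<longrightarrow> \<bar>coef x q\<bar> < e)"
proof -
  obtain m :: rat where "real_of_rat m < r" using of_rat_dense[of "r - 1" r] by auto
  then have "(\<lambda>q. \<bar>coef x q\<bar>) ` {q. real_of_rat q \<le> r} \<noteq> {}" by (auto intro: less_imp_le)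
  then show ?thesis unfolding max_coef_def
    by (subst Max_less_iff[OF finite_max_coef]) auto
qed

definition weak_lim :: "(nat \<Rightarrow> levi_civita) \<Rightarrow> levi_civita \<Rightarrow> bool" where
  "weak_lim X l \<longleftrightarrow>
     (\<forall>\<epsilon>::real. \<epsilon> > 0 \<longrightarrow> (\<forall>\<^sub>F n in sequentially. max_coef (inverse \<epsilon>) (X n - l) < \<epsilon>))"

definition regular :: "(nat \<Rightarrow> levi_civita) \<Rightarrow> bool" where
  "regular X \<longleftrightarrow> left_finite (\<Union>n. supp (X n))"

text \<open>Limit of \<open>F\<close> at \<open>c\<close> along \<open>I\<close>, in the order topology.\<close>

definition lim_within :: "(levi_civita \<Rightarrow> levi_civita) \<Rightarrow> levi_civita \<Rightarrow> levi_civita set \<Rightarrow> levi_civita \<Rightarrow> bool"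
  where "lim_within F c I L \<longleftrightarrow>
    (\<forall>\<epsilon>>0. \<exists>\<delta>>0. \<forall>x\<in>I. x \<noteq> c \<and> \<bar>x - c\<bar> < \<delta> \<longrightarrow> \<bar>F x - L\<bar> < \<epsilon>)"


section \<open>Measurable sets\<close>

definition interval :: "levi_civita \<Rightarrow> levi_civita \<Rightarrow> levi_civita set \<Rightarrow> bool" where
  "interval a b I \<longleftrightarrow> a \<le> b \<and> I \<in> {{a..b}, {a..<b}, {a<..b}, {a<..<b}}"

text \<open>A sequence of mutually disjoint intervals \<open>I n\<close> with end points \<open>a n\<close>, \<open>b n\<close> whose
  lengths strongly sum to \<open>s\<close>.  The end points are carried along because the length is
  \<open>b n - a n\<close>.\<close>

definition interval_seq ::
  "(nat \<Rightarrow> levi_civita) \<Rightarrow> (nat \<Rightarrow> levi_civita) \<Rightarrow> (nat \<Rightarrow> levi_civita set) \<Rightarrow> levi_civita \<Rightarrow> bool"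
  where "interval_seq a b I s \<longleftrightarrow>
    (\<forall>n. interval (a n) (b n) (I n)) \<and> disjoint_family I \<and> strong_sums (\<lambda>n. b n - a n) s"

definition inner_sums :: "levi_civita set \<Rightarrow> levi_civita set" where
  "inner_sums A = {s. \<exists>a b I. interval_seq a b I s \<and> (\<Union>n. I n) \<subseteq> A}"

definition outer_sums :: "levi_civita set \<Rightarrow> levi_civita set" where
  "outer_sums A = {s. \<exists>a b J. interval_seq a b J s \<and> A \<subseteq> (\<Union>n. J n)}"

definition measurable_set :: "levi_civita set \<Rightarrow> bool" where
  "measurable_set A \<longleftrightarrow> (\<forall>\<epsilon>>0. \<exists>s\<in>inner_sums A. \<exists>t\<in>outer_sums A. t - s \<le> \<epsilon>)"

text \<open>The order of the field is not complete, so \<open>Sup\<close> and \<open>Inf\<close> are not available;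
  suprema and infima are spelled out.\<close>

definition is_sup :: "levi_civita set \<Rightarrow> levi_civita \<Rightarrow> bool" where
  "is_sup S m \<longleftrightarrow> (\<forall>s\<in>S. s \<le> m) \<and> (\<forall>u. (\<forall>s\<in>S. s \<le> u) \<longrightarrow> m \<le> u)"

definition is_inf :: "levi_civita set \<Rightarrow> levi_civita \<Rightarrow> bool" where
  "is_inf S m \<longleftrightarrow> (\<forall>s\<in>S. m \<le> s) \<and> (\<forall>u. (\<forall>s\<in>S. u \<le> s) \<longrightarrow> u \<le> m)"

definition meas :: "levi_civita set \<Rightarrow> levi_civita" where
  "meas A = (THE m. is_sup (inner_sums A) m)"

definition ae_on :: "levi_civita set \<Rightarrow> (levi_civita \<Rightarrow> bool) \<Rightarrow> bool" where
  "ae_on A P \<longleftrightarrow> measurable_set {x \<in> A. P x} \<and> meas {x \<in> A. P x} = meas A"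


section \<open>Measurable functions and the integral\<close>

text \<open>The power series \<open>\<Sum>k. c k * (x - x0) ^ k\<close> converges weakly to \<open>v\<close>.  As usual for weak
  convergence of power series over this field, the partial sums have to form a regular sequence,
  that is, their supports are contained in one left-finite set.  Without regularity a function
  can have several weak expansions whose termwise antiderivatives differ by more than a
  constant, and the integral of a simple function would not be well defined.\<close>

definition power_series_at ::
  "(nat \<Rightarrow> levi_civita) \<Rightarrow> levi_civita \<Rightarrow> levi_civita \<Rightarrow> levi_civita \<Rightarrow> bool"
  where "power_series_at c x0 x v \<longleftrightarrow>
    regular (\<lambda>K. \<Sum>k\<le>K. c k * (x - x0) ^ k) \<and> weak_lim (\<lambda>K. \<Sum>k\<le>K. c k * (x - x0) ^ k) v"

definition expansion_on ::
  "(levi_civita \<Rightarrow> levi_civita) \<Rightarrow> levi_civita set \<Rightarrow> levi_civita \<Rightarrow> (nat \<Rightarrow> levi_civita) \<Rightarrow> bool"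
  where "expansion_on f I x0 c \<longleftrightarrow> (\<forall>x\<in>I. power_series_at c x0 x (f x))"

definition simple_on :: "(levi_civita \<Rightarrow> levi_civita) \<Rightarrow> levi_civita set \<Rightarrow> bool" where
  "simple_on f I \<longleftrightarrow> (\<exists>x0 c. expansion_on f I x0 c)"

definition antideriv_coeffs :: "(nat \<Rightarrow> levi_civita) \<Rightarrow> nat \<Rightarrow> levi_civita" where
  "antideriv_coeffs c k = (case k of 0 \<Rightarrow> 0 | Suc j \<Rightarrow> (1 / real (Suc j)) *\<^sub>R c j)"

text \<open>\<open>v\<close> is the integral of the simple function \<open>f\<close> over the interval \<open>I\<close> with end points
  \<open>a \<le> b\<close>.  The universal quantifier makes the independence of the chosen expansion part of the
  definition, so that \<open>v\<close> is unique.  If \<open>a = b\<close>, then \<open>I\<close> may be empty and there is no limit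
  along \<open>I\<close> to take, but both limits in the difference would be the same.\<close>

definition has_simple_integral ::
  "(levi_civita \<Rightarrow> levi_civita) \<Rightarrow> levi_civita \<Rightarrow> levi_civita \<Rightarrow> levi_civita set \<Rightarrow> levi_civita \<Rightarrow> bool"
  where "has_simple_integral f a b I v \<longleftrightarrow> interval a b I \<and> simple_on f I \<and>
    (if a = b then v = 0
     else \<forall>x0 c. expansion_on f I x0 c \<longrightarrow>
       (\<exists>F La Lb. expansion_on F I x0 (antideriv_coeffs c) \<and>
          lim_within F b I Lb \<and> lim_within F a I La \<and> v = Lb - La))"

definition measurable_funs :: "levi_civita set \<Rightarrow> (levi_civita \<Rightarrow> levi_civita) set" where
  "measurable_funs A = {f. measurable_set A \<and>
     (\<forall>\<epsilon>>0. \<exists>a b I s. interval_seq a b I s \<and> (\<Union>n. I n) \<subseteq> A \<and> meas A - s < \<epsilon> \<and>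
        (\<forall>n. simple_on f (I n)))}"

text \<open>\<open>L\<close> is the limit of the sums of the integrals over the \<open>I n\<close> as their total length
  tends to the measure of \<open>A\<close>.  Only finite integrals are represented, not the values \<open>\<plusminus>\<infinity>\<close>.\<close>

definition has_lc_integral ::
  "levi_civita set \<Rightarrow> (levi_civita \<Rightarrow> levi_civita) \<Rightarrow> levi_civita \<Rightarrow> bool"
  where "has_lc_integral A f L \<longleftrightarrow> f \<in> measurable_funs A \<and>
    (\<forall>\<epsilon>>0. \<exists>\<delta>>0. \<forall>a b I s.
       interval_seq a b I s \<and> (\<Union>n. I n) \<subseteq> A \<and> (\<forall>n. simple_on f (I n)) \<and> meas A - s < \<delta> \<longrightarrow>
       (\<exists>v t. (\<forall>n. has_simple_integral f (a n) (b n) (I n) (v n)) \<and>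
          strong_sums v t \<and> \<bar>t - L\<bar> < \<epsilon>))"


section \<open>\<open>L\<^sup>p\<close> spaces\<close>

text \<open>\<open>y = x\<^sup>p\<close> for \<open>x \<ge> 0\<close> and real \<open>p > 0\<close>.  Writing \<open>x = r d\<^sup>q (1 + h)\<close> with \<open>r > 0\<close> real,
  \<open>q = \<lambda>(x)\<close> and \<open>h\<close> infinitesimal, \<open>x\<^sup>p = r\<^sup>p d\<^bsup>pq\<^esup> (1 + h)\<^sup>p\<close> where the last factor is the
  binomial series.  The exponent \<open>pq\<close> has to be rational: for irrational \<open>p\<close> and \<open>q \<noteq> 0\<close> the
  power does not exist in the field.  For rational \<open>p = m / n\<close> it always exists, and is the
  unique \<open>y \<ge> 0\<close> with \<open>y\<^sup>n = x\<^sup>m\<close>.\<close>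

definition has_lc_powr :: "levi_civita \<Rightarrow> real \<Rightarrow> levi_civita \<Rightarrow> bool" where
  "has_lc_powr x p y \<longleftrightarrow> (x = 0 \<and> y = 0) \<or>
     (x > 0 \<and> (\<exists>h e s.
        x = of_real (coef x (val x)) * d_pow (val x) * (1 + h) \<and>
        real_of_rat e = p * real_of_rat (val x) \<and>
        strong_sums (\<lambda>k. of_real (p gchoose k) * h ^ k) s \<and>
        y = of_real (coef x (val x) powr p) * d_pow e * s))"

definition is_abs_powr ::
  "levi_civita set \<Rightarrow> real \<Rightarrow> (levi_civita \<Rightarrow> levi_civita) \<Rightarrow> (levi_civita \<Rightarrow> levi_civita) \<Rightarrow> bool"
  where "is_abs_powr A p f g \<longleftrightarrow> (\<forall>x\<in>A. has_lc_powr \<bar>f x\<bar> p (g x))"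

text \<open>\<open>\<integral>\<^sub>A |f|\<^sup>p = L\<close>, for \<open>f \<in> M(A)\<close> with \<open>f\<^sup>p \<in> M(A)\<close>.  For non-integral \<open>p\<close> a power \<open>f\<^sup>p\<close>
  of a function with negative values only makes sense as \<open>|f|\<^sup>p\<close>, whose measurability is part of
  the definition of the integral.\<close>

definition has_Lp_integral ::
  "real \<Rightarrow> levi_civita set \<Rightarrow> (levi_civita \<Rightarrow> levi_civita) \<Rightarrow> levi_civita \<Rightarrow> bool"
  where "has_Lp_integral p A f L \<longleftrightarrow> f \<in> measurable_funs A \<and>
    (\<forall>n::nat. p = real n \<longrightarrow> (\<lambda>x. f x ^ n) \<in> measurable_funs A) \<and>
    (\<exists>g. is_abs_powr A p f g \<and> has_lc_integral A g L)"

definition has_ess_sup_norm ::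
  "levi_civita set \<Rightarrow> (levi_civita \<Rightarrow> levi_civita) \<Rightarrow> levi_civita \<Rightarrow> bool"
  where "has_ess_sup_norm A f N \<longleftrightarrow> f \<in> measurable_funs A \<and>
    is_inf {c. ae_on A (\<lambda>x. \<bar>f x\<bar> \<le> c)} N"

text \<open>\<open>L\<^sup>p(A)\<close> for \<open>1 \<le> p \<le> \<infinity>\<close>, as a set of representatives.  An integral of \<open>|f|\<^sup>p\<close>, if defined,
  is at least \<open>0\<close>, so that it is less than \<open>+\<infinity>\<close> iff it is an element of the field.\<close>

definition Lp_space :: "ereal \<Rightarrow> levi_civita set \<Rightarrow> (levi_civita \<Rightarrow> levi_civita) set" where
  "Lp_space p A = (if p = \<infinity> then {f. \<exists>N. has_ess_sup_norm A f N}
     else {f. \<exists>L. has_Lp_integral (real_of_ereal p) A f L})"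

definition has_Lp_norm ::
  "ereal \<Rightarrow> levi_civita set \<Rightarrow> (levi_civita \<Rightarrow> levi_civita) \<Rightarrow> levi_civita \<Rightarrow> bool"
  where "has_Lp_norm p A f N \<longleftrightarrow> (if p = \<infinity> then has_ess_sup_norm A f N
    else \<exists>L. has_Lp_integral (real_of_ereal p) A f L \<and> has_lc_powr L (1 / real_of_ereal p) N)"

definition weakly_Cauchy_Lp ::
  "ereal \<Rightarrow> levi_civita set \<Rightarrow> (nat \<Rightarrow> levi_civita \<Rightarrow> levi_civita) \<Rightarrow> bool"
  where "weakly_Cauchy_Lp p A f \<longleftrightarrow> (\<forall>n. f n \<in> Lp_space p A) \<and>
    (\<forall>\<epsilon>::real. \<epsilon> > 0 \<longrightarrow> (\<exists>n0. \<forall>m>n0. \<forall>n>n0.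
       \<exists>N. has_Lp_norm p A (\<lambda>x. f n x - f m x) N \<and> max_coef (inverse \<epsilon>) N < \<epsilon>))"

definition real_Lp_norm :: "ereal \<Rightarrow> real \<Rightarrow> real \<Rightarrow> (real \<Rightarrow> real) \<Rightarrow> real" where
  "real_Lp_norm p a b f =
    (if p = \<infinity> then real_of_ereal (esssup (restrict_space lborel {a..b}) (\<lambda>x. ereal \<bar>f x\<bar>))
     else (LINT x:{a..b}|lborel. \<bar>f x\<bar> powr real_of_ereal p) powr (1 / real_of_ereal p))"

end

theory Submission
  imports Defs "HOL-Complex_Analysis.Complex_Analysis"
begin

text \<open>The approximants are step functions on dyadic partitions, taking on each cell the value of
  \<open>f\<close> at its left end point. Polynomial approximants would not do: near a root, \<open>|x|\<^sup>p\<close> need not exist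
  in the field for irrational \<open>p\<close>. For step functions with real values and real break points all
  norms are real numbers, and the claims reduce to uniform continuity and Riemann sums.

  The integral quantifies over all families of intervals on which the integrand is simple and over
  all expansions on them, so the main point is that a function with finite range and a power series
  expansion on a nondegenerate interval is constant there and that the termwise antiderivative of
  the expansion is affine. On intervals that are large at the scale of the distance to the centre of
  the expansion this is the identity theorem for real power series; on infinitesimal ones only
  finitely many Taylor coefficients contribute to each coefficient of the value.\<close>

section \<open>Order, strong limits and inverses\<close>

text \<open>The intervals in the definition of the integral are arbitrary and may straddle break
  points, so knowing a step function on its cells is not enough: simplicity on such an interval must
  itself force constancy. Continuity cannot do this, since the order topology is totally
  disconnected and locally constant functions abound; only the expansion can. Finiteness of the
  range is all that the expansion argument asks of the integrand, and powers and differences of step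
  functions inherit it. Once each interval carries one value, the sum of the integrals is regrouped
  by the overlaps with the cells, and the error is at most a bound for the values times the length
  left uncovered. The partitions are dyadic because these are nested: two approximants are step
  functions on one common grid, so the norm of their difference is again a real number, and for real
  elements weak smallness is smallness in absolute value.\<close>

lemma coef_of_real [simp]: "coef (of_real r) q = (if q = 0 then r else 0)"
  by (simp add: of_real_def)

lemma of_real_mult_eq_scaleR: "of_real r * x = r *\<^sub>R (x :: levi_civita)"
  by (simp add: of_real_def)

lemma lc_less_iff: "x < y \<longleftrightarrow> (\<exists>q. coef x q < coef y q \<and> (\<forall>r<q. coef x r = coef y r))"
  by (simp add: less_iff_lead_pos lead_pos_iff) (metis eq_iff_diff_eq_0)

lemma of_real_lc_less_iff [simp]: "(of_real r :: levi_civita) < of_real s \<longleftrightarrow> r < s"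
  by (auto simp: lc_less_iff)

lemma of_real_lc_le_iff [simp]: "(of_real r :: levi_civita) \<le> of_real s \<longleftrightarrow> r \<le> s"
  by (simp add: not_less[symmetric])

lemma abs_of_real_lc [simp]: "\<bar>of_real r :: levi_civita\<bar> = of_real \<bar>r\<bar>"
  using of_real_lc_less_iff[of r 0] by (simp add: abs_levi_civita_def abs_if del: of_real_lc_less_iff)

lemma coef_d_pow [simp]: "coef (d_pow p) q = (if q = p then 1 else 0)"
  by (simp add: d_pow.rep_eq)

lemma d_pow_pos [simp]: "d_pow q > 0"
  by (auto simp: lc_less_iff intro!: exI[of _ q])

lemma d_pow_nonzero [simp]: "d_pow q \<noteq> 0"
  using d_pow_pos[of q] by force

lemma d_pow_0 [simp]: "d_pow 0 = 1"
  by (rule levi_civita_eqI) simp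

lemma lc_dense:
  fixes x y :: levi_civita
  assumes "x < y"
  obtains z where "x < z" "z < y"
proof -
  define z where "z = (1/2) *\<^sub>R (x + y)"
  have "z + z = x + y" by (simp add: z_def flip: scaleR_left_distrib)
  then have "x < z" "z < y" using assms by linarith+
  then show ?thesis using that by blast
qed

lemma abs_less_d_pow_imp: "\<bar>x\<bar> < d_pow q \<Longrightarrow> r < q \<Longrightarrow> coef x r = 0"
proof (rule ccontr)
  assume *: "\<bar>x\<bar> < d_pow q" "r < q" "coef x r \<noteq> 0"
  then have "x \<noteq> 0" by auto
  then have le: "val x \<le> r" using val_le[of x r] * by (auto simp: supp_def)
  have "d_pow q < \<bar>x\<bar>"
    unfolding lc_less_iff
  proof (intro exI[of _ "val x"] conjI allI impI)
    show "coef (d_pow q) (val x) < coef \<bar>x\<bar> (val x)"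
    proof (cases "x < 0")
      case True
      then show ?thesis using le *(2) \<open>x \<noteq> 0\<close>
        by (auto simp: abs_levi_civita_def less_levi_civita_def)
    next
      case False
      then have "0 < x" using \<open>x \<noteq> 0\<close> by simp
      then show ?thesis using le *(2) False
        by (auto simp: abs_levi_civita_def less_iff_lead_pos lead_pos_def)
    qed
    show "coef (d_pow q) s = coef \<bar>x\<bar> s" if "s < val x" for s
      using that le *(2) coef_less_val[OF \<open>x \<noteq> 0\<close> that] by (simp add: abs_levi_civita_def)
  qed
  then show False using *(1) by simp
qed

lemma abs_less_if_coef_zero:
  assumes "\<epsilon> > 0" "\<And>r. r \<le> val \<epsilon> \<Longrightarrow> coef x r = 0"
  shows "\<bar>x\<bar> < \<epsilon>"
  unfolding lc_less_iff
proof (intro exI[of _ "val \<epsilon>"] conjI allI impI)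
  have "lead_pos \<epsilon>" using assms(1) by (simp add: less_iff_lead_pos)
  then show "coef \<bar>x\<bar> (val \<epsilon>) < coef \<epsilon> (val \<epsilon>)"
    using assms(2) by (simp add: abs_levi_civita_def lead_pos_def)
  show "coef \<bar>x\<bar> r = coef \<epsilon> r" if "r < val \<epsilon>" for r
    using that assms coef_less_val[of \<epsilon> r] by (simp add: abs_levi_civita_def)
qed

text \<open>Among the positive elements the \<open>d_pow q\<close> become arbitrarily small, so
  closeness means agreement of all coefficients up to a given exponent. Strong limits thus reduce to
  eventual equality.\<close>

lemma strong_lim_iff:
  "strong_lim X l \<longleftrightarrow> (\<forall>q. \<forall>\<^sub>F n in sequentially. \<forall>r\<le>q. coef (X n) r = coef l r)"
proof safe
  fix q assume "strong_lim X l"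
  \<comment> \<open>A bound by \<open>d_pow p\<close> kills only the coefficients strictly below p;
    the shift by 1 includes the exponent q itself.\<close>
  then have "\<forall>\<^sub>F n in sequentially. \<bar>X n - l\<bar> < d_pow (q + 1)"
    by (simp add: strong_lim_def)
  then show "\<forall>\<^sub>F n in sequentially. \<forall>r\<le>q. coef (X n) r = coef l r"
  proof eventually_elim
    case (elim n)
    show ?case
    proof (intro allI impI)
      fix r assume "r \<le> q"
      then show "coef (X n) r = coef l r" using abs_less_d_pow_imp[OF elim, of r] by simp
    qed
  qed
next
  assume *: "\<forall>q. \<forall>\<^sub>F n in sequentially. \<forall>r\<le>q. coef (X n) r = coef l r"
  show "strong_lim X l"
    unfolding strong_lim_def
  proof (intro allI impI)
    fix \<epsilon> :: levi_civita assume "\<epsilon> > 0"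
    from *[rule_format, of "val \<epsilon>"]
    show "\<forall>\<^sub>F n in sequentially. \<bar>X n - l\<bar> < \<epsilon>"
      by eventually_elim (auto intro!: abs_less_if_coef_zero \<open>\<epsilon> > 0\<close>)
  qed
qed

lemma strong_lim_const [simp]: "strong_lim (\<lambda>_. l) l"
  by (simp add: strong_lim_iff)

lemma strong_lim_add: "strong_lim X l \<Longrightarrow> strong_lim Y m \<Longrightarrow> strong_lim (\<lambda>n. X n + Y n) (l + m)"
  unfolding strong_lim_iff
proof
  fix q
  assume "\<forall>q. \<forall>\<^sub>F n in sequentially. \<forall>r\<le>q. coef (X n) r = coef l r"
    "\<forall>q. \<forall>\<^sub>F n in sequentially. \<forall>r\<le>q. coef (Y n) r = coef m r"
  from this[rule_format, of q]
  show "\<forall>\<^sub>F n in sequentially. \<forall>r\<le>q. coef (X n + Y n) r = coef (l + m) r"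
    by eventually_elim simp
qed

lemma strong_lim_scaleR: "strong_lim X l \<Longrightarrow> strong_lim (\<lambda>n. c *\<^sub>R X n) (c *\<^sub>R l)"
  unfolding strong_lim_iff
proof
  fix q
  assume "\<forall>q. \<forall>\<^sub>F n in sequentially. \<forall>r\<le>q. coef (X n) r = coef l r"
  from this[rule_format, of q]
  show "\<forall>\<^sub>F n in sequentially. \<forall>r\<le>q. coef (c *\<^sub>R X n) r = coef (c *\<^sub>R l) r"
    by eventually_elim simp
qed

lemma strong_lim_diff:
  assumes "strong_lim X l" "strong_lim Y m"
  shows "strong_lim (\<lambda>n. X n - Y n) (l - m)"
  using strong_lim_add[OF assms(1) strong_lim_scaleR[OF assms(2), of "-1"]] by simp

lemma strong_lim_nonneg:
  assumes "strong_lim X l" "\<And>n. 0 \<le> X n"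
  shows "0 \<le> l"
proof (rule ccontr)
  assume "\<not> 0 \<le> l"
  then have "\<forall>\<^sub>F n in sequentially. \<bar>X n - l\<bar> < - l"
    using assms(1) by (simp add: strong_lim_def)
  then obtain n where "\<bar>X n - l\<bar> < - l" by (auto simp: eventually_sequentially)
  then show False using assms(2)[of n] by (simp add: abs_less_iff)
qed

lemma strong_lim_le:
  assumes "strong_lim X l" "\<And>n. X n \<le> C"
  shows "l \<le> C"
  using strong_lim_nonneg[OF strong_lim_diff[OF strong_lim_const assms(1)], of C] assms(2) by simp

lemma strong_lim_Suc_iff: "strong_lim (\<lambda>n. X (Suc n)) l \<longleftrightarrow> strong_lim X l"
  unfolding strong_lim_iff
  by (subst eventually_sequentially_Suc[symmetric, of "\<lambda>n. \<forall>r\<le>_. coef (X n) r = coef l r"]) (rule refl)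

lemma strong_sums_finite_support:
  assumes "finite A" "\<And>n. n \<notin> A \<Longrightarrow> u n = 0"
  shows "strong_sums u (\<Sum>n\<in>A. u n)"
proof -
  obtain N where N: "\<And>n. n \<in> A \<Longrightarrow> n < N" using assms(1) finite_nat_set_iff_bounded by auto
  have "(\<Sum>k<n. u k) = (\<Sum>n\<in>A. u n)" if "n \<ge> N" for n
    using assms N that by (intro sum.mono_neutral_right) (auto, force)
  then have "\<forall>\<^sub>F n in sequentially. (\<Sum>k<n. u k) = (\<Sum>n\<in>A. u n)"
    by (auto simp: eventually_sequentially)
  then show ?thesis unfolding strong_sums_def strong_lim_iff
    by (auto elim: eventually_mono)
qed

lemma strong_sums_imp_lim_0:
  assumes "strong_sums u s"
  shows "strong_lim u 0"
  using strong_lim_diff[of "\<lambda>n. \<Sum>k<Suc n. u k" s "\<lambda>n. \<Sum>k<n. u k" s] assms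
    strong_lim_Suc_iff[of "\<lambda>n. \<Sum>k<n. u k" s]
  by (simp add: strong_sums_def)

lemma coef_sum: "coef (\<Sum>k\<in>A. u k) q = (\<Sum>k\<in>A. coef (u k) q)"
  by (induction A rule: infinite_finite_induct) auto

text \<open>The field is Cauchy complete and non-archimedean, so terms tending to 0 suffice.\<close>

lemma strong_summable_if_lim_0:
  assumes "strong_lim u 0"
  shows "\<exists>s. strong_sums u s"
proof -
  from assms have "\<exists>N. \<forall>q. \<forall>n\<ge>N q. \<forall>r\<le>q. coef (u n) r = 0"
    by (intro choice) (simp add: strong_lim_iff eventually_sequentially)
  then obtain N where N: "\<And>q n r. n \<ge> N q \<Longrightarrow> r \<le> q \<Longrightarrow> coef (u n) r = 0" by blast
  define \<sigma> where "\<sigma> q = (\<Sum>k<N q. coef (u k) q)" for q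
  have \<sigma>: "\<sigma> r = (\<Sum>k<n. coef (u k) r)" if "r \<le> q" "n \<ge> N q" for r q n
  proof -
    have "\<sigma> r = (\<Sum>k<N r + N q. coef (u k) r)" unfolding \<sigma>_def
      by (rule sum.mono_neutral_left) (auto intro: N)
    also have "\<dots> = (\<Sum>k<N q. coef (u k) r)"
      using that by (intro sum.mono_neutral_right) (auto intro: N)
    also have "\<dots> = (\<Sum>k<n. coef (u k) r)"
      using that by (intro sum.mono_neutral_left) (auto intro: N)
    finally show ?thesis .
  qed
  have "left_finite {q. \<sigma> q \<noteq> 0}"
    unfolding left_finite_def
  proof
    fix q
    have "{x \<in> {q. \<sigma> q \<noteq> 0}. x \<le> q} \<subseteq> (\<Union>k<N q. {x \<in> supp (u k). x \<le> q})"
    proof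
      fix x assume x: "x \<in> {x \<in> {q. \<sigma> q \<noteq> 0}. x \<le> q}"
      then have "(\<Sum>k<N q. coef (u k) x) \<noteq> 0" using \<sigma>[of x q "N q"] by auto
      then obtain k where "k < N q" "coef (u k) x \<noteq> 0"
        by (meson lessThan_iff sum.neutral)
      then show "x \<in> (\<Union>k<N q. {x \<in> supp (u k). x \<le> q})" using x by (auto simp: supp_def)
    qed
    moreover have "finite (\<Union>k<N q. {x \<in> supp (u k). x \<le> q})"
      using left_finite_supp by (auto simp: left_finite_def)
    ultimately show "finite {x \<in> {q. \<sigma> q \<noteq> 0}. x \<le> q}" by (rule finite_subset)
  qed
  then have c: "coef (Abs_levi_civita \<sigma>) = \<sigma>" by (simp add: Abs_levi_civita_inverse)
  have "strong_sums u (Abs_levi_civita \<sigma>)"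
    unfolding strong_sums_def strong_lim_iff eventually_sequentially
    using \<sigma> by (fastforce simp: c coef_sum)
  then show ?thesis ..
qed

section \<open>Exponents in products and powers, and inverses\<close>

lemma coef_mult_eq_0:
  assumes "\<And>r. r < m \<Longrightarrow> coef x r = 0" "\<And>r. r < n \<Longrightarrow> coef y r = 0" "q < m + n"
  shows "coef (x * y) q = 0"
proof -
  have "{a. coef x a \<noteq> 0 \<and> coef y (q - a) \<noteq> 0} \<subseteq> {}"
  proof
    fix a assume "a \<in> {a. coef x a \<noteq> 0 \<and> coef y (q - a) \<noteq> 0}"
    then have "m \<le> a" "n \<le> q - a" using assms(1,2) by (auto simp: not_less[symmetric])
    then show "a \<in> {}" using assms(3) by simp
  qed
  then show ?thesis using coef_times_superset[of "{}" x y q] by simp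
qed

lemma coef_power_eq_0:
  assumes "\<And>r. r < m \<Longrightarrow> coef x r = 0" "q < of_nat k * m"
  shows "coef (x ^ k) q = 0"
  using assms(2)
proof (induction k arbitrary: q)
  case (Suc k)
  show ?case unfolding power_Suc
    by (rule coef_mult_eq_0[of m _ "of_nat k * m"]) (use assms(1) Suc in \<open>auto simp: algebra_simps\<close>)
qed simp

lemma coef_d_pow_mult [simp]: "coef (d_pow p * x) q = coef x (q - p)"
proof -
  have "coef (d_pow p * x) q = (\<Sum>a\<in>{p}. coef (d_pow p) a * coef x (q - a))"
    by (rule coef_times_superset) auto
  then show ?thesis by simp
qed

text \<open>The support has a least element, so vanishing at all r \<le> 0 leaves a gap up to a
  positive rational. Multiples of that rational outgrow every exponent, which is why high powers of
  an infinitesimal vanish up to any given exponent.\<close>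

lemma infinitesimal_gap:
  assumes "\<And>r. r \<le> 0 \<Longrightarrow> coef x r = 0"
  obtains m where "m > 0" "\<And>r. r < m \<Longrightarrow> coef x r = 0"
proof (cases "x = 0")
  case True
  then show ?thesis using that[of 1] by simp
next
  case False
  then have "val x > 0" using coef_val_nz[of x] assms[of "val x"] by (cases "val x \<le> 0") auto
  then show ?thesis using that[of "val x"] coef_less_val[OF False] by blast
qed

lemma strong_lim_mult_const:
  assumes "strong_lim X l"
  shows "strong_lim (\<lambda>n. c * X n) (c * l)"
  unfolding strong_lim_iff
proof
  fix q
  show "\<forall>\<^sub>F n in sequentially. \<forall>r\<le>q. coef (c * X n) r = coef (c * l) r"
  proof (cases "c = 0")
    case False
    \<comment> \<open>Exponents r \<le> q of the product see exponents of the second factor only up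
      to q - \<open>val c\<close>; the 1 turns this into the strict bound of
      \<open>coef_mult_eq_0\<close>.\<close>
    have "\<forall>\<^sub>F n in sequentially. \<forall>r\<le>q + 1 - val c. coef (X n) r = coef l r"
      using assms by (simp add: strong_lim_iff)
    then show ?thesis
    proof eventually_elim
      case (elim n)
      show ?case
      proof (intro allI impI)
        fix r assume "r \<le> q"
        have "coef (c * (X n - l)) r = 0"
          by (rule coef_mult_eq_0[of "val c" _ "q + 1 - val c"])
            (use elim coef_less_val[OF False] \<open>r \<le> q\<close> in auto)
        then show "coef (c * X n) r = coef (c * l) r" by (simp add: algebra_simps)
      qed
    qed
  qed simp
qed

lemma strong_lim_unique: "strong_lim X l \<Longrightarrow> strong_lim X m \<Longrightarrow> l = m"
proof (rule levi_civita_eqI)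
  fix q assume "strong_lim X l" "strong_lim X m"
  then have "\<forall>\<^sub>F n in sequentially. \<forall>r\<le>q. coef (X n) r = coef l r"
    "\<forall>\<^sub>F n in sequentially. \<forall>r\<le>q. coef (X n) r = coef m r"
    by (simp_all add: strong_lim_iff)
  then have "\<forall>\<^sub>F n in sequentially. coef l q = coef m q"
    by eventually_elim (metis order_refl)
  then show "coef l q = coef m q" by simp
qed

text \<open>Geometric series: \<open>e\<close> cancels the leading term of u, so that
  \<open>e * u\<close> is 1 - z with z infinitesimal, and the powers of z are strongly summable. The
  type is an ordered integral domain, so the inverse appears as a witness and not as an
  operation.\<close>

lemma lc_inverse:
  fixes u :: levi_civita
  assumes "u \<noteq> 0"
  obtains u' where "u * u' = 1"
proof -
  define \<rho> where "\<rho> = coef u (val u)"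
  have \<rho>: "\<rho> \<noteq> 0" using coef_val_nz[OF assms] by (simp add: \<rho>_def)
  define e where "e = (1 / \<rho>) *\<^sub>R d_pow (- val u)"
  define z where "z = 1 - e * u"
  have z: "coef z r = 0" if "r \<le> 0" for r
    using that \<rho> coef_less_val[OF assms, of "r + val u"]
    by (auto simp: z_def e_def \<rho>_def)
  obtain m where m: "m > 0" "\<And>r. r < m \<Longrightarrow> coef z r = 0" using infinitesimal_gap[OF z] by blast
  have "strong_lim (\<lambda>k. z ^ k) 0"
    unfolding strong_lim_iff
  proof
    fix q
    obtain K where K: "q < of_nat K * m" using ex_less_of_nat_mult[OF m(1)] by blast
    have "\<forall>r\<le>q. coef (z ^ k) r = coef 0 r" if "k \<ge> K" for k
    proof (intro allI impI)
      fix r assume "r \<le> q"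
      also note K
      also have "of_nat K * m \<le> of_nat k * m" using that m(1) by simp
      finally show "coef (z ^ k) r = coef 0 r" using coef_power_eq_0[OF m(2)] by simp
    qed
    then show "\<forall>\<^sub>F k in sequentially. \<forall>r\<le>q. coef (z ^ k) r = coef 0 r"
      by (auto simp: eventually_sequentially)
  qed
  note z0 = this
  then obtain s where s: "strong_lim (\<lambda>n. \<Sum>k<n. z ^ k) s"
    using strong_summable_if_lim_0 unfolding strong_sums_def by blast
  have "(1 - z) * (\<Sum>k<n. z ^ k) = 1 - z ^ n" for n
    by (simp add: one_diff_power_eq)
  then have "strong_lim (\<lambda>n. 1 - z ^ n) ((1 - z) * s)"
    using strong_lim_mult_const[OF s, of "1 - z"] by simp
  moreover have "strong_lim (\<lambda>n. 1 - z ^ n) (1 - 0)"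
    by (rule strong_lim_diff[OF strong_lim_const z0])
  ultimately have "(1 - z) * s = 1" using strong_lim_unique by fastforce
  then have "u * (e * s) = 1" by (simp add: z_def algebra_simps)
  then show ?thesis by (rule that)
qed

lemma ex_small_mult:
  fixes v \<epsilon> :: levi_civita
  assumes "\<epsilon> > 0"
  obtains \<delta> where "\<delta> > 0" "\<bar>v\<bar> * \<delta> < \<epsilon>"
proof -
  \<comment> \<open>The inverse of 1 + |v|, which is nonzero also for v = 0; the witness for
    \<delta> is \<open>\<epsilon> * i\<close>.\<close>
  obtain i where i: "(1 + \<bar>v\<bar>) * i = 1" using lc_inverse[of "1 + \<bar>v\<bar>"]
    by (metis abs_ge_zero add_nonneg_eq_0_iff zero_le_one zero_neq_one)
  have "i > 0" using i by (metis abs_ge_zero add_pos_nonneg zero_less_mult_pos zero_less_one)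
  then have "\<epsilon> * i > 0" using assms by simp
  moreover have "\<epsilon> = \<bar>v\<bar> * (\<epsilon> * i) + \<epsilon> * i" using i by (metis distrib_left mult.assoc mult.commute mult_1 add.commute mult.right_neutral)
  ultimately show ?thesis using that[of "\<epsilon> * i"] by linarith
qed

section \<open>Coefficientwise convergence of power series\<close>

lemma weak_lim_imp_coef:
  assumes "weak_lim X l"
  shows "(\<lambda>n. coef (X n) q) \<longlonglongrightarrow> coef l q"
proof (rule LIMSEQ_I)
  fix \<epsilon> :: real assume "\<epsilon> > 0"
  \<comment> \<open>In a weak limit one parameter bounds both the error and, through its inverse,
    the exponents: \<delta> must be at most \<epsilon> and so small that its inverse reaches
    q.\<close>
  define \<delta> where "\<delta> = min \<epsilon> (1 / (\<bar>real_of_rat q\<bar> + 1))"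
  have \<delta>: "\<delta> > 0" "\<delta> \<le> \<epsilon>" using \<open>\<epsilon> > 0\<close> by (auto simp: \<delta>_def add_nonneg_pos)
  have "\<bar>real_of_rat q\<bar> + 1 \<le> inverse \<delta>"
    using \<delta>(1) by (intro order_trans[OF _ le_imp_inverse_le[of \<delta> "1 / (\<bar>real_of_rat q\<bar> + 1)"]])
      (auto simp: \<delta>_def)
  then have q: "real_of_rat q \<le> inverse \<delta>" by linarith
  have "\<forall>\<^sub>F n in sequentially. max_coef (inverse \<delta>) (X n - l) < \<delta>"
    using assms \<delta>(1) by (simp add: weak_lim_def)
  then have "\<forall>\<^sub>F n in sequentially. norm (coef (X n) q - coef l q) < \<epsilon>"
    using q \<delta>(2) by (auto simp: max_coef_less_iff elim!: eventually_mono dest!: spec[of _ q])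
  then show "\<exists>no. \<forall>n\<ge>no. norm (coef (X n) q - coef l q) < \<epsilon>"
    by (simp add: eventually_sequentially)
qed

text \<open>By regularity only finitely many exponents up to the inverse of \<epsilon> can carry a
  nonzero difference, so coefficientwise convergence is uniform over the exponents that
  count.\<close>

lemma weak_lim_if_regular:
  assumes "regular X" "\<And>q. (\<lambda>n. coef (X n) q) \<longlonglongrightarrow> coef l q"
  shows "weak_lim X l"
  unfolding weak_lim_def
proof (intro allI impI)
  fix \<epsilon> :: real assume "\<epsilon> > 0"
  obtain m :: rat where m: "inverse \<epsilon> < real_of_rat m"
    using of_rat_dense[of "inverse \<epsilon>" "inverse \<epsilon> + 1"] by auto
  define L where "L = (\<Union>n. supp (X n)) \<union> supp l"
  have "left_finite L"
    using assms(1) unfolding L_def regular_def by (rule left_finite_Un[OF _ left_finite_supp])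
  then have "finite {q \<in> L. q \<le> m}" by (simp add: left_finite_def)
  moreover have "\<forall>\<^sub>F n in sequentially. \<bar>coef (X n - l) q\<bar> < \<epsilon>" for q
    using tendstoD[OF assms(2)[of q] \<open>\<epsilon> > 0\<close>] by (simp add: dist_real_def)
  ultimately have "\<forall>\<^sub>F n in sequentially. \<forall>q\<in>{q \<in> L. q \<le> m}. \<bar>coef (X n - l) q\<bar> < \<epsilon>"
    by (intro eventually_ball_finite) auto
  then show "\<forall>\<^sub>F n in sequentially. max_coef (inverse \<epsilon>) (X n - l) < \<epsilon>"
  proof eventually_elim
    case (elim n)
    show ?case unfolding max_coef_less_iff
    proof (intro allI impI)
      fix q assume "real_of_rat q \<le> inverse \<epsilon>"
      then have "real_of_rat q < real_of_rat m" using m by linarith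
      then have "q \<le> m" by (simp add: of_rat_less)
      then show "\<bar>coef (X n - l) q\<bar> < \<epsilon>"
        using elim \<open>\<epsilon> > 0\<close> by (cases "q \<in> L") (auto simp: L_def supp_def)
    qed
  qed
qed

text \<open>Each term is a difference of consecutive partial sums, so terms and partial sums have
  the same union of supports. Under regularity, weak and coefficientwise convergence agree.\<close>

lemma power_series_at_iff:
  "power_series_at c x0 x v \<longleftrightarrow> left_finite (\<Union>k. supp (c k * (x - x0) ^ k)) \<and>
     (\<forall>q. (\<lambda>k. coef (c k * (x - x0) ^ k) q) sums coef v q)"
proof -
  define t where "t k = c k * (x - x0) ^ k" for k
  have sub1: "(\<Union>K. supp (\<Sum>k\<le>K. t k)) \<subseteq> (\<Union>k. supp (t k))"
  proof safe
    fix q K assume "q \<in> supp (\<Sum>k\<le>K. t k)"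
    then have "(\<Sum>k\<le>K. coef (t k) q) \<noteq> 0" by (simp add: supp_def coef_sum)
    then obtain k where "coef (t k) q \<noteq> 0" by (meson sum.neutral)
    then show "q \<in> (\<Union>k. supp (t k))" by (auto simp: supp_def)
  qed
  have sub2: "(\<Union>k. supp (t k)) \<subseteq> (\<Union>K. supp (\<Sum>k\<le>K. t k))"
  proof safe
    fix q k assume q: "q \<in> supp (t k)"
    show "q \<in> (\<Union>K. supp (\<Sum>k\<le>K. t k))"
    proof (cases k)
      case 0
      then show ?thesis using q by (auto intro!: exI[of _ 0])
    next
      case (Suc j)
      have "coef (\<Sum>k\<le>Suc j. t k) q = coef (\<Sum>k\<le>j. t k) q + coef (t k) q"
        using Suc by simp
      then have "coef (\<Sum>k\<le>Suc j. t k) q \<noteq> 0 \<or> coef (\<Sum>k\<le>j. t k) q \<noteq> 0"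
        using q by (auto simp: supp_def)
      then show ?thesis by (auto simp: supp_def simp del: sum.atMost_Suc)
    qed
  qed
  have reg: "regular (\<lambda>K. \<Sum>k\<le>K. t k) \<longleftrightarrow> left_finite (\<Union>k. supp (t k))"
    using sub1 sub2 by (simp add: regular_def subset_antisym)
  have "(\<lambda>k. coef (t k) q) sums coef v q \<longleftrightarrow> (\<lambda>K. coef (\<Sum>k\<le>K. t k) q) \<longlonglongrightarrow> coef v q" for q
    by (simp add: sums_def_le coef_sum)
  then show ?thesis
    unfolding power_series_at_def t_def[symmetric] reg[symmetric]
    using weak_lim_imp_coef weak_lim_if_regular by blast
qed

text \<open>Of regularity only a common lower bound for the supports is kept. It suffices for
  products with a fixed y: each coefficient of \<open>t k * y\<close> is then a sum over one finite
  index set that does not depend on k.\<close>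

definition coef_sums :: "(nat \<Rightarrow> levi_civita) \<Rightarrow> levi_civita \<Rightarrow> bool" where
  "coef_sums t T \<longleftrightarrow> (\<exists>m. \<forall>k. \<forall>r<m. coef (t k) r = 0) \<and> (\<forall>q. (\<lambda>k. coef (t k) q) sums coef T q)"

lemma coef_sums_mult_right:
  assumes "coef_sums t T"
  shows "coef_sums (\<lambda>k. t k * y) (T * y)"
proof -
  obtain m where m: "\<And>k r. r < m \<Longrightarrow> coef (t k) r = 0"
    and sums: "\<And>q. (\<lambda>k. coef (t k) q) sums coef T q"
    using assms by (auto simp: coef_sums_def)
  have T: "coef T r = 0" if "r < m" for r
    using sums[of r] m[OF that] sums_unique2[of "\<lambda>_. 0" 0 "coef T r"] by simp
  obtain n where n: "\<And>r. r \<in> supp y \<Longrightarrow> n \<le> r"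
    using left_finite_bdd_below[OF left_finite_supp[of y]] by auto
  have y: "coef y r = 0" if "r < n" for r
    using n[of r] that by (force simp: supp_def)
  have "(\<lambda>k. coef (t k * y) q) sums coef (T * y) q" for q
  proof -
    define X where "X = {a \<in> supp y. a \<le> q - m}"
    have fin: "finite X" using left_finite_supp by (simp add: X_def left_finite_def)
    have X: "coef (s * y) q = (\<Sum>a\<in>X. coef y a * coef s (q - a))"
      if "\<And>r. r < m \<Longrightarrow> coef s r = 0" for s
      unfolding coef_times_commute[of s y]
    proof (rule coef_times_superset[OF fin], rule subsetI)
      fix a assume "a \<in> {a. coef y a \<noteq> 0 \<and> coef s (q - a) \<noteq> 0}"
      then have "a \<in> supp y" "m \<le> q - a" using that by (auto simp: supp_def not_less[symmetric])
      then show "a \<in> X" by (simp add: X_def algebra_simps)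
    qed
    have "(\<lambda>k. \<Sum>a\<in>X. coef y a * coef (t k) (q - a)) sums (\<Sum>a\<in>X. coef y a * coef T (q - a))"
      by (intro sums_sum sums_mult sums)
    then show ?thesis using X[OF m] X[OF T] by simp
  qed
  moreover have "\<forall>k. \<forall>r<m + n. coef (t k * y) r = 0"
    using coef_mult_eq_0[OF m y] by simp
  ultimately show ?thesis unfolding coef_sums_def by blast
qed

section \<open>Real polynomials, power series, and series divided termwise by k + 1\<close>

text \<open>Induction on the degree: \<open>p r K - 2 ^ Suc J * p (r / 2) K\<close> loses its top
  coefficient, while each lower one is only multiplied by the nonzero constant
  \<open>1 - 2 ^ (Suc J - j)\<close>.\<close>

lemma polynomial_coeffs_convergent:
  fixes a :: "nat \<Rightarrow> nat \<Rightarrow> real"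
  assumes "\<And>r. r \<in> {0..1} \<Longrightarrow> convergent (\<lambda>K. \<Sum>j\<le>J. a j K * r ^ j)" "j \<le> J"
  shows "convergent (a j)"
  using assms
proof (induction J arbitrary: a j)
  case 0
  then show ?case using "0.prems"(1)[of 1] by simp
next
  case (Suc J)
  define p where "p r K = (\<Sum>j\<le>Suc J. a j K * r ^ j)" for r K
  have lower: "convergent (a j)" if "j \<le> J" for j
  proof -
    have "convergent (\<lambda>K. \<Sum>j\<le>J. (a j K * (1 - 2 ^ (Suc J - j))) * r ^ j)"
      if r: "r \<in> {0..1}" for r :: real
    proof -
      have "convergent (\<lambda>K. p r K - 2 ^ Suc J * p (r / 2) K)"
        using Suc.prems(1)[of r] Suc.prems(1)[of "r / 2"] r unfolding p_def
        by (intro convergent_diff convergent_mult convergent_const) auto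
      moreover have "p r K - 2 ^ Suc J * p (r / 2) K
          = (\<Sum>j\<le>J. (a j K * (1 - 2 ^ (Suc J - j))) * r ^ j)" for K
      proof -
        have "(2::real) ^ Suc J = 2 ^ (Suc J - j) * 2 ^ j" if "j \<le> Suc J" for j
          using that by (simp flip: power_add)
        then have eq: "a j K * r ^ j - 2 ^ Suc J * (a j K * (r / 2) ^ j)
            = (a j K * (1 - 2 ^ (Suc J - j))) * r ^ j" if "j \<le> Suc J" for j
          using that by (simp add: power_divide algebra_simps del: power_Suc)
        have "p r K - 2 ^ Suc J * p (r / 2) K
            = (\<Sum>j\<le>Suc J. a j K * r ^ j - 2 ^ Suc J * (a j K * (r / 2) ^ j))"
          unfolding p_def sum_distrib_left sum_subtractf ..
        also have "\<dots> = (\<Sum>j\<le>Suc J. (a j K * (1 - 2 ^ (Suc J - j))) * r ^ j)"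
          by (intro sum.cong eq refl) simp
        finally show ?thesis by simp
      qed
      ultimately show ?thesis by simp
    qed
    from Suc.IH[OF this \<open>j \<le> J\<close>] have "convergent (\<lambda>K. a j K * (1 - 2 ^ (Suc J - j)))" .
    moreover have "1 < (2::real) ^ (Suc J - j)"
      using that by (intro one_less_power) auto
    then have "(1 - 2 ^ (Suc J - j) :: real) \<noteq> 0" by linarith
    ultimately show ?thesis using convergent_mult_const_right_iff[of "1 - 2 ^ (Suc J - j)" "a j"] by blast
  qed
  show ?case
  proof (cases "j = Suc J")
    case True
    have "convergent (p 1)" using Suc.prems(1)[of 1] by (simp add: p_def[abs_def])
    then have "convergent (\<lambda>K. p 1 K - (\<Sum>j\<le>J. a j K))"
      by (intro convergent_diff convergent_sum) (simp_all add: lower)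
    then show ?thesis by (simp add: p_def True)
  next
    case False
    then show ?thesis using lower Suc.prems(2) by simp
  qed
qed

text \<open>By the pigeonhole principle some value is taken infinitely often, and the polynomial
  minus that value has infinitely many roots.\<close>

lemma polynomial_finite_range:
  fixes \<alpha> :: "nat \<Rightarrow> real"
  assumes "finite ((\<lambda>r. \<Sum>j\<le>J. \<alpha> j * r ^ j) ` {0..1})" "0 < j" "j \<le> J"
  shows "\<alpha> j = 0"
proof -
  let ?p = "\<lambda>r. \<Sum>j\<le>J. \<alpha> j * r ^ j"
  have "infinite {0..1::real}" by (simp add: infinite_Icc)
  from pigeonhole_infinite[OF this assms(1)]
  obtain s where s: "infinite {r \<in> {0..1}. ?p r = ?p s}" by blast
  define v where "v = ?p s"
  define c where "c i = \<alpha> i - (if i = 0 then v else 0)" for i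
  have "(\<Sum>i\<le>J. c i * r ^ i) = ?p r - v" for r
  proof -
    have "(\<Sum>i\<le>J. (if i = 0 then v else 0) * r ^ i) = (\<Sum>i\<le>J. if i = 0 then v else 0)"
      by (intro sum.cong) auto
    then show ?thesis by (simp add: c_def left_diff_distrib sum_subtractf)
  qed
  then have "infinite {r. (\<Sum>i\<le>J. c i * r ^ i) = 0}"
    using s by (elim infinite_super[rotated]) (auto simp: v_def)
  then have "c j = 0" using polyfun_finite_roots[of c J] assms(3) by auto
  then show ?thesis using assms(2) by (simp add: c_def)
qed

text \<open>Some value is taken at infinitely many points, which accumulate inside the disc of
  radius max |r1| |r2|. The complexified series converges there, so the identity theorem makes it
  equal to that value on the whole disc. The interval itself need not contain 0.\<close>

lemma powser_finite_range:
  fixes a :: "nat \<Rightarrow> real"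
  assumes "r1 < r2" "\<And>r. r \<in> {r1<..<r2} \<Longrightarrow> (\<lambda>k. a k * r ^ k) sums G r"
    "finite (G ` {r1<..<r2})" "0 < k"
  shows "a k = 0"
proof (rule ccontr)
  assume "a k \<noteq> 0"
  define R where "R = max \<bar>r1\<bar> \<bar>r2\<bar>"
  have "R > 0" using assms(1) by (auto simp: R_def)
  have inside: "\<exists>r\<in>{r1<..<r2}. \<rho> < \<bar>r\<bar>" if "\<rho> < R" for \<rho>
  proof (cases "\<bar>r1\<bar> \<le> \<bar>r2\<bar>")
    case True
    then have "r2 > 0" "max r1 \<rho> < r2" using assms(1) that by (auto simp: R_def)
    then obtain r where "max r1 \<rho> < r" "r < r2" using dense by blast
    then show ?thesis by (intro bexI[of _ r]) auto
  next
    case False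
    then have "r1 < 0" "r1 < min r2 (- \<rho>)" using assms(1) that by (auto simp: R_def)
    then obtain r where "r1 < r" "r < min r2 (- \<rho>)" using dense by blast
    then show ?thesis by (intro bexI[of _ r]) auto
  qed
  define A :: "nat \<Rightarrow> complex" where "A k = of_real (a k)" for k
  have "summable (\<lambda>k. A k * z ^ k)" if z: "norm z < R" for z
  proof -
    obtain r where r: "r \<in> {r1<..<r2}" "norm z < \<bar>r\<bar>" using inside[OF z] by blast
    have "(\<lambda>k. complex_of_real (a k * r ^ k)) sums of_real (G r)"
      using assms(2)[OF r(1)] by (simp only: sums_of_real_iff)
    then have "summable (\<lambda>k. A k * complex_of_real r ^ k)"
      by (simp add: A_def sums_iff)
    then show ?thesis by (rule powser_inside) (use r in simp)
  qed
  then have sums: "(\<lambda>k. A k * z ^ k) sums (\<Sum>k. A k * z ^ k)" if "norm z < R" for z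
    using that by (simp add: summable_sums)
  \<comment> \<open>A compact subinterval keeps the accumulation point away from the boundary of the
    disc.\<close>
  define s1 s2 where "s1 = (2 * r1 + r2) / 3" and "s2 = (r1 + 2 * r2) / 3"
  have s: "r1 < s1" "s1 < s2" "s2 < r2" using assms(1) by (auto simp: s1_def s2_def)
  have "infinite {s1..s2}" using s by (simp add: infinite_Icc)
  moreover have "finite (G ` {s1..s2})"
    by (rule finite_subset[OF _ assms(3)]) (use s in auto)
  ultimately obtain s0 where s0: "infinite {r \<in> {s1..s2}. G r = G s0}" (is "infinite ?U")
    using pigeonhole_infinite[of "{s1..s2}" G] by blast
  then obtain \<xi> where \<xi>: "\<xi> \<in> {s1..s2}" "\<xi> islimpt ?U"
    using compact_Icc[of s1 s2] unfolding compact_eq_Bolzano_Weierstrass by (metis (no_types, lifting) mem_Collect_eq subsetI)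
  define \<phi> where "\<phi> z = (\<Sum>k. A k * z ^ k) - of_real (G s0)" for z
  have ball: "complex_of_real r \<in> ball 0 R" if "r \<in> {s1..s2}" for r
    using that s by (auto simp: R_def)
  have sums\<phi>: "(\<lambda>k. (if k = 0 then A 0 - of_real (G s0) else A k) * z ^ k) sums \<phi> z" if "norm z < R" for z
  proof -
    have "(\<lambda>k. if k = 0 then complex_of_real (G s0) else 0) sums of_real (G s0)"
      using sums_single[of 0 "\<lambda>_. complex_of_real (G s0)"] by simp
    from sums_diff[OF sums[OF that] this] show ?thesis
      unfolding \<phi>_def by (rule back_subst[of "\<lambda>f. f sums _"]) auto
  qed
  have hol: "\<phi> holomorphic_on ball 0 R"
    by (rule power_series_holomorphic[of 0 R "\<lambda>k. if k = 0 then A 0 - of_real (G s0) else A k"])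
      (use sums\<phi> in auto)
  have zero: "\<phi> (of_real r) = 0" if "r \<in> ?U" for r
  proof -
    have "(\<lambda>k. complex_of_real (a k * r ^ k)) sums of_real (G r)"
      using assms(2)[of r] that s by (subst sums_of_real_iff) auto
    then have "(\<lambda>k. A k * of_real r ^ k) sums of_real (G s0)" using that by (simp add: A_def)
    then show ?thesis by (simp add: \<phi>_def sums_iff)
  qed
  have "complex_of_real \<xi> islimpt of_real ` ?U"
    unfolding islimpt_approachable
  proof (intro allI impI)
    fix e :: real assume "e > 0"
    then obtain r where "r \<in> ?U" "r \<noteq> \<xi>" "dist r \<xi> < e"
      using \<xi>(2) by (auto simp: islimpt_approachable)
    then show "\<exists>x'\<in>of_real ` ?U. x' \<noteq> complex_of_real \<xi> \<and> dist x' (complex_of_real \<xi>) < e"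
      by (intro bexI[of _ "of_real r"]) (auto simp: dist_of_real)
  qed
  note islimpt = this
  have vanish: "\<phi> z = 0" if "norm z < R" for z
    by (rule analytic_continuation[OF hol open_ball connected_ball _ ball[OF \<xi>(1)] islimpt])
      (use ball zero that in auto)
  \<comment> \<open>A power series that vanishes at 0 and has a nonzero coefficient has an isolated
    zero there, against \<open>vanish\<close>.\<close>
  obtain \<sigma> where "\<sigma> > 0" "\<And>z. z \<in> cball 0 \<sigma> - {0} \<Longrightarrow> \<phi> z \<noteq> 0"
    by (rule powser_0_nonzero[of R 0 "\<lambda>k. if k = 0 then A 0 - of_real (G s0) else A k" \<phi> k])
      (use sums\<phi> vanish \<open>R > 0\<close> \<open>a k \<noteq> 0\<close> assms(4) in \<open>auto simp: A_def\<close>)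
  moreover have "complex_of_real (min \<sigma> (R / 2)) \<in> cball 0 \<sigma> - {0}"
    using \<open>\<sigma> > 0\<close> \<open>R > 0\<close> by auto
  moreover have "\<phi> (complex_of_real (min \<sigma> (R / 2))) = 0"
    using \<open>\<sigma> > 0\<close> \<open>R > 0\<close> by (intro vanish) auto
  ultimately show False by blast
qed

lemma summable_divide_Suc:
  fixes e :: "nat \<Rightarrow> real"
  assumes "summable e"
  shows "summable (\<lambda>k. e k / real (Suc k))"
proof -
  define s where "s n = (\<Sum>k<n. e k)" for n
  have lim: "s \<longlonglongrightarrow> suminf e" unfolding s_def by (rule summable_LIMSEQ[OF assms])
  then obtain B where B: "\<And>n. \<bar>s n\<bar> \<le> B"
    using convergent_imp_Bseq[OF convergentI[OF lim]] by (auto simp: Bseq_def)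
  have "summable (\<lambda>k. 1 / real (Suc k) ^ 2)"
    using inverse_power_summable[of 2, where 'a = real]
    by (subst summable_Suc_iff) (simp add: inverse_eq_divide)
  then have "summable (\<lambda>k. B * (1 / real (Suc k) ^ 2))" by (rule summable_mult)
  moreover have "norm (s (Suc k) / (real (Suc k) * real (Suc (Suc k)))) \<le> B * (1 / real (Suc k) ^ 2)" for k
  proof -
    have "norm (s (Suc k) / (real (Suc k) * real (Suc (Suc k))))
        = \<bar>s (Suc k)\<bar> / (real (Suc k) * real (Suc (Suc k)))" by (simp add: abs_mult)
    also have "\<dots> \<le> B / real (Suc k) ^ 2"
      using B[of "Suc k"] by (intro frac_le) (auto simp: power2_eq_square)
    finally show ?thesis by simp
  qed
  ultimately have "summable (\<lambda>k. s (Suc k) / (real (Suc k) * real (Suc (Suc k))))"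
    by (rule summable_comparison_test'[where N = 0])
  from summable_LIMSEQ[OF this]
  have 1: "convergent (\<lambda>n. \<Sum>k<n. s (Suc k) / (real (Suc k) * real (Suc (Suc k))))"
    by (rule convergentI)
  have "(\<lambda>n. s n * (1 / real (Suc n))) \<longlonglongrightarrow> suminf e * 0"
    by (intro tendsto_mult lim) real_asymp
  then have 2: "convergent (\<lambda>n. s n * (1 / real (Suc n)))" by (rule convergentI)
  have "(\<Sum>k<n. e k / real (Suc k)) =
      s n * (1 / real (Suc n)) + (\<Sum>k<n. s (Suc k) / (real (Suc k) * real (Suc (Suc k))))" for n
  proof (induction n)
    case 0
    then show ?case by (simp add: s_def)
  next
    case (Suc n)
    have "s (Suc n) = s n + e n" by (simp add: s_def)
    then have "s n * (1 / real (Suc n)) + e n / real (Suc n) = s (Suc n) * (1 / real (Suc n))"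
      by (simp add: add_divide_distrib)
    moreover have "1 / real (Suc n) = 1 / real (Suc (Suc n)) + 1 / (real (Suc n) * real (Suc (Suc n)))"
      by (simp add: divide_simps del: of_nat_Suc)
    then have "s (Suc n) * (1 / real (Suc n)) = s (Suc n) * (1 / real (Suc (Suc n)))
        + s (Suc n) / (real (Suc n) * real (Suc (Suc n)))"
      by (simp only: distrib_left mult_1_right times_divide_eq_right)
    ultimately have "s n * (1 / real (Suc n)) + e n / real (Suc n) = s (Suc n) * (1 / real (Suc (Suc n)))
        + s (Suc n) / (real (Suc n) * real (Suc (Suc n)))" by linarith
    then show ?case using Suc by simp
  qed
  then have "convergent (\<lambda>n. \<Sum>k<n. e k / real (Suc k))"
    using convergent_add[OF 2 1] by simp
  then show ?thesis by (simp add: summable_iff_convergent)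
qed

section \<open>Expansions of functions with finite range\<close>

lemma coef_of_nat_mult: "coef (of_nat n * x) q = real n * coef x q"
  using of_real_mult_eq_scaleR[of "real n" x] by simp

lemma scaleR_power_lc: "(r *\<^sub>R x) ^ n = r ^ n *\<^sub>R (x :: levi_civita) ^ n"
  by (induction n) (simp_all add: mult_ac)

lemma coef_mult_lead:
  assumes "\<And>r. r < m \<Longrightarrow> coef x r = 0" "\<And>r. r < n \<Longrightarrow> coef y r = 0"
  shows "coef (x * y) (m + n) = coef x m * coef y n"
proof -
  have "coef (x * y) (m + n) = (\<Sum>a\<in>{m}. coef x a * coef y (m + n - a))"
  proof (rule coef_times_superset)
    show "{a. coef x a \<noteq> 0 \<and> coef y (m + n - a) \<noteq> 0} \<subseteq> {m}"
    proof
      fix a assume "a \<in> {a. coef x a \<noteq> 0 \<and> coef y (m + n - a) \<noteq> 0}"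
      then have "m \<le> a" "n \<le> m + n - a" using assms by (auto simp: not_less[symmetric])
      then show "a \<in> {m}" by simp
    qed
  qed simp
  then show ?thesis by simp
qed

lemma coef_mult_nonzero:
  assumes "coef (x * y) q \<noteq> 0"
  shows "\<exists>a b. q = a + b \<and> coef x a \<noteq> 0 \<and> coef y b \<noteq> 0"
proof (rule ccontr)
  assume *: "\<not> ?thesis"
  have "{a. coef x a \<noteq> 0 \<and> coef y (q - a) \<noteq> 0} \<subseteq> {}"
  proof
    fix a assume "a \<in> {a. coef x a \<noteq> 0 \<and> coef y (q - a) \<noteq> 0}"
    moreover have "q = a + (q - a)" by simp
    ultimately show "a \<in> {}" using * by blast
  qed
  then show False using assms coef_times_superset[of "{}" x y q] by simp
qed

text \<open>The point is that J does not depend on k: the binomial expansions of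
  \<open>(1 + h) ^ k\<close>, for all k at once, contribute to the coefficient at q only up to the
  power J. The condition \<open>J \<ge> i\<close> keeps a chosen index within range.\<close>

lemma coef_infinitesimal_powers:
  assumes "\<And>k r. r < m \<Longrightarrow> coef (e k) r = 0" "\<And>r. r \<le> 0 \<Longrightarrow> coef h r = 0"
  obtains J where "J \<ge> i" "\<And>j k. j > J \<Longrightarrow> coef (e k * h ^ j) q = 0"
proof -
  obtain d where d: "d > 0" "\<And>r. r < d \<Longrightarrow> coef h r = 0"
    using infinitesimal_gap[OF assms(2)] by blast
  obtain N where N: "q - m < of_nat N * d" using ex_less_of_nat_mult[OF d(1)] by blast
  have "coef (e k * h ^ j) q = 0" if "j > max i N" for j k
  proof (rule coef_mult_eq_0[OF assms(1)])
    have "of_nat N * d \<le> of_nat j * d" using that d(1) by simp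
    then show "q < m + of_nat j * d" using N by linarith
  qed (use coef_power_eq_0[OF d(2)] in auto)
  then show ?thesis using that[of "max i N"] by simp
qed

text \<open>Along the real segment \<open>r h\<close> each coefficient of the partial sums is a polynomial in \<open>r\<close> whose
  degree is bounded because \<open>h\<close> is infinitesimal. So the coefficients of these polynomials converge,
  and a limit with finite range is constant. The \<open>e k\<close> themselves need not vanish: they may be the
  Taylor coefficients of a function that is flat at the point 1 of its circle of convergence.\<close>

lemma infinitesimal_expansion:
  assumes m: "\<And>k r. r < m \<Longrightarrow> coef (e k) r = 0"
    and h: "\<And>r. r \<le> 0 \<Longrightarrow> coef h r = 0"
    and sums: "\<And>r q. r \<in> {0..1} \<Longrightarrow> (\<lambda>k. coef (e k * (1 + r *\<^sub>R h) ^ k) q) sums coef (G r) q"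
    and fin: "finite (G ` {0..1})"
  shows "G 1 = G 0"
    and "coef_sums (\<lambda>k. of_nat (k choose i) * (e k * h ^ i)) (if i = 0 then G 0 else 0)"
proof -
  have main: "coef (G 1) q = coef (G 0) q"
    "(\<lambda>k. coef (of_nat (k choose i) * (e k * h ^ i)) q) sums coef (if i = 0 then G 0 else 0) q" for q i
  proof -
    obtain J where J: "J \<ge> i" "\<And>j k. j > J \<Longrightarrow> coef (e k * h ^ j) q = 0"
      using coef_infinitesimal_powers[OF m h, where i = i and q = q] by metis
    define b where "b j k = real (k choose j) * coef (e k * h ^ j) q" for j k
    define a where "a j K = (\<Sum>k\<le>K. b j k)" for j K
    have expand: "coef (e k * (1 + r *\<^sub>R h) ^ k) q = (\<Sum>j\<le>J. b j k * r ^ j)" for r k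
    proof -
      have "(1 + r *\<^sub>R h) ^ k = (\<Sum>j\<le>k. of_nat (k choose j) * (r *\<^sub>R h) ^ j)"
        using binomial_ring[of "r *\<^sub>R h" 1 k] by (simp add: add.commute)
      then have "coef (e k * (1 + r *\<^sub>R h) ^ k) q
          = (\<Sum>j\<le>k. coef (e k * (of_nat (k choose j) * (r *\<^sub>R h) ^ j)) q)"
        by (simp only: sum_distrib_left coef_sum)
      also have "\<dots> = (\<Sum>j\<le>k. b j k * r ^ j)"
      proof (intro sum.cong refl)
        fix j
        have "e k * (of_nat (k choose j) * (r *\<^sub>R h) ^ j) = r ^ j *\<^sub>R (of_nat (k choose j) * (e k * h ^ j))"
          by (simp add: scaleR_power_lc mult.left_commute[of "e k"])
        then show "coef (e k * (of_nat (k choose j) * (r *\<^sub>R h) ^ j)) q = b j k * r ^ j"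
          by (simp add: coef_of_nat_mult b_def)
      qed
      \<comment> \<open>The sum is padded to \<open>max k J\<close> and cut back to J: for j > k the
        binomial coefficient vanishes, for j > J the coefficient of
        \<open>e k * h ^ j\<close>.\<close>
      also have "\<dots> = (\<Sum>j\<le>max k J. b j k * r ^ j)"
        by (rule sum.mono_neutral_left) (auto simp: b_def)
      also have "\<dots> = (\<Sum>j\<le>J. b j k * r ^ j)"
        by (rule sum.mono_neutral_right) (auto simp: b_def J)
      finally show ?thesis .
    qed
    have lim: "(\<lambda>K. \<Sum>j\<le>J. a j K * r ^ j) \<longlonglongrightarrow> coef (G r) q" if "r \<in> {0..1}" for r
    proof -
      have "(\<Sum>k\<le>K. coef (e k * (1 + r *\<^sub>R h) ^ k) q) = (\<Sum>j\<le>J. a j K * r ^ j)" for K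
        unfolding expand a_def sum_distrib_right by (rule sum.swap)
      then show ?thesis using sums[OF that, of q] by (simp add: sums_def_le)
    qed
    have "convergent (a j)" if "j \<le> J" for j
      by (rule polynomial_coeffs_convergent[OF _ that]) (use lim in \<open>blast intro: convergentI\<close>)
    then have \<alpha>: "a j \<longlonglongrightarrow> lim (a j)" if "j \<le> J" for j
      using that by (simp add: convergent_LIMSEQ_iff)
    have G: "coef (G r) q = (\<Sum>j\<le>J. lim (a j) * r ^ j)" if "r \<in> {0..1}" for r
      by (rule LIMSEQ_unique[OF lim[OF that]]) (intro tendsto_sum tendsto_mult tendsto_const \<alpha>; simp)
    have "finite ((\<lambda>x. coef x q) ` G ` {0..1})" using fin by simp
    then have fin_poly: "finite ((\<lambda>r. \<Sum>j\<le>J. lim (a j) * r ^ j) ` {0..1})"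
      using G by (simp add: image_image cong: image_cong_simp)
    have zero: "lim (a j) = 0" if "0 < j" "j \<le> J" for j
      by (rule polynomial_finite_range[OF fin_poly that])
    have const: "coef (G r) q = lim (a 0)" if "r \<in> {0..1}" for r
    proof -
      have "coef (G r) q = (\<Sum>j\<in>{0}. lim (a j) * r ^ j)"
        unfolding G[OF that] by (rule sum.mono_neutral_right) (auto simp: zero)
      then show ?thesis by simp
    qed
    show "coef (G 1) q = coef (G 0) q" using const by simp
    have "b i sums lim (a i)" using \<alpha>[OF J(1)] by (simp add: sums_def_le a_def[abs_def])
    moreover have "lim (a i) = coef (if i = 0 then G 0 else 0) q"
      using const[of 0] zero[of i] J(1) by auto
    ultimately show "(\<lambda>k. coef (of_nat (k choose i) * (e k * h ^ i)) q) sums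
        coef (if i = 0 then G 0 else 0) q"
      by (simp add: b_def[abs_def] coef_of_nat_mult)
  qed
  show "G 1 = G 0" by (rule levi_civita_eqI) (rule main(1))
  have "\<forall>k. \<forall>r<m. coef (of_nat (k choose i) * (e k * h ^ i)) r = 0"
  proof (intro allI impI)
    fix k r assume "r < m"
    have "coef (e k * h ^ i) r = 0"
      by (rule coef_mult_eq_0[of m _ 0]) (use m h coef_power_eq_0[of 0 h _ i] \<open>r < m\<close> in auto)
    then show "coef (of_nat (k choose i) * (e k * h ^ i)) r = 0" by (simp add: coef_of_nat_mult)
  qed
  then show "coef_sums (\<lambda>k. of_nat (k choose i) * (e k * h ^ i)) (if i = 0 then G 0 else 0)"
    using main(2) unfolding coef_sums_def by blast
qed

text \<open>Since (k+1 choose j+1) / (k+1) = (k choose j) / (j+1), expanding the antiderivative in h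
  integrates the expansion of the function order by order. All orders j > 0 of the latter sum to 0,
  so only the constant K and the term \<open>v * h\<close> survive.\<close>

lemma infinitesimal_antiderivative:
  assumes m: "\<And>k r. r < m \<Longrightarrow> coef (e k) r = 0"
    and h: "\<And>r. r \<le> 0 \<Longrightarrow> coef h r = 0"
    and sums: "\<And>j. coef_sums (\<lambda>k. of_nat (k choose j) * (e k * h ^ j)) (if j = 0 then v else 0)"
    and K: "\<And>q. (\<lambda>k. coef (e k) q / real (Suc k)) sums coef K q"
  shows "coef_sums (\<lambda>k. (1 / real (Suc k)) *\<^sub>R (e k * (1 + h) ^ Suc k)) (K + v * h)"
proof -
  have "(\<lambda>k. coef ((1 / real (Suc k)) *\<^sub>R (e k * (1 + h) ^ Suc k)) q) sums coef (K + v * h) q" for q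
  proof -
    obtain J where J: "\<And>j k. j > J \<Longrightarrow> coef (e k * h ^ j) q = 0"
      using coef_infinitesimal_powers[OF m h, where i = 0 and q = q] by metis
    define b where "b j k = coef (of_nat (k choose j) * (e k * h ^ j) * h) q" for j k
    have b: "b j k = real (k choose j) * coef (e k * h ^ Suc j) q" for j k
      unfolding b_def mult.assoc coef_of_nat_mult by (simp add: power_commutes)
    have expand: "coef ((1 / real (Suc k)) *\<^sub>R (e k * (1 + h) ^ Suc k)) q
        = coef (e k) q / real (Suc k) + (\<Sum>j\<le>J. (1 / real (Suc j)) * b j k)" for k
    proof -
      have "(1 + h) ^ Suc k = (\<Sum>j\<le>Suc k. of_nat (Suc k choose j) * h ^ j)"
        using binomial_ring[of h 1 "Suc k"] by (simp add: add.commute del: power_Suc)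
      also have "\<dots> = 1 + (\<Sum>j\<le>k. of_nat (Suc k choose Suc j) * h ^ Suc j)"
        by (subst sum.atMost_Suc_shift) simp
      finally have "coef ((1 / real (Suc k)) *\<^sub>R (e k * (1 + h) ^ Suc k)) q
          = (coef (e k) q + (\<Sum>j\<le>k. coef (of_nat (Suc k choose Suc j) * (e k * h ^ Suc j)) q)) / real (Suc k)"
        by (simp add: distrib_left sum_distrib_left coef_sum mult.left_commute add_divide_distrib
            sum_divide_distrib del: power_Suc binomial_Suc_Suc of_nat_Suc)
      also have "\<dots> = coef (e k) q / real (Suc k)
          + (\<Sum>j\<le>k. real (Suc k choose Suc j) / real (Suc k) * coef (e k * h ^ Suc j) q)"
        by (simp add: add_divide_distrib sum_divide_distrib coef_of_nat_mult del: power_Suc binomial_Suc_Suc of_nat_Suc)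
      also have "(\<Sum>j\<le>k. real (Suc k choose Suc j) / real (Suc k) * coef (e k * h ^ Suc j) q)
          = (\<Sum>j\<le>k. (1 / real (Suc j)) * b j k)"
      proof (intro sum.cong refl)
        fix j
        have "real (Suc j) * real (Suc k choose Suc j) = real (Suc k) * real (k choose j)"
          by (simp only: of_nat_mult[symmetric] Suc_times_binomial)
        then have "real (Suc k choose Suc j) / real (Suc k) = real (k choose j) / real (Suc j)"
          by (simp add: field_simps del: binomial_Suc_Suc of_nat_Suc)
        then show "real (Suc k choose Suc j) / real (Suc k) * coef (e k * h ^ Suc j) q = (1 / real (Suc j)) * b j k"
          by (simp add: b del: binomial_Suc_Suc of_nat_Suc)
      qed
      also have "\<dots> = (\<Sum>j\<le>max k J. (1 / real (Suc j)) * b j k)"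
        by (rule sum.mono_neutral_left) (auto simp: b)
      also have "\<dots> = (\<Sum>j\<le>J. (1 / real (Suc j)) * b j k)"
        by (rule sum.mono_neutral_right) (auto simp: b J simp del: power_Suc)
      finally show ?thesis .
    qed
    have "(\<lambda>k. b j k) sums coef ((if j = 0 then v else 0) * h) q" for j
      using coef_sums_mult_right[OF sums[of j], of h] by (simp add: coef_sums_def b_def)
    then have "(\<lambda>k. coef (e k) q / real (Suc k) + (\<Sum>j\<le>J. (1 / real (Suc j)) * b j k)) sums
        (coef K q + (\<Sum>j\<le>J. (1 / real (Suc j)) * coef ((if j = 0 then v else 0) * h) q))"
      by (intro sums_add K sums_sum sums_mult)
    also have "(\<Sum>j\<le>J. (1 / real (Suc j)) * coef ((if j = 0 then v else 0) * h) q)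
        = (\<Sum>j\<le>J. if j = 0 then coef (v * h) q else 0)"
      by (intro sum.cong) auto
    finally show ?thesis unfolding expand by simp
  qed
  moreover have "\<forall>k. \<forall>r<m. coef ((1 / real (Suc k)) *\<^sub>R (e k * (1 + h) ^ Suc k)) r = 0"
  proof (intro allI impI)
    fix k r assume "r < m"
    have "coef (e k * (1 + h) ^ Suc k) r = 0"
      by (rule coef_mult_eq_0[of m _ 0])
        (use m h coef_power_eq_0[of 0 "1 + h" _ "Suc k"] \<open>r < m\<close> in auto)
    then show "coef ((1 / real (Suc k)) *\<^sub>R (e k * (1 + h) ^ Suc k)) r = 0" by simp
  qed
  ultimately show ?thesis unfolding coef_sums_def by blast
qed

section \<open>Constant and affine expansions, and intervals of the two scales\<close>

lemma interval_convex: "interval a b I \<Longrightarrow> x \<in> I \<Longrightarrow> y \<in> I \<Longrightarrow> x \<le> z \<Longrightarrow> z \<le> y \<Longrightarrow> z \<in> I"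
  by (auto simp: interval_def)

lemma interval_Ioo_subset: "interval a b I \<Longrightarrow> {a<..<b} \<subseteq> I"
  by (auto simp: interval_def)

lemma expansion_const: "expansion_on (\<lambda>_. v) I 0 (\<lambda>k. if k = 0 then v else 0)"
  unfolding expansion_on_def power_series_at_iff
proof (intro ballI conjI allI)
  fix x :: levi_civita and q
  have "(\<Union>k. supp ((if k = 0 then v else 0) * (x - 0) ^ k)) \<subseteq> supp v"
    by (auto simp: supp_def split: if_splits)
  then show "left_finite (\<Union>k. supp ((if k = 0 then v else 0) * (x - 0) ^ k))"
    by (rule left_finite_subset[OF left_finite_supp])
  have "coef ((if k = 0 then v else 0) * (x - 0) ^ k) q = (if k = 0 then coef v q else 0)" for k
    by simp
  then show "(\<lambda>k. coef ((if k = 0 then v else 0) * (x - 0) ^ k) q) sums coef v q"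
    using sums_single[of 0 "\<lambda>_. coef v q"] by simp
qed

lemma expansion_affine:
  assumes "\<And>k. k > 1 \<Longrightarrow> c k = 0"
  shows "expansion_on (\<lambda>x. c 0 + c 1 * (x - x0)) I x0 c"
  unfolding expansion_on_def power_series_at_iff
proof (intro ballI conjI allI)
  fix x q
  have supp: "supp (c k * (x - x0) ^ k) \<subseteq> supp (c 0) \<union> supp (c 1 * (x - x0))" for k
    using assms[of k] by (cases "k > 1"; cases "k = 0") (auto simp: supp_def not_less le_Suc_eq)
  show "left_finite (\<Union>k. supp (c k * (x - x0) ^ k))"
    by (rule left_finite_subset[OF left_finite_Un[OF left_finite_supp left_finite_supp]])
      (use supp in blast)
  have "(\<lambda>k. coef (c k * (x - x0) ^ k) q) sums (\<Sum>k\<in>{0, 1}. coef (c k * (x - x0) ^ k) q)"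
    by (rule sums_finite) (use assms in auto)
  then show "(\<lambda>k. coef (c k * (x - x0) ^ k) q) sums coef (c 0 + c 1 * (x - x0)) q"
    by simp
qed

text \<open>The points \<open>x - x0\<close> differ in their leading coefficient, so \<open>I\<close> contains a real segment at the
  scale \<open>d\<^sup>m\<close> and the coefficients are real power series in the parameter of that segment.\<close>

lemma finite_range_expansion_large:
  assumes I: "interval a b I" and fin: "finite (g ` I)" and exp: "expansion_on g I x0 c"
    and x: "x \<in> I" "x' \<in> I" "\<And>r. r < m \<Longrightarrow> coef (x - x0) r = 0" "\<And>r. r < m \<Longrightarrow> coef (x' - x0) r = 0"
      "coef (x - x0) m < coef (x' - x0) m"
    and k: "k > 0"
  shows "c k = 0"
proof -
  define r1 r2 where "r1 = coef (x - x0) m" and "r2 = coef (x' - x0) m"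
  define e where "e k = c k * d_pow m ^ k" for k
  have mem: "x0 + r *\<^sub>R d_pow m \<in> I" if "r \<in> {r1<..<r2}" for r
  proof (rule interval_convex[OF I x(1,2)])
    have "x < x0 + r *\<^sub>R d_pow m"
      unfolding lc_less_iff using x(3) that by (intro exI[of _ m]) (auto simp: r1_def)
    moreover have "x0 + r *\<^sub>R d_pow m < x'"
      unfolding lc_less_iff using x(4) that by (intro exI[of _ m]) (auto simp: r2_def)
    ultimately show "x \<le> x0 + r *\<^sub>R d_pow m" "x0 + r *\<^sub>R d_pow m \<le> x'" by simp_all
  qed
  have "coef (e k) q = 0" for q
  proof (rule powser_finite_range[of r1 r2 "\<lambda>k. coef (e k) q"
        "\<lambda>r. coef (g (x0 + r *\<^sub>R d_pow m)) q" k, OF _ _ _ k])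
    show "r1 < r2" using x(5) by (simp add: r1_def r2_def)
    fix r assume r: "r \<in> {r1<..<r2}"
    have "coef (c k * (r *\<^sub>R d_pow m) ^ k) q = coef (e k) q * r ^ k" for k
      by (simp add: scaleR_power_lc e_def)
    moreover have "power_series_at c x0 (x0 + r *\<^sub>R d_pow m) (g (x0 + r *\<^sub>R d_pow m))"
      using exp mem[OF r] by (simp add: expansion_on_def)
    then have "(\<lambda>k. coef (c k * (x0 + r *\<^sub>R d_pow m - x0) ^ k) q) sums coef (g (x0 + r *\<^sub>R d_pow m)) q"
      by (simp only: power_series_at_iff)
    ultimately show "(\<lambda>k. coef (e k) q * r ^ k) sums coef (g (x0 + r *\<^sub>R d_pow m)) q"
      by simp
  next
    have "(\<lambda>r. coef (g (x0 + r *\<^sub>R d_pow m)) q) ` {r1<..<r2} \<subseteq> (\<lambda>v. coef v q) ` g ` I"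
      using mem by auto
    then show "finite ((\<lambda>r. coef (g (x0 + r *\<^sub>R d_pow m)) q) ` {r1<..<r2})"
      using fin by (meson finite_imageI finite_subset)
  qed
  then have "e k = 0" by (intro levi_civita_eqI) simp
  then show ?thesis by (simp add: e_def)
qed

lemma power_series_at_unique:
  "power_series_at c x0 x v \<Longrightarrow> power_series_at c x0 x w \<Longrightarrow> v = w"
  unfolding power_series_at_iff by (metis levi_civita_eqI sums_unique2)

text \<open>By \<open>near\<close>, every point of I satisfies x - x0 = u (1 + h) with u = x1 - x0
  fixed and h infinitesimal. Absorbing \<open>u ^ k\<close> into the coefficients reduces the claim
  to series in \<open>(1 + h) ^ k\<close>.\<close>

lemma finite_range_expansion_small:
  assumes I: "interval a b I" and fin: "finite (g ` I)" and exp: "expansion_on g I x0 c"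
    and x1: "x1 \<in> I" "x1 \<noteq> x0"
    and near: "\<And>x r. x \<in> I \<Longrightarrow> r \<le> val (x1 - x0) \<Longrightarrow> coef (x - x1) r = 0"
  obtains K where "\<And>x. x \<in> I \<Longrightarrow> g x = g x1"
    "expansion_on (\<lambda>x. K + g x1 * x) I x0 (antideriv_coeffs c)"
proof -
  define u where "u = x1 - x0"
  have "u \<noteq> 0" using x1 by (simp add: u_def)
  then obtain u' where u': "u * u' = 1" using lc_inverse by blast
  define e where "e k = c k * u ^ k" for k
  define h where "h x = u' * (x - x1)" for x
  have uh: "u * h x = x - x1" for x using u' by (simp add: h_def flip: mult.assoc)
  \<comment> \<open>Otherwise the product of the leading terms of u and \<open>h x\<close> would be
    a nonzero coefficient of x - x1 at an exponent at most \<open>val u\<close>, against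
    \<open>near\<close>.\<close>
  have h: "coef (h x) r = 0" if "x \<in> I" "r \<le> 0" for x r
  proof (rule ccontr)
    assume *: "coef (h x) r \<noteq> 0"
    then have "h x \<noteq> 0" by auto
    have le: "val (h x) \<le> 0" using val_le[OF \<open>h x \<noteq> 0\<close>, of r] * that by (simp add: supp_def)
    have "coef (u * h x) (val u + val (h x)) = coef u (val u) * coef (h x) (val (h x))"
      using coef_less_val \<open>u \<noteq> 0\<close> \<open>h x \<noteq> 0\<close> by (intro coef_mult_lead) auto
    then have "coef (x - x1) (val u + val (h x)) \<noteq> 0"
      using coef_val_nz \<open>u \<noteq> 0\<close> \<open>h x \<noteq> 0\<close> by (simp only: uh mult_eq_0_iff) simp
    then show False using near[OF that(1), of "val u + val (h x)"] le by (simp add: u_def)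
  qed
  have at: "power_series_at c x0 x (g x)" if "x \<in> I" for x
    using exp that by (simp add: expansion_on_def)
  have lf: "left_finite (\<Union>k. supp (e k))" and e_sums: "\<And>q. (\<lambda>k. coef (e k) q) sums coef (g x1) q"
    using at[OF x1(1)] by (simp_all add: power_series_at_iff e_def u_def)
  obtain m where "\<And>q k. q \<in> supp (e k) \<Longrightarrow> m \<le> q"
    using left_finite_bdd_below[OF lf] by blast
  then have m: "coef (e k) r = 0" if "r < m" for k r
    using that by (force simp: supp_def)
  have seg: "x1 + r *\<^sub>R (x - x1) \<in> I" if "x \<in> I" "r \<in> {0..1}" for x r
  proof -
    have 1: "x1 + r *\<^sub>R (x - x1) = x + of_real (1 - r) * (x1 - x)"
      unfolding of_real_mult_eq_scaleR by (simp add: algebra_simps)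
    have 2: "x1 + r *\<^sub>R (x - x1) = x1 + of_real r * (x - x1)"
      by (simp add: of_real_mult_eq_scaleR)
    have r: "(0::levi_civita) \<le> of_real r" "(0::levi_civita) \<le> of_real (1 - r)"
      using that(2) of_real_lc_le_iff[of 0 r] of_real_lc_le_iff[of 0 "1 - r"]
      by (simp_all del: of_real_lc_le_iff of_real_diff)
    show ?thesis
    proof (cases "x \<le> x1")
      case True
      have "0 \<le> of_real (1 - r) * (x1 - x)" "of_real r * (x - x1) \<le> 0"
        using r True by (simp_all add: mult_nonneg_nonpos)
      then show ?thesis using 1 2 by (intro interval_convex[OF I that(1) x1(1)]) simp_all
    next
      case False
      then have "of_real (1 - r) * (x1 - x) \<le> 0" "0 \<le> of_real r * (x - x1)"
        using r by (simp_all add: mult_nonneg_nonpos)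
      then show ?thesis using 1 2 by (intro interval_convex[OF I x1(1) that(1)]) simp_all
    qed
  qed
  have terms: "c k * (x1 + r *\<^sub>R (x - x1) - x0) ^ k = e k * (1 + r *\<^sub>R h x) ^ k" for x r k
  proof -
    have "x1 + r *\<^sub>R (x - x1) - x0 = u * (1 + r *\<^sub>R h x)"
      by (simp add: distrib_left uh) (simp add: u_def)
    then show ?thesis by (simp add: e_def power_mult_distrib mult.assoc)
  qed
  have sums: "(\<lambda>k. coef (e k * (1 + r *\<^sub>R h x) ^ k) q) sums coef (g (x1 + r *\<^sub>R (x - x1))) q"
    if "x \<in> I" "r \<in> {0..1}" for x r q
    using at[OF seg[OF that]] by (simp only: power_series_at_iff terms)
  have fin': "finite ((\<lambda>r. g (x1 + r *\<^sub>R (x - x1))) ` {0..1})" if "x \<in> I" for x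
    by (rule finite_subset[OF _ fin]) (use seg[OF that] in auto)
  have const: "g x = g x1" if "x \<in> I" for x
    using infinitesimal_expansion(1)[of m e "h x" "\<lambda>r. g (x1 + r *\<^sub>R (x - x1))",
        OF m h[OF that] sums[OF that] fin'[OF that]] by simp
  have expansion: "coef_sums (\<lambda>k. of_nat (k choose i) * (e k * h x ^ i)) (if i = 0 then g x1 else 0)"
    if "x \<in> I" for x i
    using infinitesimal_expansion(2)[of m e "h x" "\<lambda>r. g (x1 + r *\<^sub>R (x - x1))" i,
        OF m h[OF that] sums[OF that] fin'[OF that]]
    by (simp only: scaleR_zero_left add_0_right)
  \<comment> \<open>The constant of integration: times u, this is the value of the termwise
    antiderivative at x1, where h = 0.\<close>
  define \<sigma> where "\<sigma> q = (\<Sum>k. coef (e k) q / real (Suc k))" for q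
  have \<sigma>: "(\<lambda>k. coef (e k) q / real (Suc k)) sums \<sigma> q" for q
    unfolding \<sigma>_def using e_sums[of q] by (intro summable_sums summable_divide_Suc) (simp add: sums_iff)
  have "{q. \<sigma> q \<noteq> 0} \<subseteq> (\<Union>k. supp (e k))"
  proof
    fix q assume "q \<in> {q. \<sigma> q \<noteq> 0}"
    then have "\<exists>k. coef (e k) q \<noteq> 0" by (rule contrapos_pp) (simp add: \<sigma>_def)
    then show "q \<in> (\<Union>k. supp (e k))" by (auto simp: supp_def)
  qed
  then have "left_finite {q. \<sigma> q \<noteq> 0}" by (rule left_finite_subset[OF lf])
  then have coef_K0: "coef (Abs_levi_civita \<sigma>) = \<sigma>" by (simp add: Abs_levi_civita_inverse)
  define K0 where "K0 = Abs_levi_civita \<sigma>"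
  have K0: "(\<lambda>k. coef (e k) q / real (Suc k)) sums coef K0 q" for q
    using \<sigma> by (simp add: K0_def coef_K0)
  have "power_series_at (antideriv_coeffs c) x0 x (K0 * u + g x1 * (x - x1))" if x: "x \<in> I" for x
    unfolding power_series_at_iff
  proof (intro conjI allI)
    have x_eq: "x - x0 = u * (1 + h x)"
      by (simp add: distrib_left uh) (simp add: u_def)
    have Suc_eq: "antideriv_coeffs c (Suc k) * (x - x0) ^ Suc k
        = (1 / real (Suc k)) *\<^sub>R (c k * (x - x0) ^ k) * (x - x0)" for k
      by (simp add: antideriv_coeffs_def mult_ac del: of_nat_Suc)
    show "left_finite (\<Union>k. supp (antideriv_coeffs c k * (x - x0) ^ k))"
    \<comment> \<open>Up to a real factor, a term of the antiderivative is a term of the given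
      series times one more x - x0, so its support lies in a sum of two left-finite sets.\<close>
    proof (rule left_finite_subset[OF left_finite_plus])
      show "left_finite (\<Union>k. supp (c k * (x - x0) ^ k))"
        using at[OF x] by (simp add: power_series_at_iff)
      show "left_finite (supp (x - x0))" by (rule left_finite_supp)
      show "(\<Union>k. supp (antideriv_coeffs c k * (x - x0) ^ k))
          \<subseteq> {p + q |p q. p \<in> (\<Union>k. supp (c k * (x - x0) ^ k)) \<and> q \<in> supp (x - x0)}"
      proof safe
        fix q k assume q: "q \<in> supp (antideriv_coeffs c k * (x - x0) ^ k)"
        show "\<exists>p r. q = p + r \<and> p \<in> (\<Union>k. supp (c k * (x - x0) ^ k)) \<and> r \<in> supp (x - x0)"
        proof (cases k)
          case 0
          then show ?thesis using q by (simp add: antideriv_coeffs_def supp_def)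
        next
          case (Suc j)
          have "q \<in> supp ((1 / real (Suc j)) *\<^sub>R (c j * (x - x0) ^ j) * (x - x0))"
            using q unfolding Suc Suc_eq .
          then have "coef (c j * (x - x0) ^ j * (x - x0)) q \<noteq> 0"
            by (simp add: supp_def)
          from coef_mult_nonzero[OF this] show ?thesis by (auto simp: supp_def)
        qed
      qed
    qed
    fix q
    have "coef_sums (\<lambda>k. (1 / real (Suc k)) *\<^sub>R (e k * (1 + h x) ^ Suc k)) (K0 + g x1 * h x)"
      by (rule infinitesimal_antiderivative[OF m h[OF x] expansion[OF x] K0])
    from coef_sums_mult_right[OF this, of u]
    have "(\<lambda>k. coef ((1 / real (Suc k)) *\<^sub>R (e k * (1 + h x) ^ Suc k) * u) q) sums
        coef ((K0 + g x1 * h x) * u) q"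
      by (simp only: coef_sums_def)
    also have "(\<lambda>k. coef ((1 / real (Suc k)) *\<^sub>R (e k * (1 + h x) ^ Suc k) * u) q)
        = (\<lambda>k. coef (antideriv_coeffs c (Suc k) * (x - x0) ^ Suc k) q)"
      unfolding Suc_eq by (simp add: x_eq e_def power_mult_distrib mult_ac del: of_nat_Suc)
    also have "(K0 + g x1 * h x) * u = K0 * u + g x1 * (u * h x)"
      by (simp add: algebra_simps)
    finally show "(\<lambda>k. coef (antideriv_coeffs c k * (x - x0) ^ k) q) sums coef (K0 * u + g x1 * (x - x1)) q"
      by (subst (asm) sums_Suc_iff) (simp add: uh antideriv_coeffs_def)
  qed
  then have "expansion_on (\<lambda>x. (K0 * u - g x1 * x1) + g x1 * x) I x0 (antideriv_coeffs c)"
    by (simp add: expansion_on_def algebra_simps)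
  then show ?thesis using that const by blast
qed

text \<open>Either two points of I are told apart by x - x0 at an exponent below which both
  differences vanish, or all points of I share the leading term of x - x0. In the second case I is
  infinitesimal compared with its distance to x0.\<close>

proposition finite_range_expansion:
  assumes I: "interval a b I" "a < b" and fin: "finite (g ` I)" and exp: "expansion_on g I x0 c"
  obtains v K where "\<And>x. x \<in> I \<Longrightarrow> g x = v"
    "expansion_on (\<lambda>x. K + v * x) I x0 (antideriv_coeffs c)"
proof (cases "\<exists>x\<in>I. \<exists>x'\<in>I. \<exists>m. (\<forall>r<m. coef (x - x0) r = 0 \<and> coef (x' - x0) r = 0) \<and>
    coef (x - x0) m < coef (x' - x0) m")
  case True
  then have c: "c k = 0" if "k > 0" for k
    using finite_range_expansion_large[OF I(1) fin exp] that by blast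
  have "g x = c 0" if "x \<in> I" for x
  proof (rule power_series_at_unique)
    show "power_series_at c x0 x (g x)" using exp that by (simp add: expansion_on_def)
    show "power_series_at c x0 x (c 0)"
      using expansion_affine[of c x0 I] c that by (simp add: expansion_on_def)
  qed
  moreover have "expansion_on (\<lambda>x. - (c 0 * x0) + c 0 * x) I x0 (antideriv_coeffs c)"
    using expansion_affine[of "antideriv_coeffs c" x0 I] c
    by (simp add: antideriv_coeffs_def algebra_simps split: nat.splits)
  ultimately show ?thesis using that by blast
next
  case False
  have lead: "coef (x - x0) m = coef (x' - x0) m"
    if "x \<in> I" "x' \<in> I" "\<And>r. r < m \<Longrightarrow> coef (x - x0) r = 0" "\<And>r. r < m \<Longrightarrow> coef (x' - x0) r = 0" for x x' m
    using False that by (metis linorder_neqE_linordered_idom)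
  obtain y where y: "a < y" "y < b" using lc_dense[OF I(2)] by blast
  obtain y' where y': "y < y'" "y' < b" using lc_dense[OF y(2)] by blast
  have "y \<in> I" "y' \<in> I" using interval_Ioo_subset[OF I(1)] y y' by auto
  then obtain x1 where x1: "x1 \<in> I" "x1 \<noteq> x0" using y'(1) by (metis less_irrefl)
  then have u: "x1 - x0 \<noteq> 0" by simp
  have "coef (x - x1) r = 0" if x: "x \<in> I" and r: "r \<le> val (x1 - x0)" for x r
  proof -
    \<comment> \<open>At its own leading exponent x - x0 would differ from x1 - x0, which still
      vanishes there, against \<open>lead\<close>.\<close>
    have below: "coef (x - x0) s = 0" if s: "s < val (x1 - x0)" for s
    proof (rule ccontr)
      assume *: "coef (x - x0) s \<noteq> 0"
      then have nz: "x - x0 \<noteq> 0" by auto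
      have le: "val (x - x0) \<le> s" using val_le[OF nz, of s] * by (simp add: supp_def)
      then have "coef (x - x0) (val (x - x0)) = coef (x1 - x0) (val (x - x0))"
        using s by (intro lead x x1 coef_less_val u nz) auto
      also have "\<dots> = 0" using le s by (intro coef_less_val u) auto
      finally show False using coef_val_nz[OF nz] by simp
    qed
    have "coef (x - x0) r = coef (x1 - x0) r"
    proof (cases "r = val (x1 - x0)")
      case True
      show ?thesis unfolding True by (intro lead x x1 below coef_less_val u)
    next
      case False
      then show ?thesis using below[of r] r coef_less_val[OF u, of r] by simp
    qed
    then show ?thesis by simp
  qed
  then show ?thesis
    using finite_range_expansion_small[OF I(1) fin exp x1] that by metis
qed

section \<open>Step functions\<close>

lemma lim_within_affine: "lim_within (\<lambda>x. K + v * x) c I (K + v * c)"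
  unfolding lim_within_def
proof (intro allI impI)
  fix \<epsilon> :: levi_civita assume "\<epsilon> > 0"
  then obtain \<delta> where \<delta>: "\<delta> > 0" "\<bar>v\<bar> * \<delta> < \<epsilon>" by (rule ex_small_mult)
  have "\<bar>K + v * x - (K + v * c)\<bar> < \<epsilon>" if "\<bar>x - c\<bar> < \<delta>" for x
  proof -
    have "K + v * x - (K + v * c) = v * (x - c)" by (simp add: algebra_simps)
    then have "\<bar>K + v * x - (K + v * c)\<bar> = \<bar>v\<bar> * \<bar>x - c\<bar>" by (simp add: abs_mult)
    also have "\<dots> \<le> \<bar>v\<bar> * \<delta>" using that by (intro mult_left_mono) auto
    finally show ?thesis using \<delta>(2) by simp
  qed
  then show "\<exists>\<delta>>0. \<forall>x\<in>I. x \<noteq> c \<and> \<bar>x - c\<bar> < \<delta> \<longrightarrow> \<bar>K + v * x - (K + v * c)\<bar> < \<epsilon>"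
    using \<delta>(1) by blast
qed

text \<open>The definition asks for the same value from every expansion, and
  \<open>finite_range_expansion\<close> turns the antiderivative of each into an affine function of
  slope v. Fixing v on the open interval alone also admits degenerate intervals, where the product
  is 0.\<close>

lemma has_simple_integral_finite_range:
  assumes I: "interval a b I" and simple: "simple_on g I" and fin: "finite (g ` I)"
    and v: "\<And>x. x \<in> {a<..<b} \<Longrightarrow> g x = v"
  shows "has_simple_integral g a b I (v * (b - a))"
proof (cases "a = b")
  case True
  then show ?thesis using I simple by (simp add: has_simple_integral_def)
next
  case False
  then have "a < b" using I by (simp add: interval_def)
  have "\<exists>F La Lb. expansion_on F I x0 (antideriv_coeffs c) \<and> lim_within F b I Lb \<and> lim_within F a I La \<and>
      v * (b - a) = Lb - La" if exp: "expansion_on g I x0 c" for x0 c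
  proof -
    obtain v' K where v': "\<And>x. x \<in> I \<Longrightarrow> g x = v'"
      and F: "expansion_on (\<lambda>x. K + v' * x) I x0 (antideriv_coeffs c)"
      using finite_range_expansion[OF I \<open>a < b\<close> fin exp] by blast
    obtain z where "a < z" "z < b" using lc_dense[OF \<open>a < b\<close>] by blast
    then have "v' = v" using v[of z] v'[of z] interval_Ioo_subset[OF I] by auto
    then have "v * (b - a) = (K + v' * b) - (K + v' * a)" by (simp add: algebra_simps)
    then show ?thesis using F lim_within_affine by blast
  qed
  then show ?thesis using I simple False by (simp add: has_simple_integral_def)
qed

section \<open>Lengths of overlaps\<close>

text \<open>Induction that adds the interval with the greatest left end point: all the others then
  lie to its left, so the bound y is replaced by that end point.\<close>

lemma sum_nonoverlapping_le:
  fixes \<alpha> \<beta> :: "'i \<Rightarrow> 'a::linordered_idom"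
  assumes "finite S" "x \<le> y" "\<And>k. k \<in> S \<Longrightarrow> x \<le> \<alpha> k \<and> \<alpha> k < \<beta> k \<and> \<beta> k \<le> y"
    "\<And>k l. k \<in> S \<Longrightarrow> l \<in> S \<Longrightarrow> k \<noteq> l \<Longrightarrow> \<beta> k \<le> \<alpha> l \<or> \<beta> l \<le> \<alpha> k"
  shows "(\<Sum>k\<in>S. \<beta> k - \<alpha> k) \<le> y - x"
  using assms
proof (induction S arbitrary: y rule: finite_ranking_induct[where f = \<alpha>])
  case empty
  then show ?case by simp
next
  case (insert k S)
  show ?case
  proof (cases "k \<in> S")
    case True
    then show ?thesis using insert.IH[of y] insert.prems by (simp add: insert_absorb)
  next
    case False
    have k: "x \<le> \<alpha> k" "\<alpha> k < \<beta> k" "\<beta> k \<le> y" using insert.prems(2) by auto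
    have "(\<Sum>k\<in>S. \<beta> k - \<alpha> k) \<le> \<alpha> k - x"
    proof (rule insert.IH)
      show "x \<le> \<alpha> l \<and> \<alpha> l < \<beta> l \<and> \<beta> l \<le> \<alpha> k" if "l \<in> S" for l
      proof -
        have "\<alpha> l \<le> \<alpha> k" "l \<noteq> k" using that False insert.hyps by auto
        then show ?thesis using insert.prems(2)[of l] insert.prems(3)[of l k] that k by force
      qed
    qed (use k insert.prems in auto)
    then show ?thesis using False insert.hyps k by simp
  qed
qed

text \<open>The length of the intersection of the intervals with end points a, b and x, y.\<close>

definition overlap :: "'a \<Rightarrow> 'a \<Rightarrow> 'a \<Rightarrow> 'a \<Rightarrow> 'a::linordered_idom" where
  "overlap a b x y = max 0 (min b y - max a x)"

text \<open>As increments of the map that clamps a point to the interval from a to b, the overlaps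
  with adjacent cells telescope.\<close>

lemma overlap_eq_clamp_diff:
  "a \<le> b \<Longrightarrow> x \<le> y \<Longrightarrow> overlap a b x y = max a (min b y) - max a (min b x)"
  by (auto simp: overlap_def max_def min_def)

lemma overlap_nonneg [simp]: "0 \<le> overlap a b x y"
  by (simp add: overlap_def)

lemma overlap_nonzero:
  fixes a b x y :: levi_civita
  assumes "overlap a b x y \<noteq> 0"
  obtains z where "z \<in> {a<..<b}" "z \<in> {x<..<y}"
proof -
  have "max a x < min b y"
  proof (rule ccontr)
    assume "\<not> max a x < min b y"
    then have "min b y - max a x \<le> 0" by (simp only: not_less diff_le_0_iff_le)
    then show False using assms by (simp add: overlap_def max_absorb1)
  qed
  then obtain z where "max a x < z" "z < min b y" using lc_dense by blast
  then show ?thesis using that[of z] by auto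
qed

text \<open>If two of the truncated intervals overlapped, density would give a point common to two
  of the disjoint sets \<open>I k\<close>.\<close>

lemma sum_overlap_le:
  assumes "\<And>k. k \<in> S \<Longrightarrow> interval (a k) (b k) (I k)" "disjoint_family_on I S" "x \<le> y" "finite S"
  shows "(\<Sum>k\<in>S. overlap (a k) (b k) x y) \<le> y - x"
proof -
  define S' where "S' = {k \<in> S. max (a k) x < min (b k) y}"
  have "(\<Sum>k\<in>S. overlap (a k) (b k) x y) = (\<Sum>k\<in>S'. min (b k) y - max (a k) x)"
    using \<open>finite S\<close> by (intro sum.mono_neutral_cong_right) (auto simp: S'_def overlap_def)
  also have "\<dots> \<le> y - x"
  proof (rule sum_nonoverlapping_le)
    fix k l assume kl: "k \<in> S'" "l \<in> S'" "k \<noteq> l"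
    show "min (b k) y \<le> max (a l) x \<or> min (b l) y \<le> max (a k) x"
    proof (rule ccontr)
      assume "\<not> ?thesis"
      then have "max (max (a k) x) (max (a l) x) < min (min (b k) y) (min (b l) y)"
        using kl by (auto simp: S'_def)
      then obtain z where "max (max (a k) x) (max (a l) x) < z" "z < min (min (b k) y) (min (b l) y)"
        using lc_dense by blast
      then have "z \<in> {a k<..<b k}" "z \<in> {a l<..<b l}" by auto
      then have "z \<in> I k \<inter> I l"
        using subsetD[OF interval_Ioo_subset[OF assms(1)], of k z]
          subsetD[OF interval_Ioo_subset[OF assms(1)], of l z] kl by (auto simp: S'_def)
      then show False using assms(2) kl by (auto simp: S'_def disjoint_family_on_def)
    qed
  qed (use assms in \<open>auto simp: S'_def\<close>)
  finally show ?thesis .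
qed

lemma Ioo_subset_Icc_lc:
  fixes a b x y :: levi_civita
  assumes "{a<..<b} \<subseteq> {x..y}" "a < b"
  shows "x \<le> a" "b \<le> y"
proof -
  show "x \<le> a"
  proof (rule ccontr)
    assume "\<not> x \<le> a"
    then obtain z where "a < z" "z < min b x" using lc_dense[of a "min b x"] assms(2) by auto
    then have "z \<in> {a<..<b}" "z < x" by auto
    then show False using assms(1) by auto
  qed
  show "b \<le> y"
  proof (rule ccontr)
    assume "\<not> b \<le> y"
    then obtain z where "max a y < z" "z < b" using lc_dense[of "max a y" b] assms(2) by auto
    then have "z \<in> {a<..<b}" "y < z" by auto
    then show False using assms(1) by auto
  qed
qed

lemma is_sup_unique: "is_sup S m \<Longrightarrow> is_sup S n \<Longrightarrow> m = n"
  unfolding is_sup_def by (meson order_antisym)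

text \<open>The real factors may be unbounded: they do not enlarge supports, and strong convergence
  to 0 only concerns supports.\<close>

lemma strong_lim_scaleR_0:
  assumes "strong_lim X 0"
  shows "strong_lim (\<lambda>n. u n *\<^sub>R X n) 0"
  unfolding strong_lim_iff
proof
  fix q
  have "\<forall>\<^sub>F n in sequentially. \<forall>r\<le>q. coef (X n) r = coef 0 r"
    using assms by (simp add: strong_lim_iff)
  then show "\<forall>\<^sub>F n in sequentially. \<forall>r\<le>q. coef (u n *\<^sub>R X n) r = coef 0 r"
    by eventually_elim simp
qed

lemma simple_on_const: "(\<And>x. x \<in> I \<Longrightarrow> g x = v) \<Longrightarrow> simple_on g I"
  using expansion_const[of v I] unfolding simple_on_def expansion_on_def by force

section \<open>Cells of a grid: measure, and integrals of step functions\<close>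

locale grid =
  fixes N :: nat and X :: "nat \<Rightarrow> real"
  assumes N_pos: "0 < N" and X_less_Suc: "\<And>i. i < N \<Longrightarrow> X i < X (Suc i)"
begin

text \<open>Half-open except for the last one, which is closed, so that the cells partition the
  closed interval exactly.\<close>

definition cell :: "nat \<Rightarrow> levi_civita set" where
  "cell i = {x. of_real (X i) \<le> x \<and> x \<le> of_real (X (Suc i)) \<and> (Suc i < N \<longrightarrow> x < of_real (X (Suc i)))}"

abbreviation dom :: "levi_civita set" where
  "dom \<equiv> {of_real (X 0)..of_real (X N)}"

definition len :: "nat \<Rightarrow> real" where
  "len i = X (Suc i) - X i"

lemma len_pos: "i < N \<Longrightarrow> 0 < len i"
  using X_less_Suc by (simp add: len_def)

lemma X_mono: "i \<le> j \<Longrightarrow> j \<le> N \<Longrightarrow> X i \<le> X j"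
proof (induction rule: dec_induct)
  case (step n)
  then show ?case using X_less_Suc[of n] by simp
qed simp

lemma interval_cell: "i < N \<Longrightarrow> interval (of_real (X i)) (of_real (X (Suc i))) (cell i)"
  using X_less_Suc[of i] by (auto simp: interval_def cell_def)

lemma Ioo_subset_cell: "{of_real (X i)<..<of_real (X (Suc i))} \<subseteq> cell i"
  by (auto simp: cell_def)

lemma cell_disjoint:
  assumes "i < N" "j < N" "x \<in> cell i" "x \<in> cell j"
  shows "i = j"
proof (rule ccontr)
  have *: False if "i < j" "j < N" "x \<in> cell i" "x \<in> cell j" for i j
  proof -
    have "x < of_real (X (Suc i))" "of_real (X j) \<le> x" using that by (auto simp: cell_def)
    then have "X j < X (Suc i)" by (metis le_less_trans of_real_lc_less_iff)
    then show False using X_mono[of "Suc i" j] that by simp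
  qed
  assume "i \<noteq> j"
  then show False using *[of i j] *[of j i] assms by linarith
qed

lemma UN_cell: "(\<Union>i<N. cell i) = dom"
proof (intro equalityI subsetI)
  fix x assume "x \<in> (\<Union>i<N. cell i)"
  then obtain i where i: "i < N" "of_real (X i) \<le> x" "x \<le> of_real (X (Suc i))" by (auto simp: cell_def)
  have "(of_real (X 0) :: levi_civita) \<le> of_real (X i)" "(of_real (X (Suc i)) :: levi_civita) \<le> of_real (X N)"
    using X_mono[of 0 i] X_mono[of "Suc i" N] i(1) by simp_all
  then show "x \<in> dom" using i by (auto intro: order_trans simp del: of_real_lc_le_iff)
next
  fix x assume x: "x \<in> dom"
  define S where "S = {i. i < N \<and> of_real (X i) \<le> x}"
  have fin: "finite S" and "0 \<in> S" using x N_pos by (auto simp: S_def)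
  then have "Max S \<in> S" by (intro Max_in) auto
  moreover have "x < of_real (X (Suc (Max S)))" if "Suc (Max S) < N"
  proof (rule ccontr)
    assume "\<not> x < of_real (X (Suc (Max S)))"
    then have "Suc (Max S) \<in> S" using that by (simp add: S_def)
    from Max_ge[OF fin this] show False by simp
  qed
  ultimately have "x \<in> cell (Max S)"
    using x by (cases "Suc (Max S) < N") (auto simp: cell_def S_def dest: less_antisym not_less_less_Suc_eq intro: less_imp_le)
  then show "x \<in> (\<Union>i<N. cell i)" using \<open>Max S \<in> S\<close> by (auto simp: S_def)
qed

lemma sum_overlap_cells:
  assumes "a \<le> b" "a < b \<Longrightarrow> {a<..<b} \<subseteq> dom"
  shows "(\<Sum>i<N. overlap a b (of_real (X i)) (of_real (X (Suc i)))) = b - a"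
proof (cases "a < b")
  case True
  have "(\<Sum>i<N. overlap a b (of_real (X i)) (of_real (X (Suc i))))
      = (\<Sum>i<N. max a (min b (of_real (X (Suc i)))) - max a (min b (of_real (X i))))"
    using assms(1) X_less_Suc by (intro sum.cong refl overlap_eq_clamp_diff) (auto intro: less_imp_le)
  also have "\<dots> = max a (min b (of_real (X N))) - max a (min b (of_real (X 0)))"
    by (rule sum_lessThan_telescope)
  also have "\<dots> = b - a"
    using Ioo_subset_Icc_lc[OF assms(2) True] True assms(1) by (simp add: max_def min_def)
  finally show ?thesis .
next
  case False
  then show ?thesis using assms(1) by (auto simp: overlap_def intro!: sum.neutral)
qed

text \<open>An interval may meet several cells, so its length is split among them; summed over i,
  this gives back the partial sum of the lengths.\<close>

definition covered :: "(nat \<Rightarrow> levi_civita) \<Rightarrow> (nat \<Rightarrow> levi_civita) \<Rightarrow> nat \<Rightarrow> nat \<Rightarrow> levi_civita" where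
  "covered a b i n = (\<Sum>k<n. overlap (a k) (b k) (of_real (X i)) (of_real (X (Suc i))))"

text \<open>T is the set of all cells for integrals, and a subset of them when sublevel sets are
  measured for the essential supremum.\<close>

context
  fixes a b I s T
  assumes seq: "interval_seq a b I s" and sub: "(\<Union>n. I n) \<subseteq> (\<Union>i\<in>T. cell i)" and T: "T \<subseteq> {..<N}"
begin

lemma seq_interval: "interval (a k) (b k) (I k)"
  using seq by (simp add: interval_seq_def)

lemma seq_sub_dom: "{a k<..<b k} \<subseteq> dom"
proof -
  have "{a k<..<b k} \<subseteq> (\<Union>i<N. cell i)"
    using interval_Ioo_subset[OF seq_interval, of k] sub T by blast
  then show ?thesis by (simp add: UN_cell)
qed

lemma seq_sum_overlap:
  "(\<Sum>i<N. overlap (a k) (b k) (of_real (X i)) (of_real (X (Suc i)))) = b k - a k"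
  using seq_interval[of k] seq_sub_dom by (intro sum_overlap_cells) (simp_all add: interval_def)

lemma covered_le: "i < N \<Longrightarrow> covered a b i n \<le> of_real (len i)"
  unfolding covered_def len_def of_real_diff
  by (rule sum_overlap_le[where I = I])
    (use seq X_less_Suc[of i] in \<open>auto simp: interval_seq_def disjoint_family_on_def\<close>)

lemma covered_eq_0:
  assumes "i < N" "i \<notin> T"
  shows "covered a b i n = 0"
  unfolding covered_def
proof (intro sum.neutral ballI)
  fix k
  show "overlap (a k) (b k) (of_real (X i)) (of_real (X (Suc i))) = 0"
  proof (rule ccontr)
    assume "overlap (a k) (b k) (of_real (X i)) (of_real (X (Suc i))) \<noteq> 0"
    then obtain z where z: "z \<in> {a k<..<b k}" "z \<in> {of_real (X i)<..<of_real (X (Suc i))}"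
      by (rule overlap_nonzero)
    then have "z \<in> I k" "z \<in> cell i"
      using interval_Ioo_subset[OF seq_interval] Ioo_subset_cell by blast+
    then obtain j where "j \<in> T" "z \<in> cell j" using sub by blast
    then show False using cell_disjoint[of i j z] T assms \<open>z \<in> cell i\<close> by auto
  qed
qed

lemma sum_covered: "(\<Sum>i<N. covered a b i n) = (\<Sum>k<n. b k - a k)"
  unfolding covered_def by (subst sum.swap) (simp add: seq_sum_overlap)

lemma inner_sum_le: "s \<le> of_real (\<Sum>i\<in>T. len i)"
proof (rule strong_lim_le)
  show "strong_lim (\<lambda>n. \<Sum>k<n. b k - a k) s"
    using seq by (simp add: interval_seq_def strong_sums_def)
  fix n
  have "(\<Sum>k<n. b k - a k) = (\<Sum>i\<in>T. covered a b i n)"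
    unfolding sum_covered[symmetric] using T covered_eq_0 by (intro sum.mono_neutral_right) auto
  also have "\<dots> \<le> of_real (\<Sum>i\<in>T. len i)"
    unfolding of_real_sum using T covered_le by (intro sum_mono) auto
  finally show "(\<Sum>k<n. b k - a k) \<le> of_real (\<Sum>i\<in>T. len i)" .
qed

end

text \<open>Indices outside T carry the empty interval with both end points 0, which turns a finite
  family into a sequence without adding length.\<close>

lemma cells_interval_seq:
  assumes "T \<subseteq> {..<N}"
  shows "interval_seq (\<lambda>i. if i \<in> T then of_real (X i) else 0) (\<lambda>i. if i \<in> T then of_real (X (Suc i)) else 0)
    (\<lambda>i. if i \<in> T then cell i else {}) (of_real (\<Sum>i\<in>T. len i))"
  unfolding interval_seq_def
proof (intro conjI allI)
  fix i
  show "interval (if i \<in> T then of_real (X i) else 0) (if i \<in> T then of_real (X (Suc i)) else 0)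
      (if i \<in> T then cell i else {})"
    using interval_cell assms by (auto simp: interval_def[of 0 0])
next
  show "disjoint_family (\<lambda>i. if i \<in> T then cell i else {})"
    unfolding disjoint_family_on_def
  proof (intro ballI impI equals0I)
    fix i j x
    assume "i \<noteq> j" "x \<in> (if i \<in> T then cell i else {}) \<inter> (if j \<in> T then cell j else {})"
    then show False using cell_disjoint[of i j x] assms by (auto split: if_splits)
  qed
next
  have "strong_sums (\<lambda>i. (if i \<in> T then of_real (X (Suc i)) else 0) - (if i \<in> T then of_real (X i) else 0))
      (\<Sum>i\<in>T. (if i \<in> T then of_real (X (Suc i)) else 0) - (if i \<in> T then of_real (X i) else 0))"
    using finite_subset[OF assms] by (intro strong_sums_finite_support) auto
  also have "(\<Sum>i\<in>T. (if i \<in> T then of_real (X (Suc i)) else 0) - (if i \<in> T then of_real (X i) else 0))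
      = (of_real (\<Sum>i\<in>T. len i) :: levi_civita)"
    by (simp add: len_def)
  finally show "strong_sums (\<lambda>i. (if i \<in> T then of_real (X (Suc i)) else 0) - (if i \<in> T then of_real (X i) else 0))
      (of_real (\<Sum>i\<in>T. len i))" .
qed

text \<open>The padded family of cells is an inner and an outer family at once, and
  \<open>inner_sum_le\<close> makes its total length the supremum of the inner sums.\<close>

lemma
  assumes T: "T \<subseteq> {..<N}"
  shows measurable_cells: "measurable_set (\<Union>i\<in>T. cell i)"
    and meas_cells: "meas (\<Union>i\<in>T. cell i) = of_real (\<Sum>i\<in>T. len i)"
proof -
  let ?s = "of_real (\<Sum>i\<in>T. len i) :: levi_civita"
  have "(\<Union>i. if i \<in> T then cell i else {}) = (\<Union>i\<in>T. cell i)" by auto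
  with cells_interval_seq[OF T]
  have inner: "?s \<in> inner_sums (\<Union>i\<in>T. cell i)" and outer: "?s \<in> outer_sums (\<Union>i\<in>T. cell i)"
    unfolding inner_sums_def outer_sums_def by blast+
  show "measurable_set (\<Union>i\<in>T. cell i)"
    unfolding measurable_set_def using inner outer by force
  have "is_sup (inner_sums (\<Union>i\<in>T. cell i)) ?s"
    unfolding is_sup_def
  proof safe
    fix s assume "s \<in> inner_sums (\<Union>i\<in>T. cell i)"
    then show "s \<le> ?s" unfolding inner_sums_def using inner_sum_le[OF _ _ T] by blast
  qed (use inner in blast)
  then show "meas (\<Union>i\<in>T. cell i) = ?s"
    unfolding meas_def using is_sup_unique by blast
qed

lemma measurable_dom: "measurable_set dom"
  using measurable_cells[of "{..<N}"] by (simp add: UN_cell)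

lemma sum_len: "(\<Sum>i<N. len i) = X N - X 0"
  unfolding len_def by (rule sum_lessThan_telescope)

lemma meas_dom: "meas dom = of_real (X N - X 0)"
  using meas_cells[of "{..<N}"] unfolding UN_cell sum_len by simp

definition step :: "(nat \<Rightarrow> real) \<Rightarrow> (levi_civita \<Rightarrow> levi_civita) \<Rightarrow> bool" where
  "step w g \<longleftrightarrow> (\<forall>i<N. \<forall>x\<in>cell i. g x = of_real (w i))"

lemma step_finite_range:
  assumes "step w g" "I \<subseteq> dom"
  shows "finite (g ` I)"
proof (rule finite_subset)
  show "g ` I \<subseteq> (\<lambda>i. of_real (w i)) ` {..<N}"
    using assms unfolding UN_cell[symmetric] step_def by force
qed simp

lemma step_measurable_fun:
  assumes "step w g"
  shows "g \<in> measurable_funs dom"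
  unfolding measurable_funs_def mem_Collect_eq
proof (intro conjI allI impI measurable_dom)
  fix \<epsilon> :: levi_civita assume "\<epsilon> > 0"
  have "simple_on g (if i \<in> {..<N} then cell i else {})" for i
    by (rule simple_on_const[of _ _ "of_real (w i)"]) (use assms in \<open>auto simp: step_def split: if_splits\<close>)
  moreover have "(\<Union>i. if i \<in> {..<N} then cell i else {}) \<subseteq> dom" using UN_cell by (auto split: if_splits)
  moreover have "meas dom - of_real (\<Sum>i<N. len i) < \<epsilon>"
    using \<open>\<epsilon> > 0\<close> unfolding meas_dom sum_len by simp
  ultimately show "\<exists>a b I s. interval_seq a b I s \<and> (\<Union>n. I n) \<subseteq> dom \<and> meas dom - s < \<epsilon> \<and> (\<forall>n. simple_on g (I n))"
    using cells_interval_seq[OF order_refl] by blast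
qed

text \<open>For any admissible family, the partial sums of the integrals are the sums of w i times
  the covered length of cell i. They miss the claimed value by at most M times the uncovered length,
  which tends to M times the defect of s.\<close>

lemma step_has_lc_integral:
  assumes step: "step w g"
  shows "has_lc_integral dom g (of_real (\<Sum>i<N. w i * len i))"
  unfolding has_lc_integral_def
proof (intro conjI allI impI step_measurable_fun[OF step])
  fix \<epsilon> :: levi_civita assume "\<epsilon> > 0"
  define L where "L = (of_real (\<Sum>i<N. w i * len i) :: levi_civita)"
  define M where "M = (of_real (\<Sum>i<N. \<bar>w i\<bar>) :: levi_civita)"
  have M: "0 \<le> M" and M_ge: "i < N \<Longrightarrow> \<bar>of_real (w i)\<bar> \<le> M" for i
  proof -
    show "0 \<le> M" unfolding M_def using of_real_lc_le_iff[of 0 "\<Sum>i<N. \<bar>w i\<bar>"] by (simp add: sum_nonneg del: of_real_lc_le_iff)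
    show "\<bar>of_real (w i)\<bar> \<le> M" if "i < N"
      unfolding M_def using that by (simp add: member_le_sum[of i "{..<N}" "\<lambda>i. \<bar>w i\<bar>"] del: of_real_sum)
  qed
  obtain \<delta> where \<delta>: "\<delta> > 0" "\<bar>M\<bar> * \<delta> < \<epsilon>" using \<open>\<epsilon> > 0\<close> by (rule ex_small_mult)
  have "\<exists>v t. (\<forall>n. has_simple_integral g (a n) (b n) (I n) (v n)) \<and> strong_sums v t \<and> \<bar>t - L\<bar> < \<epsilon>"
    if "interval_seq a b I s \<and> (\<Union>n. I n) \<subseteq> dom \<and> (\<forall>n. simple_on g (I n)) \<and> meas dom - s < \<delta>" for a b I s
  proof -
    from that have seq: "interval_seq a b I s" and sub: "(\<Union>n. I n) \<subseteq> (\<Union>i\<in>{..<N}. cell i)"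
      and simple: "simple_on g (I n)" and s: "meas dom - s < \<delta>" for n
      by (auto simp: UN_cell)
    note ctx = seq sub order_refl
    have I: "interval (a n) (b n) (I n)" for n by (rule seq_interval[OF ctx])
    have fin: "finite (g ` I n)" for n
      using sub unfolding UN_cell by (intro step_finite_range[OF step]) blast
    \<comment> \<open>Constancy is asked on the open interval only, so a degenerate
      \<open>I n\<close> admits any u.\<close>
    have "\<exists>u. \<forall>x\<in>{a n<..<b n}. g x = of_real u" for n
    proof (cases "a n < b n")
      case True
      obtain x0 c where "expansion_on g (I n) x0 c" using simple unfolding simple_on_def by blast
      from finite_range_expansion[OF I True fin this]
      obtain v where v: "\<And>x. x \<in> I n \<Longrightarrow> g x = v" by metis
      obtain z where "a n < z" "z < b n" using lc_dense[OF True] by blast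
      then have "z \<in> {a n<..<b n}" by simp
      then have "z \<in> I n" by (rule subsetD[OF interval_Ioo_subset[OF I]])
      then obtain i where "i < N" "z \<in> cell i" using sub by blast
      then have "v = of_real (w i)" using v[OF \<open>z \<in> I n\<close>] step by (auto simp: step_def)
      then show ?thesis using v interval_Ioo_subset[OF I, of n] by blast
    qed auto
    then obtain u where u: "\<And>n x. x \<in> {a n<..<b n} \<Longrightarrow> g x = of_real (u n)" by metis
    define v where "v n = of_real (u n) * (b n - a n)" for n
    have int: "has_simple_integral g (a n) (b n) (I n) (v n)" for n
      unfolding v_def by (rule has_simple_integral_finite_range[OF I simple fin u])
    \<comment> \<open>The lengths tend to 0 strongly and the values are real factors, so the
      integrals are strongly summable.\<close>
    have "strong_lim v 0"
      using strong_lim_scaleR_0[OF strong_sums_imp_lim_0[of "\<lambda>n. b n - a n"], of s u] seq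
      by (simp add: interval_seq_def v_def[abs_def] of_real_mult_eq_scaleR)
    then obtain t where t: "strong_sums v t" using strong_summable_if_lim_0 by blast
    let ?cov = "covered a b"
    have v_eq: "v k = (\<Sum>i<N. of_real (w i) * overlap (a k) (b k) (of_real (X i)) (of_real (X (Suc i))))" for k
    proof -
      have "v k = (\<Sum>i<N. of_real (u k) * overlap (a k) (b k) (of_real (X i)) (of_real (X (Suc i))))"
        by (simp add: v_def seq_sum_overlap[OF ctx] flip: sum_distrib_left)
      also have "\<dots> = (\<Sum>i<N. of_real (w i) * overlap (a k) (b k) (of_real (X i)) (of_real (X (Suc i))))"
      proof (intro sum.cong refl)
        fix i assume i: "i \<in> {..<N}"
        show "of_real (u k) * overlap (a k) (b k) (of_real (X i)) (of_real (X (Suc i)))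
            = of_real (w i) * overlap (a k) (b k) (of_real (X i)) (of_real (X (Suc i)))"
        \<comment> \<open>A nonzero overlap provides an interior point common to the interval and
          the cell, where g takes both values.\<close>
        proof (cases "overlap (a k) (b k) (of_real (X i)) (of_real (X (Suc i))) = 0")
          case False
          then obtain z where z: "z \<in> {a k<..<b k}" "z \<in> {of_real (X i)<..<of_real (X (Suc i))}"
            by (rule overlap_nonzero)
          then have "of_real (u k) = g z" "g z = of_real (w i)"
            using u[OF z(1)] subsetD[OF Ioo_subset_cell z(2)] step i by (simp_all add: step_def)
          then show ?thesis by simp
        qed simp
      qed
      finally show ?thesis .
    qed
    have partial: "(\<Sum>k<n. v k) = (\<Sum>i<N. of_real (w i) * ?cov i n)" for n
      unfolding v_eq covered_def sum_distrib_left by (rule sum.swap)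
    define C where "C = (of_real (X N - X 0) :: levi_civita)"
    have bound: "\<bar>L - (\<Sum>k<n. v k)\<bar> \<le> M * (C - (\<Sum>k<n. b k - a k))" for n
    proof -
      have "L - (\<Sum>k<n. v k) = (\<Sum>i<N. of_real (w i) * (of_real (len i) - ?cov i n))"
        unfolding partial L_def of_real_sum by (simp add: right_diff_distrib sum_subtractf)
      also have "\<bar>\<dots>\<bar> \<le> (\<Sum>i<N. \<bar>of_real (w i) * (of_real (len i) - ?cov i n)\<bar>)" by (rule sum_abs)
      also have "\<dots> \<le> (\<Sum>i<N. M * (of_real (len i) - ?cov i n))"
      proof (rule sum_mono)
        fix i assume "i \<in> {..<N}"
        then show "\<bar>of_real (w i) * (of_real (len i) - ?cov i n)\<bar> \<le> M * (of_real (len i) - ?cov i n)"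
          using covered_le[OF ctx, of i n] M_ge[of i]
          by (simp add: abs_mult mult_right_mono del: abs_of_real_lc)
      qed
      also have "\<dots> = M * (C - (\<Sum>k<n. b k - a k))"
        unfolding C_def sum_len[symmetric] of_real_sum sum_covered[OF ctx, symmetric]
        by (simp add: sum_distrib_left sum_subtractf right_diff_distrib)
      finally show ?thesis .
    qed
    have lims: "strong_lim (\<lambda>n. M * (C - (\<Sum>k<n. b k - a k))) (M * (C - s))"
        "strong_lim (\<lambda>n. \<Sum>k<n. v k) t"
      using seq t by (auto simp: interval_seq_def strong_sums_def intro!: strong_lim_mult_const strong_lim_diff)
    \<comment> \<open>The absolute bound passes to the limit as two one-sided inequalities, for L -
      t and for t - L.\<close>
    have "0 \<le> M * (C - s) - (L - t)"
      by (rule strong_lim_nonneg[OF strong_lim_diff[OF lims(1) strong_lim_diff[OF strong_lim_const lims(2), of L]]])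
        (use bound in \<open>simp add: abs_le_iff\<close>)
    moreover have "0 \<le> M * (C - s) - (t - L)"
      by (rule strong_lim_nonneg[OF strong_lim_diff[OF lims(1) strong_lim_diff[OF lims(2) strong_lim_const, of L]]])
        (use bound in \<open>simp add: abs_le_iff\<close>)
    moreover have "M * (C - s) \<le> M * \<delta>"
      using s M unfolding meas_dom C_def by (intro mult_left_mono) auto
    ultimately have "\<bar>t - L\<bar> < \<epsilon>" using \<delta>(2) M by (simp add: abs_less_iff)
    then show ?thesis using int t by blast
  qed
  then show "\<exists>\<delta>>0. \<forall>a b I s. interval_seq a b I s \<and> (\<Union>n. I n) \<subseteq> dom \<and> (\<forall>n. simple_on g (I n)) \<and> meas dom - s < \<delta> \<longrightarrow>
      (\<exists>v t. (\<forall>n. has_simple_integral g (a n) (b n) (I n) (v n)) \<and> strong_sums v t \<and>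
        \<bar>t - of_real (\<Sum>i<N. w i * len i)\<bar> < \<epsilon>)"
    using \<delta>(1) unfolding L_def by blast
qed

end

section \<open>Powers of real elements and norms of step functions\<close>

text \<open>A positive real element has valuation 0, so h = 0, e = 0 and s = 1 are witnesses, and p
  times the valuation is rational for every real p.\<close>

lemma has_lc_powr_of_real:
  assumes "0 \<le> y"
  shows "has_lc_powr (of_real y) p (of_real (y powr p))"
proof (cases "y = 0")
  case True
  then show ?thesis by (simp add: has_lc_powr_def)
next
  case False
  then have pos: "(of_real y :: levi_civita) > 0" using assms of_real_lc_less_iff[of 0 y] by simp
  have val: "val (of_real y) = 0" using False by (intro val_eqI) auto
  have "strong_sums (\<lambda>k. of_real (p gchoose k) * (0::levi_civita) ^ k)
      (\<Sum>k\<in>{0}. of_real (p gchoose k) * (0::levi_civita) ^ k)"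
    by (rule strong_sums_finite_support) auto
  then have "strong_sums (\<lambda>k. of_real (p gchoose k) * (0::levi_civita) ^ k) 1" by simp
  then have "\<exists>h e s. of_real y = of_real (coef (of_real y) (val (of_real y))) * d_pow (val (of_real y)) * (1 + h) \<and>
        real_of_rat e = p * real_of_rat (val (of_real y)) \<and>
        strong_sums (\<lambda>k. of_real (p gchoose k) * h ^ k) s \<and>
        of_real (y powr p) = of_real (coef (of_real y) (val (of_real y)) powr p) * d_pow e * s"
    by (intro exI[of _ "0::levi_civita"] exI[of _ "0::rat"] exI[of _ "1::levi_civita"]) (simp add: val)
  then show ?thesis using pos by (simp add: has_lc_powr_def)
qed

lemma weak_lim_of_real:
  assumes "N \<longlonglongrightarrow> l"
  shows "weak_lim (\<lambda>n. of_real (N n)) (of_real l)"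
  unfolding weak_lim_def
proof (intro allI impI)
  fix \<epsilon> :: real assume "\<epsilon> > 0"
  with tendstoD[OF assms] have "\<forall>\<^sub>F n in sequentially. \<bar>N n - l\<bar> < \<epsilon>" by (simp add: dist_real_def)
  then show "\<forall>\<^sub>F n in sequentially. max_coef (inverse \<epsilon>) (of_real (N n) - of_real l) < \<epsilon>"
    using \<open>\<epsilon> > 0\<close> by (auto simp: max_coef_less_iff elim: eventually_mono)
qed

context grid
begin

definition step_norm :: "ereal \<Rightarrow> (nat \<Rightarrow> real) \<Rightarrow> real" where
  "step_norm p w = (if p = \<infinity> then Max ((\<lambda>i. \<bar>w i\<bar>) ` {..<N})
    else (\<Sum>i<N. \<bar>w i\<bar> powr real_of_ereal p * len i) powr (1 / real_of_ereal p))"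

lemma step_has_Lp_integral:
  assumes "step w g"
  shows "has_Lp_integral p dom g (of_real (\<Sum>i<N. \<bar>w i\<bar> powr p * len i))"
  unfolding has_Lp_integral_def
proof (intro conjI allI impI)
  show "g \<in> measurable_funs dom" by (rule step_measurable_fun[OF assms])
  fix n :: nat
  have "step (\<lambda>i. w i ^ n) (\<lambda>x. g x ^ n)" using assms by (simp add: step_def)
  then show "(\<lambda>x. g x ^ n) \<in> measurable_funs dom" by (rule step_measurable_fun)
next
  \<comment> \<open>On a cell g is real, so its coefficient at 0 is its value, and one formula
    defines the power on all cells.\<close>
  define h where "h x = (of_real (\<bar>coef (g x) 0\<bar> powr p) :: levi_civita)" for x
  have powr: "has_lc_powr \<bar>g x\<bar> p (h x)" if "x \<in> dom" for x
  proof -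
    have "x \<in> (\<Union>i<N. cell i)" using that unfolding UN_cell .
    then obtain i where "i < N" "x \<in> cell i" by blast
    then have "g x = of_real (w i)" using assms by (simp add: step_def)
    then show ?thesis using has_lc_powr_of_real[of "\<bar>w i\<bar>" p] by (simp add: h_def)
  qed
  have "step (\<lambda>i. \<bar>w i\<bar> powr p) h" using assms by (simp add: step_def h_def)
  from step_has_lc_integral[OF this]
  show "\<exists>h. is_abs_powr dom p g h \<and> has_lc_integral dom h (of_real (\<Sum>i<N. \<bar>w i\<bar> powr p * len i))"
    unfolding is_abs_powr_def using powr by (intro exI[of _ h] conjI ballI)
qed

text \<open>Every cell has positive length, so a union of cells of full measure contains all of
  them: a bound almost everywhere is a bound everywhere.\<close>

lemma step_ae_le_iff:
  assumes "step w g"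
  shows "ae_on dom (\<lambda>x. \<bar>g x\<bar> \<le> c) \<longleftrightarrow> (\<forall>i<N. of_real \<bar>w i\<bar> \<le> c)"
proof -
  define T where "T = {i. i < N \<and> of_real \<bar>w i\<bar> \<le> c}"
  have T: "T \<subseteq> {..<N}" by (auto simp: T_def)
  have S: "{x \<in> dom. \<bar>g x\<bar> \<le> c} = (\<Union>i\<in>T. cell i)"
    unfolding UN_cell[symmetric] using assms by (auto simp: T_def step_def)
  have "ae_on dom (\<lambda>x. \<bar>g x\<bar> \<le> c) \<longleftrightarrow> (\<Sum>i\<in>T. len i) = (\<Sum>i<N. len i)"
    unfolding ae_on_def S meas_cells[OF T] meas_dom of_real_eq_iff sum_len
    using measurable_cells[OF T] by (simp only: simp_thms)
  also have "\<dots> \<longleftrightarrow> T = {..<N}"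
  proof
    assume eq: "(\<Sum>i\<in>T. len i) = (\<Sum>i<N. len i)"
    show "T = {..<N}"
    proof (rule ccontr)
      assume "T \<noteq> {..<N}"
      then obtain j where j: "j \<in> {..<N} - T" using T by blast
      have "(\<Sum>i\<in>T. len i) < (\<Sum>i<N. len i)"
        by (rule sum_strict_mono2[OF _ T j]) (use len_pos j in \<open>auto intro: less_imp_le\<close>)
      then show False using eq by simp
    qed
  qed simp
  also have "\<dots> \<longleftrightarrow> (\<forall>i<N. of_real \<bar>w i\<bar> \<le> c)" by (auto simp: T_def)
  finally show ?thesis .
qed

lemma step_has_Lp_norm:
  assumes "step w g"
  shows "has_Lp_norm p dom g (of_real (step_norm p w))"
proof (cases "p = \<infinity>")
  case True
  define M where "M = Max ((\<lambda>i. \<bar>w i\<bar>) ` {..<N})"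
  have "M \<in> (\<lambda>i. \<bar>w i\<bar>) ` {..<N}" unfolding M_def using N_pos by (intro Max_in) auto
  then obtain j where j: "j < N" "M = \<bar>w j\<bar>" by auto
  have "\<bar>w i\<bar> \<le> M" if "i < N" for i unfolding M_def using that by (intro Max_ge) auto
  then have le: "of_real \<bar>w i\<bar> \<le> (of_real M :: levi_civita)" if "i < N" for i using that by simp
  have "(\<forall>i<N. of_real \<bar>w i\<bar> \<le> c) \<longleftrightarrow> of_real M \<le> c" for c :: levi_civita
  proof
    assume "\<forall>i<N. of_real \<bar>w i\<bar> \<le> c"
    then show "of_real M \<le> c" using j by blast
  next
    assume "of_real M \<le> c"
    then show "\<forall>i<N. of_real \<bar>w i\<bar> \<le> c" using le order_trans by blast
  qed
  \<comment> \<open>The admissible bounds form a closed ray, so their infimum exists although the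
    order is not complete.\<close>
  then have eq: "{c. ae_on dom (\<lambda>x. \<bar>g x\<bar> \<le> c)} = {of_real M..}"
    unfolding step_ae_le_iff[OF assms] by (simp only: atLeast_def)
  have "is_inf {c. ae_on dom (\<lambda>x. \<bar>g x\<bar> \<le> c)} (of_real M)"
    unfolding eq is_inf_def
  proof (intro conjI allI impI ballI)
    fix u :: levi_civita assume "\<forall>s\<in>{of_real M..}. u \<le> s"
    then show "u \<le> of_real M" by (rule bspec) simp
  qed simp
  with step_measurable_fun[OF assms] have "has_ess_sup_norm dom g (of_real M)"
    unfolding has_ess_sup_norm_def by (rule conjI)
  then show ?thesis unfolding has_Lp_norm_def step_norm_def True M_def by (simp only: if_True refl)
next
  case False
  have "0 \<le> (\<Sum>i<N. \<bar>w i\<bar> powr real_of_ereal p * len i)"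
    using len_pos by (intro sum_nonneg mult_nonneg_nonneg) (auto intro: less_imp_le)
  note powr = has_lc_powr_of_real[OF this, of "1 / real_of_ereal p"]
  show ?thesis
    unfolding has_Lp_norm_def step_norm_def if_not_P[OF False]
    by (rule exI, rule conjI, rule step_has_Lp_integral[OF assms], rule powr)
qed

lemma step_in_Lp_space:
  assumes "step w g"
  shows "g \<in> Lp_space p dom"
proof (cases "p = \<infinity>")
  case True
  then have "has_ess_sup_norm dom g (of_real (step_norm p w))"
    using step_has_Lp_norm[OF assms, of p] by (simp only: has_Lp_norm_def if_True)
  then show ?thesis unfolding Lp_space_def if_P[OF True] by (intro CollectI exI)
next
  case False
  show ?thesis
    unfolding Lp_space_def if_not_P[OF False] by (intro CollectI exI) (rule step_has_Lp_integral[OF assms])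
qed

lemma step_norm_nonneg: "0 \<le> step_norm p w"
proof (cases "p = \<infinity>")
  case True
  have "\<bar>w 0\<bar> \<le> Max ((\<lambda>i. \<bar>w i\<bar>) ` {..<N})" using N_pos by (intro Max_ge) auto
  then show ?thesis using True abs_ge_zero[of "w 0"] unfolding step_norm_def by simp
qed (simp add: step_norm_def)

text \<open>The factor \<open>max 1 (X N - X 0)\<close> dominates
  \<open>(X N - X 0) powr (1 / q)\<close> for all q \<ge> 1 and also serves p = \<infinity>, so one
  bound covers every exponent.\<close>

lemma step_norm_le:
  assumes w: "\<And>i. i < N \<Longrightarrow> \<bar>w i\<bar> \<le> \<eta>" and p: "1 \<le> p"
  shows "step_norm p w \<le> \<eta> * max 1 (X N - X 0)"
proof -
  have \<eta>: "0 \<le> \<eta>" using w[OF N_pos] by linarith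
  have ge: "\<eta> * 1 \<le> \<eta> * max 1 (X N - X 0)" using \<eta> by (intro mult_left_mono) auto
  show ?thesis
  proof (cases "p = \<infinity>")
    case True
    have "Max ((\<lambda>i. \<bar>w i\<bar>) ` {..<N}) \<le> \<eta>" using w N_pos by (subst Max_le_iff) auto
    then show ?thesis using True ge by (simp add: step_norm_def)
  next
    case False
    define q where "q = real_of_ereal p"
    have q: "1 \<le> q" using p False unfolding q_def by (cases p) auto
    have D: "0 \<le> X N - X 0" using X_mono[of 0 N] by simp
    have "(\<Sum>i<N. \<bar>w i\<bar> powr q * len i) \<le> (\<Sum>i<N. \<eta> powr q * len i)"
      using w q len_pos by (intro sum_mono mult_right_mono powr_mono2) (auto intro: less_imp_le)
    also have "\<dots> = \<eta> powr q * (X N - X 0)" by (simp add: sum_len flip: sum_distrib_left)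
    finally have "(\<Sum>i<N. \<bar>w i\<bar> powr q * len i) powr (1 / q) \<le> (\<eta> powr q * (X N - X 0)) powr (1 / q)"
      using q len_pos by (intro powr_mono2 sum_nonneg mult_nonneg_nonneg) (auto intro: less_imp_le)
    also have "\<dots> = \<eta> * (X N - X 0) powr (1 / q)"
      using q \<eta> D by (simp add: powr_mult powr_powr)
    also have "\<dots> \<le> \<eta> * max 1 (X N - X 0)"
    proof (intro mult_left_mono \<eta>)
      have "(X N - X 0) powr (1 / q) \<le> max 1 (X N - X 0) powr (1 / q)"
        using D q by (intro powr_mono2) auto
      also have "\<dots> \<le> max 1 (X N - X 0) powr 1" using q by (intro powr_mono) auto
      finally show "(X N - X 0) powr (1 / q) \<le> max 1 (X N - X 0)" by simp
    qed
    finally show ?thesis using False by (simp add: step_norm_def q_def)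
  qed
qed

text \<open>Induction over the cells: on each, the error is the integral of
  \<open>\<phi> (X n) - \<phi> t\<close>, at most \<eta> times the length.\<close>

lemma riemann_sum_error:
  assumes cont: "continuous_on {X 0..X N} \<phi>"
    and \<eta>: "\<And>i t. i < N \<Longrightarrow> t \<in> {X i..X (Suc i)} \<Longrightarrow> \<bar>\<phi> (X i) - \<phi> t\<bar> \<le> \<eta>"
  shows "\<bar>(\<Sum>i<N. \<phi> (X i) * len i) - integral {X 0..X N} \<phi>\<bar> \<le> \<eta> * (X N - X 0)"
proof -
  have "\<bar>(\<Sum>i<n. \<phi> (X i) * len i) - integral {X 0..X n} \<phi>\<bar> \<le> \<eta> * (X n - X 0)" if "n \<le> N" for n
    using that
  proof (induction n)
    case (Suc n)
    have le: "X 0 \<le> X n" "X n \<le> X (Suc n)" "X (Suc n) \<le> X N"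
      using Suc.prems X_mono[of 0 n] X_mono[of n "Suc n"] X_mono[of "Suc n" N] by simp_all
    have cont': "continuous_on {X 0..X (Suc n)} \<phi>" "continuous_on {X n..X (Suc n)} \<phi>"
      using le by (auto intro: continuous_on_subset[OF cont])
    have split: "integral {X 0..X (Suc n)} \<phi> = integral {X 0..X n} \<phi> + integral {X n..X (Suc n)} \<phi>"
      using le cont'(1) by (intro Henstock_Kurzweil_Integration.integral_combine[symmetric] integrable_continuous_interval)
    have "integral {X n..X (Suc n)} (\<lambda>t. \<phi> (X n) - \<phi> t) = \<phi> (X n) * len n - integral {X n..X (Suc n)} \<phi>"
      using le cont'(2) by (subst integral_diff) (auto simp: len_def mult.commute intro!: integrable_continuous_interval)
    moreover have "norm (integral {X n..X (Suc n)} (\<lambda>t. \<phi> (X n) - \<phi> t)) \<le> \<eta> * (X (Suc n) - X n)"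
      using le cont'(2) \<eta>[of n] Suc.prems by (intro integral_bound continuous_intros) auto
    ultimately have "\<bar>\<phi> (X n) * len n - integral {X n..X (Suc n)} \<phi>\<bar> \<le> \<eta> * (X (Suc n) - X n)" by simp
    moreover have "\<bar>(\<Sum>i<n. \<phi> (X i) * len i) - integral {X 0..X n} \<phi>\<bar> \<le> \<eta> * (X n - X 0)"
      using Suc by simp
    moreover have "\<eta> * (X (Suc n) - X 0) = \<eta> * (X n - X 0) + \<eta> * (X (Suc n) - X n)"
      by (simp add: algebra_simps)
    ultimately show ?case unfolding split by simp
  qed simp
  then show ?thesis by blast
qed

end

text \<open>If the essential supremum were smaller than the maximum, some sublevel set
  \<open>C\<close> below the maximum would be closed and contain almost all of the open interval,
  hence all of it, and by closure also z, which may be an end point.\<close>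

lemma esssup_continuous:
  fixes f :: "real \<Rightarrow> real"
  assumes "a < b" and cont: "continuous_on {a..b} f" and z: "z \<in> {a..b}" "\<And>t. t \<in> {a..b} \<Longrightarrow> f t \<le> f z"
  shows "esssup (restrict_space lborel {a..b}) (\<lambda>x. ereal (f x)) = ereal (f z)"
proof (rule antisym)
  let ?M = "restrict_space lborel {a..b}"
  have "f \<in> borel_measurable ?M"
    using borel_measurable_continuous_on_restrict[OF cont]
    by (subst measurable_cong_sets[OF sets_restrict_space_cong[OF sets_lborel] refl])
  then have meas: "(\<lambda>x. ereal (f x)) \<in> borel_measurable ?M" by simp
  show "esssup ?M (\<lambda>x. ereal (f x)) \<le> ereal (f z)"
    using z(2) by (intro esssup_I meas AE_I2) (simp add: space_restrict_space)
  show "ereal (f z) \<le> esssup ?M (\<lambda>x. ereal (f x))"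
  proof (rule ccontr)
    assume "\<not> ?thesis"
    then obtain r where r: "esssup ?M (\<lambda>x. ereal (f x)) < ereal r" "r < f z"
      using ereal_dense2[of "esssup ?M (\<lambda>x. ereal (f x))" "ereal (f z)"]
      by (metis less_ereal.simps(1) not_le)
    define C where "C = {x \<in> {a..b}. f x \<le> r}"
    have "closed C"
      using continuous_closed_preimage[OF cont closed_atLeastAtMost, of "{..r}"]
      by (simp add: C_def vimage_def Int_def)
    have "AE x in ?M. ereal (f x) \<le> esssup ?M (\<lambda>x. ereal (f x))" by (rule esssup_AE)
    then have "AE x in lborel. x \<in> {a..b} \<longrightarrow> ereal (f x) \<le> esssup ?M (\<lambda>x. ereal (f x))"
      by (subst (asm) AE_restrict_space_iff) auto
    then have "AE x in lborel. x \<in> {a<..<b} \<longrightarrow> x \<in> C"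
    proof (rule AE_mp, intro AE_I2 impI)
      fix x assume "x \<in> {a..b} \<longrightarrow> ereal (f x) \<le> esssup ?M (\<lambda>x. ereal (f x))" "x \<in> {a<..<b}"
      then have "ereal (f x) \<le> esssup ?M (\<lambda>x. ereal (f x))" by simp
      from le_less_trans[OF this r(1)] have "f x < r" by simp
      then show "x \<in> C" using \<open>x \<in> {a<..<b}\<close> by (simp add: C_def)
    qed
    then have "AE x \<in> {a<..<b} in lebesgue. x \<in> C" by (rule AE_completion)
    from mem_closed_if_AE_lebesgue_open[OF _ \<open>closed C\<close> this]
    have "{a<..<b} \<subseteq> C" by auto
    then have "closure {a<..<b} \<subseteq> C" using \<open>closed C\<close> by (rule closure_minimal)
    then have "z \<in> C" using \<open>a < b\<close> z(1) by auto
    then show False using r(2) by (simp add: C_def)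
  qed
qed

section \<open>Dyadic approximation\<close>

definition dyadic_point :: "real \<Rightarrow> real \<Rightarrow> nat \<Rightarrow> nat \<Rightarrow> real" where
  "dyadic_point a b n i = a + (b - a) * (real i / 2 ^ n)"

locale dyadic =
  fixes a b :: real
  assumes less: "a < b"
begin

abbreviation pt :: "nat \<Rightarrow> nat \<Rightarrow> real" where
  "pt \<equiv> dyadic_point a b"

sublocale D: grid "2 ^ n" "pt n" for n
proof
  fix i
  have "(b - a) * (real i / 2 ^ n) < (b - a) * (real (Suc i) / 2 ^ n)"
    using less by (intro mult_strict_left_mono divide_strict_right_mono) auto
  then show "pt n i < pt n (Suc i)" by (simp add: dyadic_point_def)
qed simp

lemma pt_0 [simp]: "pt n 0 = a" and pt_last [simp]: "pt n (2 ^ n) = b"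
  by (simp_all add: dyadic_point_def)

lemma pt_in: "i \<le> 2 ^ n \<Longrightarrow> pt n i \<in> {a..b}"
  using D.X_mono[of 0 i n] D.X_mono[of i "2 ^ n" n] by simp

lemma pt_refine: "n \<le> M \<Longrightarrow> pt M (j * 2 ^ (M - n)) = pt n j"
  by (auto simp: dyadic_point_def power_add dest!: le_Suc_ex)

text \<open>\<open>i div 2 ^ (M - n)\<close> is the index of the coarse cell containing the fine
  cell i. The last claim matters because only the last cell of a grid contains its right end
  point.\<close>

lemma parent_index:
  assumes "n \<le> M" "i < 2 ^ M"
  defines "j \<equiv> i div 2 ^ (M - n)"
  shows "j < 2 ^ n" "pt n j \<le> pt M i" "pt M (Suc i) \<le> pt n (Suc j)"
    "Suc j < 2 ^ n \<Longrightarrow> Suc i < 2 ^ M"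
proof -
  have pow: "2 ^ M = 2 ^ n * (2::nat) ^ (M - n)" using assms(1) by (simp flip: power_add)
  have j: "j * 2 ^ (M - n) \<le> i" "i < Suc j * 2 ^ (M - n)"
    using dividend_less_div_times[of "2 ^ (M - n)" i] by (simp_all add: j_def)
  show "j < 2 ^ n" using assms(2) unfolding j_def pow by (simp add: less_mult_imp_div_less)
  then have "Suc j * 2 ^ (M - n) \<le> 2 ^ M" unfolding pow by (intro mult_right_mono) auto
  then show "pt M (Suc i) \<le> pt n (Suc j)"
    unfolding pt_refine[OF assms(1), symmetric] using j by (intro D.X_mono) auto
  show "pt n j \<le> pt M i"
    unfolding pt_refine[OF assms(1), symmetric] using j assms(2) by (intro D.X_mono) auto
  assume "Suc j < 2 ^ n"
  then have "Suc j * 2 ^ (M - n) < 2 ^ M"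
    unfolding pow by (rule mult_strict_right_mono) simp
  then show "Suc i < 2 ^ M" using j by linarith
qed

lemma cell_refine:
  assumes "n \<le> M" "i < 2 ^ M" "x \<in> D.cell M i"
  shows "x \<in> D.cell n (i div 2 ^ (M - n))"
proof -
  note idx = parent_index[OF assms(1,2)]
  have le: "(of_real (pt n (i div 2 ^ (M - n))) :: levi_civita) \<le> of_real (pt M i)"
    "(of_real (pt M (Suc i)) :: levi_civita) \<le> of_real (pt n (Suc (i div 2 ^ (M - n))))"
    using idx by simp_all
  have x: "of_real (pt M i) \<le> x" "x \<le> of_real (pt M (Suc i))" "Suc i < 2 ^ M \<longrightarrow> x < of_real (pt M (Suc i))"
    using assms(3) by (auto simp: D.cell_def)
  show ?thesis unfolding D.cell_def mem_Collect_eq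
  proof (intro conjI impI)
    show "of_real (pt n (i div 2 ^ (M - n))) \<le> x" by (rule order_trans[OF le(1) x(1)])
    show "x \<le> of_real (pt n (Suc (i div 2 ^ (M - n))))" by (rule order_trans[OF x(2) le(2)])
    assume "Suc (i div 2 ^ (M - n)) < 2 ^ n"
    then have "x < of_real (pt M (Suc i))" using idx(4) x(3) by blast
    then show "x < of_real (pt n (Suc (i div 2 ^ (M - n))))" using le(2) by (rule less_le_trans)
  qed
qed

lemma real_cell:
  assumes "t \<in> {a..b}"
  obtains i where "i < 2 ^ n" "of_real t \<in> D.cell n i" "t \<in> {pt n i..pt n (Suc i)}"
proof -
  have "(of_real t :: levi_civita) \<in> {of_real (pt n 0)..of_real (pt n (2 ^ n))}" using assms by simp
  then obtain i where "i < 2 ^ n" "of_real t \<in> D.cell n i" unfolding D.UN_cell[symmetric] by blast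
  then show ?thesis using that[of i] by (simp add: D.cell_def)
qed

lemma uniform_on_cells:
  assumes "continuous_on {a..b} \<phi>" "\<epsilon> > 0"
  obtains n0 where "\<And>n i t. n \<ge> n0 \<Longrightarrow> i < 2 ^ n \<Longrightarrow> t \<in> {pt n i..pt n (Suc i)} \<Longrightarrow>
    \<bar>\<phi> (pt n i) - \<phi> t :: real\<bar> < \<epsilon>"
proof -
  have "uniformly_continuous_on {a..b} \<phi>"
    by (intro compact_uniformly_continuous assms compact_Icc)
  then obtain \<delta> where \<delta>: "\<delta> > 0"
    "\<And>s t. s \<in> {a..b} \<Longrightarrow> t \<in> {a..b} \<Longrightarrow> \<bar>s - t\<bar> < \<delta> \<Longrightarrow> \<bar>\<phi> s - \<phi> t\<bar> < \<epsilon>"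
    using \<open>\<epsilon> > 0\<close> unfolding uniformly_continuous_on_def dist_real_def by metis
  have "(\<lambda>n. (b - a) / 2 ^ n) \<longlonglongrightarrow> 0" by real_asymp
  from order_tendstoD(2)[OF this \<delta>(1)] obtain n0 where n0: "\<And>n. n \<ge> n0 \<Longrightarrow> (b - a) / 2 ^ n < \<delta>"
    by (auto simp: eventually_sequentially)
  have "\<bar>\<phi> (pt n i) - \<phi> t\<bar> < \<epsilon>" if "n \<ge> n0" "i < 2 ^ n" "t \<in> {pt n i..pt n (Suc i)}" for n i t
  proof (rule \<delta>(2))
    show "pt n i \<in> {a..b}" using that(2) by (intro pt_in) simp
    have "pt n (Suc i) \<in> {a..b}" using that(2) by (intro pt_in) simp
    then show "t \<in> {a..b}" using that(3) \<open>pt n i \<in> {a..b}\<close> by simp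
    have "pt n (Suc i) = pt n i + (b - a) / 2 ^ n" by (simp add: dyadic_point_def field_simps)
    then show "\<bar>pt n i - t\<bar> < \<delta>" using n0[OF that(1)] that(3) by simp
  qed
  then show ?thesis by (rule that)
qed

lemma riemann_sums_tendsto:
  assumes "continuous_on {a..b} \<phi>"
  shows "(\<lambda>n. \<Sum>i<2 ^ n. \<phi> (pt n i) * D.len n i) \<longlonglongrightarrow> integral {a..b} \<phi>"
proof (rule LIMSEQ_I)
  fix \<epsilon> :: real assume "\<epsilon> > 0"
  \<comment> \<open>Halving leaves room for the strict inequality: \<open>riemann_sum_error\<close>
    gives a total error of at most \<epsilon> / 2.\<close>
  define \<eta> where "\<eta> = \<epsilon> / 2 / (b - a)"
  have "\<eta> > 0" using \<open>\<epsilon> > 0\<close> less by (simp add: \<eta>_def)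
  from uniform_on_cells[OF assms this]
  obtain n0 where n0: "\<And>n i t. n \<ge> n0 \<Longrightarrow> i < 2 ^ n \<Longrightarrow> t \<in> {pt n i..pt n (Suc i)} \<Longrightarrow> \<bar>\<phi> (pt n i) - \<phi> t\<bar> < \<eta>"
    by metis
  have "norm ((\<Sum>i<2 ^ n. \<phi> (pt n i) * D.len n i) - integral {a..b} \<phi>) < \<epsilon>" if "n \<ge> n0" for n
  proof -
    have "\<bar>(\<Sum>i<2 ^ n. \<phi> (pt n i) * D.len n i) - integral {a..b} \<phi>\<bar> \<le> \<eta> * (b - a)"
      using D.riemann_sum_error[of n \<phi> \<eta>] assms n0[OF that] by (simp add: less_imp_le)
    also have "\<eta> * (b - a) = \<epsilon> / 2"
      using less by (intro iffD1[OF nonzero_eq_divide_eq \<eta>_def]) simp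
    finally show ?thesis using \<open>\<epsilon> > 0\<close> by simp
  qed
  then show "\<exists>n0. \<forall>n\<ge>n0. norm ((\<Sum>i<2 ^ n. \<phi> (pt n i) * D.len n i) - integral {a..b} \<phi>) < \<epsilon>" by blast
qed

text \<open>The point z lies in some cell, and the value at the left end point of that cell, which
  enters the maximum, is within \<epsilon> of the value at z.\<close>

lemma max_tendsto:
  assumes cont: "continuous_on {a..b} \<phi>" and z: "z \<in> {a..b}" "\<And>t. t \<in> {a..b} \<Longrightarrow> \<phi> t \<le> \<phi> z"
  shows "(\<lambda>n. Max ((\<lambda>i. \<phi> (pt n i)) ` {..<2 ^ n})) \<longlonglongrightarrow> (\<phi> z :: real)"
proof (rule LIMSEQ_I)
  fix \<epsilon> :: real assume "\<epsilon> > 0"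
  from uniform_on_cells[OF cont this]
  obtain n0 where n0: "\<And>n i t. n \<ge> n0 \<Longrightarrow> i < 2 ^ n \<Longrightarrow> t \<in> {pt n i..pt n (Suc i)} \<Longrightarrow> \<bar>\<phi> (pt n i) - \<phi> t\<bar> < \<epsilon>"
    by metis
  have "norm (Max ((\<lambda>i. \<phi> (pt n i)) ` {..<2 ^ n}) - \<phi> z) < \<epsilon>" if "n \<ge> n0" for n
  proof -
    obtain i where i: "i < 2 ^ n" "z \<in> {pt n i..pt n (Suc i)}" using real_cell[OF z(1)] by blast
    have "\<phi> (pt n i) \<le> Max ((\<lambda>i. \<phi> (pt n i)) ` {..<2 ^ n})" using i by (intro Max_ge) auto
    moreover have "Max ((\<lambda>i. \<phi> (pt n i)) ` {..<2 ^ n}) \<le> \<phi> z"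
      using i by (subst Max_le_iff) (auto intro!: z(2) simp del: atLeastAtMost_iff intro: pt_in less_imp_le)
    ultimately show ?thesis using n0[OF that i] by simp
  qed
  then show "\<exists>n0. \<forall>n\<ge>n0. norm (Max ((\<lambda>i. \<phi> (pt n i)) ` {..<2 ^ n}) - \<phi> z) < \<epsilon>" by blast
qed

text \<open>Inside the interval the cells form a partition, so \<open>SOME\<close> has exactly one
  candidate there.\<close>

definition approx :: "(real \<Rightarrow> real) \<Rightarrow> nat \<Rightarrow> levi_civita \<Rightarrow> levi_civita" where
  "approx f n x = of_real (f (pt n (SOME i. i < 2 ^ n \<and> x \<in> D.cell n i)))"

lemma approx_cell:
  assumes "i < 2 ^ n" "x \<in> D.cell n i"
  shows "approx f n x = of_real (f (pt n i))"
proof -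
  have "(SOME i. i < 2 ^ n \<and> x \<in> D.cell n i) = i"
    by (rule some_equality) (use assms D.cell_disjoint in blast)+
  then show ?thesis by (simp add: approx_def)
qed

text \<open>Reading an approximant on a finer grid allows two of them to be subtracted cell by
  cell.\<close>

lemma step_approx:
  assumes "n \<le> M"
  shows "D.step M (\<lambda>i. f (pt n (i div 2 ^ (M - n)))) (approx f n)"
  unfolding D.step_def
  using approx_cell[OF parent_index(1)[OF assms] cell_refine[OF assms]] by blast

lemma step_norm_tendsto:
  assumes cont: "continuous_on {a..b} f" and p: "1 \<le> p"
  shows "(\<lambda>n. D.step_norm n p (\<lambda>i. f (pt n i))) \<longlonglongrightarrow> real_Lp_norm p a b f"
proof (cases "p = \<infinity>")
  case True
  have cont_abs: "continuous_on {a..b} (\<lambda>x. \<bar>f x\<bar>)" by (intro continuous_intros cont)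
  obtain z where z: "z \<in> {a..b}" "\<And>t. t \<in> {a..b} \<Longrightarrow> \<bar>f t\<bar> \<le> \<bar>f z\<bar>"
    using continuous_attains_sup[OF compact_Icc _ cont_abs] less by auto
  have "real_Lp_norm p a b f = \<bar>f z\<bar>"
    using esssup_continuous[OF less cont_abs z] True by (simp add: real_Lp_norm_def)
  then show ?thesis using max_tendsto[OF cont_abs z] True by (simp add: D.step_norm_def)
next
  case False
  define q where "q = real_of_ereal p"
  have q: "1 \<le> q" using p False unfolding q_def by (cases p) auto
  have cont_q: "continuous_on {a..b} (\<lambda>x. \<bar>f x\<bar> powr q)"
    using q by (intro continuous_on_powr' continuous_intros cont) auto
  have "set_integrable lborel {a..b} (\<lambda>x. \<bar>f x\<bar> powr q)"
    by (rule borel_integrable_atLeastAtMost'[OF cont_q])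
  then have "(LINT x:{a..b}|lborel. \<bar>f x\<bar> powr q) = integral {a..b} (\<lambda>x. \<bar>f x\<bar> powr q)"
    by (rule set_borel_integral_eq_integral)
  then have norm: "real_Lp_norm p a b f = integral {a..b} (\<lambda>x. \<bar>f x\<bar> powr q) powr (1 / q)"
    using False by (simp add: real_Lp_norm_def q_def)
  have "(\<lambda>n. (\<Sum>i<2 ^ n. \<bar>f (pt n i)\<bar> powr q * D.len n i) powr (1 / q))
      \<longlonglongrightarrow> integral {a..b} (\<lambda>x. \<bar>f x\<bar> powr q) powr (1 / q)"
  \<comment> \<open>The limit integral may be 0; continuity of the power there needs nonnegative
    sums and a positive exponent.\<close>
  proof (rule tendsto_powr'[OF riemann_sums_tendsto[OF cont_q] tendsto_const])
    have "0 \<le> (\<Sum>i<2 ^ n. \<bar>f (pt n i)\<bar> powr q * D.len n i)" for n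
      using D.len_pos[of _ n] by (intro sum_nonneg mult_nonneg_nonneg) (auto intro: less_imp_le)
    then show "integral {a..b} (\<lambda>x. \<bar>f x\<bar> powr q) \<noteq> 0 \<or> 0 < 1 / q \<and>
        (\<forall>\<^sub>F n in sequentially. 0 \<le> (\<Sum>i<2 ^ n. \<bar>f (pt n i)\<bar> powr q * D.len n i))"
      using q by simp
  qed
  then show ?thesis unfolding norm D.step_norm_def if_not_P[OF False] q_def .
qed

lemma weakly_Cauchy_approx:
  assumes cont: "continuous_on {a..b} f" and p: "1 \<le> p"
  shows "weakly_Cauchy_Lp p {of_real a..of_real b} (approx f)"
  unfolding weakly_Cauchy_Lp_def
proof (intro conjI allI impI)
  show "approx f n \<in> Lp_space p {of_real a..of_real b}" for n
    using D.step_in_Lp_space[OF step_approx[OF order_refl]] by simp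
next
  fix \<epsilon> :: real assume "\<epsilon> > 0"
  \<comment> \<open>Each approximant contributes one \<eta> and the norm bound a factor
    \<open>max 1 (b - a)\<close>, so the total is \<epsilon> / 2.\<close>
  define \<eta> where "\<eta> = \<epsilon> / (4 * max 1 (b - a))"
  have "\<eta> > 0" using \<open>\<epsilon> > 0\<close> by (simp add: \<eta>_def)
  from uniform_on_cells[OF cont this]
  obtain n0 where n0: "\<And>n i t. n \<ge> n0 \<Longrightarrow> i < 2 ^ n \<Longrightarrow> t \<in> {pt n i..pt n (Suc i)} \<Longrightarrow> \<bar>f (pt n i) - f t\<bar> < \<eta>"
    by metis
  have "\<exists>N. has_Lp_norm p {of_real a..of_real b} (\<lambda>x. approx f n x - approx f m x) N \<and> max_coef (inverse \<epsilon>) N < \<epsilon>"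
    if "m > n0" "n > n0" for m n
  proof -
    define M where "M = max m n"
    have M: "m \<le> M" "n \<le> M" by (simp_all add: M_def)
    define w where "w i = f (pt n (i div 2 ^ (M - n))) - f (pt m (i div 2 ^ (M - m)))" for i
    have step: "D.step M w (\<lambda>x. approx f n x - approx f m x)"
      using step_approx[OF M(1), of f] step_approx[OF M(2), of f] by (simp add: D.step_def w_def)
    \<comment> \<open>Both approximants are compared with the value of f at the left end point of
      the common fine cell.\<close>
    have near: "\<bar>f (pt k (i div 2 ^ (M - k))) - f (pt M i)\<bar> < \<eta>" if "i < 2 ^ M" "k \<le> M" "k > n0" for i k
    proof (rule n0)
      note idx = parent_index[OF that(2,1)]
      show "i div 2 ^ (M - k) < 2 ^ k" by (rule idx)
      show "pt M i \<in> {pt k (i div 2 ^ (M - k))..pt k (Suc (i div 2 ^ (M - k)))}"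
        using idx(2,3) D.X_less_Suc[OF that(1)] by simp
    qed (use that in simp)
    have "\<bar>w i\<bar> \<le> 2 * \<eta>" if "i < 2 ^ M" for i
      using near[OF that M(1) \<open>m > n0\<close>] near[OF that M(2) \<open>n > n0\<close>] by (simp add: w_def)
    from D.step_norm_le[OF this p] have "D.step_norm M p w \<le> 2 * \<eta> * max 1 (b - a)" by simp
    also have "\<dots> < \<epsilon>" using \<open>\<epsilon> > 0\<close> by (simp add: \<eta>_def)
    finally have "\<bar>D.step_norm M p w\<bar> < \<epsilon>" using D.step_norm_nonneg[of M p w] by simp
    \<comment> \<open>A real element has no coefficient besides the one at exponent 0, so the bound
      on its absolute value suffices for every range of exponents.\<close>
    then have "max_coef (inverse \<epsilon>) (of_real (D.step_norm M p w)) < \<epsilon>"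
      using \<open>\<epsilon> > 0\<close> by (simp add: max_coef_less_iff)
    moreover have "has_Lp_norm p {of_real a..of_real b} (\<lambda>x. approx f n x - approx f m x)
        (of_real (D.step_norm M p w))"
      using D.step_has_Lp_norm[OF step, of p] by simp
    ultimately show ?thesis by blast
  qed
  then show "\<exists>n0. \<forall>m>n0. \<forall>n>n0. \<exists>N. has_Lp_norm p {of_real a..of_real b} (\<lambda>x. approx f n x - approx f m x) N \<and>
      max_coef (inverse \<epsilon>) N < \<epsilon>" by blast
qed

lemma approx_tendsto:
  assumes cont: "continuous_on {a..b} f" and t: "t \<in> {a..b}"
  shows "weak_lim (\<lambda>n. approx f n (of_real t)) (of_real (f t))"
proof -
  have "\<exists>s. approx f n (of_real t) = of_real (f s) \<and> (\<exists>i<2 ^ n. s = pt n i \<and> t \<in> {pt n i..pt n (Suc i)})" for n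
  proof -
    obtain i where "i < 2 ^ n" "of_real t \<in> D.cell n i" "t \<in> {pt n i..pt n (Suc i)}" by (rule real_cell[OF t])
    then show ?thesis using approx_cell by blast
  qed
  then obtain s where s: "\<And>n. approx f n (of_real t) = of_real (f (s n))"
      "\<And>n. \<exists>i<2 ^ n. s n = pt n i \<and> t \<in> {pt n i..pt n (Suc i)}" by metis
  have "(\<lambda>n. f (s n)) \<longlonglongrightarrow> f t"
  proof (rule LIMSEQ_I)
    fix \<epsilon> :: real assume "\<epsilon> > 0"
    from uniform_on_cells[OF cont this]
    obtain n0 where "\<And>n i t. n \<ge> n0 \<Longrightarrow> i < 2 ^ n \<Longrightarrow> t \<in> {pt n i..pt n (Suc i)} \<Longrightarrow> \<bar>f (pt n i) - f t\<bar> < \<epsilon>"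
      by metis
    then show "\<exists>n0. \<forall>n\<ge>n0. norm (f (s n) - f t) < \<epsilon>" using s(2) by (metis real_norm_def)
  qed
  then show ?thesis unfolding s(1) by (rule weak_lim_of_real)
qed

end

theorem proposition5p3:
  fixes a b :: real and f :: "real \<Rightarrow> real"
  assumes "a < b" and "continuous_on {a..b} f"
  shows "\<exists>P :: nat \<Rightarrow> levi_civita \<Rightarrow> levi_civita.
    (\<forall>n. P n \<in> measurable_funs {of_real a..of_real b}) \<and>
    (\<forall>p::ereal. 1 \<le> p \<longrightarrow>
       weakly_Cauchy_Lp p {of_real a..of_real b} P \<and>
       (\<exists>N. (\<forall>n. has_Lp_norm p {of_real a..of_real b} (P n) (N n)) \<and>
          weak_lim N (of_real (real_Lp_norm p a b f))) \<and>
       (\<forall>x\<in>{a..b}. weak_lim (\<lambda>n. P n (of_real x)) (of_real (f x))))"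
proof -
  interpret dyadic a b by unfold_locales (rule assms(1))
  \<comment> \<open>For M = n each cell is its own parent, as \<open>i div 2 ^ 0\<close> is
    i.\<close>
  have step: "D.step n (\<lambda>i. f (pt n i)) (approx f n)" for n
    using step_approx[OF order_refl, of n f] by simp
  show ?thesis
  proof (intro exI[of _ "approx f"] conjI allI impI ballI)
    show "approx f n \<in> measurable_funs {of_real a..of_real b}" for n
      using D.step_measurable_fun[OF step] by simp
    fix p :: ereal assume p: "1 \<le> p"
    show "weakly_Cauchy_Lp p {of_real a..of_real b} (approx f)"
      by (rule weakly_Cauchy_approx[OF assms(2) p])
    have "has_Lp_norm p {of_real a..of_real b} (approx f n) (of_real (D.step_norm n p (\<lambda>i. f (pt n i))))" for n
      using D.step_has_Lp_norm[OF step, of p n] by simp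
    with weak_lim_of_real[OF step_norm_tendsto[OF assms(2) p]]
    show "\<exists>N. (\<forall>n. has_Lp_norm p {of_real a..of_real b} (approx f n) (N n)) \<and>
        weak_lim N (of_real (real_Lp_norm p a b f))"
      by (intro exI[of _ "\<lambda>n. of_real (D.step_norm n p (\<lambda>i. f (pt n i)))"] conjI allI)
    show "weak_lim (\<lambda>n. approx f n (of_real x)) (of_real (f x))" if "x \<in> {a..b}" for x
      by (rule approx_tendsto[OF assms(2) that])
  qed
qed

end
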